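(* Let $d\ge 1$, $\sigma>0$, let $P$ be a Borel probability measure on $\mathbb{R}^d$, let $X_1,X_2,\dots$ be i.i.d. with distribution $P$, and let $P_n=n^{-1}\sum_{i=1}^n\delta_{X_i}$. Suppose that $$\int_{\mathbb{R}^{d}} \sqrt{\mathrm{Var}_{P}(\varphi_\sigma(x-\cdot))}\,dx < \infty .$$ Then there exists a version of the Gaussian process $B_{P}^{(\sigma)}$ that is an $L^{1}(\mathbb{R}^{d})$-valued random variable such that, as $n\to\infty$, $$\sqrt{n}\,\delta_{\mathsf{TV}}^{(\sigma)}(P_n,P)\stackrel{d}{\rightarrow} \frac{1}{2} \int_{\mathbb{R}^{d}} \big| B_{P}^{(\sigma)}(x)\big|\,dx .$$ In addition, for every $n\ge 1$, $$\sqrt{n}\,\mathbb{E}\Big[\delta_{\mathsf{TV}}^{(\sigma)}(P_n,P)\Big] \le \frac{1}{2} \int_{\mathbb{R}^{d}} \sqrt{\mathrm{Var}_{P}(\varphi_\sigma(x-\cdot))}\,dx .$$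
   Context: $\varphi_\sigma(x)=(2\pi\sigma^2)^{-d/2}e^{-\|x\|^2/(2\sigma^2)}$, $x\in\mathbb{R}^d$, is the density of $\mathcal{N}_\sigma:=\mathcal{N}(0,\sigma^2 \mathrm{I}_d)$, and $\|\cdot\|$ is the Euclidean norm. $\ast$ denotes convolution of probability measures. The total variation distance is $\delta_{\mathsf{TV}}(P,Q)=\sup_{A}|P(A)-Q(A)|$, the supremum being over Borel sets $A\subseteq\mathbb{R}^d$, and its smooth version is $\delta_{\mathsf{TV}}^{(\sigma)}(P,Q):=\delta_{\mathsf{TV}}(P\ast\mathcal{N}_\sigma,Q\ast\mathcal{N}_\sigma)$. For $X\sim P$ and a function $f$, $\mathrm{Var}_P(f)$ is the variance of $f(X)$ and $\mathrm{Cov}_P(f,g)$ is the covariance of $f(X)$ and $g(X)$; thus $\mathrm{Var}_P(\varphi_\sigma(x-\cdot))=\mathrm{Var}(\varphi_\sigma(x-X))$. $B_P^{(\sigma)}=(B_P^{(\sigma)}(x))_{x\in\mathbb{R}^d}$ denotes a centered Gaussian process with covariance function $\mathbb{E}[B_P^{(\sigma)}(x)B_P^{(\sigma)}(y)]=\mathrm{Cov}_P(\varphi_\sigma(x-\cdot),\varphi_\sigma(y-\cdot))$, $x,y\in\mathbb{R}^d$. A version of a stochastic process is another stochastic process with the same finite-dimensional distributions. $L^1(\mathbb{R}^d)$ is taken with respect to Lebesgue measure; an $L^p$-valued random variable is a Borel measurable random variable with values in $L^p$, and jointly measurable processes with paths in $L^p$ are identified with $L^p$-valued random variables. $\stackrel{d}{\to}$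 denotes convergence in distribution. *)

theory Defs
  imports "HOL-Probability.Probability"
begin

definition gauss_density :: "real \<Rightarrow> real ^ 'd \<Rightarrow> real" where
  "gauss_density \<sigma> x =
     (2 * pi * \<sigma>\<^sup>2) powr (- real CARD('d) / 2) * exp (- (norm x)\<^sup>2 / (2 * \<sigma>\<^sup>2))"

definition gauss_measure :: "real \<Rightarrow> (real ^ 'd) measure" where
  "gauss_measure \<sigma> = density lborel (\<lambda>x. ennreal (gauss_density \<sigma> x))"

definition tv_dist :: "'a::topological_space measure \<Rightarrow> 'a measure \<Rightarrow> real" where
  "tv_dist P Q = (SUP A\<in>sets borel. \<bar>measure P A - measure Q A\<bar>)"

definition smooth_tv_dist :: "real \<Rightarrow> (real ^ 'd) measure \<Rightarrow> (real ^ 'd) measure \<Rightarrow> real" where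
  "smooth_tv_dist \<sigma> P Q =
     tv_dist (convolution P (gauss_measure \<sigma>)) (convolution Q (gauss_measure \<sigma>))"

text \<open>The sample is indexed from 0. For \<open>n = 0\<close> this is the null measure.\<close>

definition empirical_measure :: "nat \<Rightarrow> (nat \<Rightarrow> 'a::topological_space) \<Rightarrow> 'a measure" where
  "empirical_measure n x =
     measure_of UNIV (sets borel) (\<lambda>A. (\<Sum>i<n. emeasure (return borel (x i)) A) / of_nat n)"

lemma emeasure_empirical_measure:
  assumes "A \<in> sets borel"
  shows "emeasure (empirical_measure n x) A = (\<Sum>i<n. indicator A (x i)) / of_nat n"
proof -
  let ?\<mu> = "\<lambda>A. (\<Sum>i<n. emeasure (return borel (x i)) A) / (of_nat n :: ennreal)"
  have "emeasure (empirical_measure n x) A = ?\<mu> A"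
    unfolding empirical_measure_def
  proof (rule emeasure_measure_of_sigma)
    show "sigma_algebra UNIV (sets (borel :: 'a measure))"
      using sets.sigma_algebra_axioms[of "borel :: 'a measure"] by simp
    show "positive (sets borel) ?\<mu>"
      by (simp add: positive_def)
    show "countably_additive (sets borel) ?\<mu>"
    proof (rule countably_additiveI)
      fix F :: "nat \<Rightarrow> 'a set"
      assume F: "range F \<subseteq> sets borel" "disjoint_family F"
      have "(\<Sum>k. ?\<mu> (F k)) = (\<Sum>k. \<Sum>i<n. emeasure (return borel (x i)) (F k)) / of_nat n"
        by (simp add: divide_ennreal_def)
      also have "(\<Sum>k. \<Sum>i<n. emeasure (return borel (x i)) (F k)) =
          (\<Sum>i<n. \<Sum>k. emeasure (return borel (x i)) (F k))"
        by (rule suminf_sum) simp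
      also have "\<dots> = (\<Sum>i<n. emeasure (return borel (x i)) (\<Union>k. F k))"
        using F by (intro sum.cong refl suminf_emeasure) auto
      finally show "(\<Sum>k. ?\<mu> (F k)) = ?\<mu> (\<Union>k. F k)" .
    qed
  qed (use assms in simp)
  then show ?thesis
    using assms by simp
qed

definition covariance :: "'a measure \<Rightarrow> ('a \<Rightarrow> real) \<Rightarrow> ('a \<Rightarrow> real) \<Rightarrow> real" where
  "covariance P f g =
     (\<integral>x. (f x - (\<integral>y. f y \<partial>P)) * (g x - (\<integral>y. g y \<partial>P)) \<partial>P)"

text \<open>The normal law with mean 0 and standard deviation \<open>s\<close>, including the degenerate case.\<close>

definition centered_normal :: "real \<Rightarrow> real measure" where
  "centered_normal s = (if s = 0 then return borel 0 else density lborel (normal_density 0 s))"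

definition centered_gaussian_process ::
    "'w measure \<Rightarrow> ('t \<Rightarrow> 'w \<Rightarrow> real) \<Rightarrow> ('t \<Rightarrow> 't \<Rightarrow> real) \<Rightarrow> bool" where
  "centered_gaussian_process N B K \<longleftrightarrow>
     prob_space N \<and>
     (\<forall>t. B t \<in> borel_measurable N) \<and>
     (\<forall>T c. finite T \<longrightarrow>
        (\<exists>s\<ge>0. distr N borel (\<lambda>\<omega>. \<Sum>t\<in>T. c t * B t \<omega>) = centered_normal s)) \<and>
     (\<forall>s t. (\<integral>\<omega>. B s \<omega> * B t \<omega> \<partial>N) = K s t)"

text \<open>Equality of finite-dimensional distributions; the two processes may live on different
  probability spaces.\<close>

definition is_version ::
    "'w measure \<Rightarrow> ('t \<Rightarrow> 'w \<Rightarrow> real) \<Rightarrow> 'v measure \<Rightarrow> ('t \<Rightarrow> 'v \<Rightarrow> real) \<Rightarrow> bool" where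
  "is_version N B N' B' \<longleftrightarrow>
     (\<forall>T. finite T \<longrightarrow>
        distr N (\<Pi>\<^sub>M t\<in>T. borel) (\<lambda>\<omega>. \<lambda>t\<in>T. B t \<omega>) =
        distr N' (\<Pi>\<^sub>M t\<in>T. borel) (\<lambda>\<omega>. \<lambda>t\<in>T. B' t \<omega>))"

text \<open>A random variable with values in \<open>L\<^sup>1\<close> is represented by a jointly measurable process all of
  whose paths are integrable.\<close>

definition L1_valued :: "'w measure \<Rightarrow> ('t::euclidean_space \<Rightarrow> 'w \<Rightarrow> real) \<Rightarrow> bool" where
  "L1_valued N B \<longleftrightarrow>
     (\<lambda>(x, \<omega>). B x \<omega>) \<in> borel_measurable (borel \<Otimes>\<^sub>M N) \<and>
     (\<forall>\<omega>\<in>space N. integrable lborel (\<lambda>x. B x \<omega>))"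

end

(* The smoothed measures have densities, so sqrt n times the smooth total variation distance is half
   the L^1 norm of G_n(x) = n^(-1/2) * sum_i h(x, X_i), where h is the centred Gaussian kernel. The
   proof of weak convergence only uses finite-dimensional limits and second moments. Replacing x by
   q(x), for a simple function q close to the identity on a large ball, turns the L^1 norm into a
   finite weighted sum of the |G_n(y)|, with an L^1(M) error bounded through the covariance kernel
   alone, hence uniformly in n and equally for the limit process B. The characteristic function of
   such a sum is the expectation of a product of functions of the single coordinates, and its limit
   follows from that of the characteristic functions of linear combinations, that is, from the
   one-dimensional central limit theorem. The limit process is sum_j f_j(x) xi_j with xi_j i.i.d.
   standard normal, where the f_j come from a Cholesky factorization of the covariance kernel along
   a dense sequence of points. *)

theory Submission
  imports Defs
begin

section \<open>Weighted laws and products of test functions\<close>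

text \<open>Two obstacles shape the proof. First, joint convergence of several coordinates is drawn
  from Levy's theorems on the real line alone. The bridge is a change of measure: for a positive
  weight h, the numbers E[h exp(irY)], divided by E[h], form the characteristic function of the
  single real variable Y under the measure with density h / E[h]. Convergence for all r thus passes
  from exponentials in Y to bounded continuous functions of Y with the weight still in place, and
  the other coordinates can be hidden in the weight. Second, the limit must be jointly measurable
  and yet have the prescribed covariance at every point x, not merely at almost every x. Mean square
  convergence of the series at each x takes care of the covariance; partial sums stopped at an index
  that depends measurably on x converge almost surely at each x, and their limit is jointly
  measurable. Integrable paths come last, from Fubini's theorem and a change on a null set of
  outcomes, which leaves all finite-dimensional laws alone.\<close>

definition weighted_law :: "'a measure \<Rightarrow> ('a \<Rightarrow> real) \<Rightarrow> ('a \<Rightarrow> real) \<Rightarrow> real measure" where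
  "weighted_law M h Y = distr (density M (\<lambda>\<omega>. ennreal (h \<omega> / integral\<^sup>L M h))) borel Y"

text \<open>The lower bound 1 keeps the normalizing constant in \<open>weighted_law\<close> away
  from 0. It suits the weights \<open>2 + Re (h n \<omega>)\<close> that occur below.\<close>

lemma (in prob_space) expectation_weight_pos:
  fixes h :: "'a \<Rightarrow> real"
  assumes "h \<in> borel_measurable M" "\<And>\<omega>. 1 \<le> h \<omega>" "\<And>\<omega>. h \<omega> \<le> C"
  shows "integrable M h" "1 \<le> expectation h"
proof -
  show *: "integrable M h"
    using assms by (intro integrable_const_bound[where B=C]) (auto intro: order_trans[OF abs_ge_self]
      simp: abs_of_nonneg[OF order_trans[OF zero_le_one assms(2)]])
  have "expectation (\<lambda>_. 1) \<le> expectation h"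
    using assms * by (intro integral_mono) auto
  then show "1 \<le> expectation h" by (simp add: prob_space)
qed

lemma (in prob_space) weighted_law:
  assumes h: "h \<in> borel_measurable M" "\<And>\<omega>. 1 \<le> h \<omega>" "\<And>\<omega>. h \<omega> \<le> C"
    and [measurable]: "Y \<in> borel_measurable M"
  shows "real_distribution (weighted_law M h Y)"
    and "f \<in> borel_measurable borel \<Longrightarrow>
      (\<integral>x. f x \<partial>weighted_law M h Y) = (\<integral>\<omega>. h \<omega> *\<^sub>R (f (Y \<omega>) :: complex) \<partial>M) /\<^sub>R expectation h"
proof -
  note [measurable] = h(1)
  have m: "1 \<le> expectation h" and hi: "integrable M h"
    using expectation_weight_pos[OF h] by auto
  have h0: "0 \<le> h \<omega>" for \<omega> using h(2)[of \<omega>] by linarith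
  have nn: "0 \<le> h \<omega> / expectation h" for \<omega> using h0 m by (simp add: divide_nonneg_pos)
  have "prob_space (density M (\<lambda>\<omega>. ennreal (h \<omega> / expectation h)))"
  proof
    have "(\<integral>\<^sup>+\<omega>. ennreal (h \<omega> / expectation h) \<partial>M) = ennreal (\<integral>\<omega>. h \<omega> / expectation h \<partial>M)"
      using nn hi by (intro nn_integral_eq_integral) auto
    then show "emeasure (density M (\<lambda>\<omega>. ennreal (h \<omega> / expectation h)))
        (space (density M (\<lambda>\<omega>. ennreal (h \<omega> / expectation h)))) = 1"
      using m by (subst emeasure_density) (auto cong: nn_integral_cong)
  qed
  then show "real_distribution (weighted_law M h Y)"
    unfolding weighted_law_def
    by (intro prob_space.real_distribution_distr) auto
  show "(\<integral>x. f x \<partial>weighted_law M h Y) = (\<integral>\<omega>. h \<omega> *\<^sub>R (f (Y \<omega>) :: complex) \<partial>M) /\<^sub>R expectation h"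
    if [measurable]: "f \<in> borel_measurable borel"
  proof -
    have "(\<integral>x. f x \<partial>weighted_law M h Y) =
        (\<integral>\<omega>. (h \<omega> / expectation h) *\<^sub>R f (Y \<omega>) \<partial>M)"
      unfolding weighted_law_def using nn
      by (subst integral_distr) (auto simp: integral_density)
    also have "\<dots> = (\<integral>\<omega>. inverse (expectation h) *\<^sub>R (h \<omega> *\<^sub>R f (Y \<omega>)) \<partial>M)"
      by (simp add: field_simps)
    also have "\<dots> = (\<integral>\<omega>. h \<omega> *\<^sub>R (f (Y \<omega>) :: complex) \<partial>M) /\<^sub>R expectation h"
      by (rule integral_scaleR_right)
    finally show ?thesis .
  qed
qed

lemma (in prob_space) char_weighted_law:
  assumes "h \<in> borel_measurable M" "\<And>\<omega>. 1 \<le> h \<omega>" "\<And>\<omega>. h \<omega> \<le> C" "Y \<in> borel_measurable M"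
  shows "char (weighted_law M h Y) r = (\<integral>\<omega>. h \<omega> *\<^sub>R iexp (r * Y \<omega>) \<partial>M) /\<^sub>R expectation h"
  unfolding char_def using weighted_law(2)[OF assms, of "\<lambda>x. iexp (r * x)"] by simp

text \<open>The hypothesis at r = 0 gives convergence of the normalizing constants. After division
  by them the hypothesis states convergence of the characteristic functions of the weighted laws, so
  Levy's continuity theorem applies, and multiplying by the constants again returns to the
  unnormalized integrals.\<close>

lemma weighted_integral_tendsto:
  fixes h :: "nat \<Rightarrow> 'a \<Rightarrow> real" and h' :: "'b \<Rightarrow> real" and u :: "real \<Rightarrow> complex"
  assumes "\<And>n. prob_space (M n)" "prob_space N"
    and h: "\<And>n. h n \<in> borel_measurable (M n)" "\<And>n \<omega>. 1 \<le> h n \<omega>" "\<And>n \<omega>. h n \<omega> \<le> C"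
    and h': "h' \<in> borel_measurable N" "\<And>\<omega>. 1 \<le> h' \<omega>" "\<And>\<omega>. h' \<omega> \<le> C"
    and Y: "\<And>n. Y n \<in> borel_measurable (M n)" and Z: "Z \<in> borel_measurable N"
    and lim: "\<And>r. (\<lambda>n. \<integral>\<omega>. h n \<omega> *\<^sub>R iexp (r * Y n \<omega>) \<partial>M n)
        \<longlonglongrightarrow> (\<integral>\<omega>. h' \<omega> *\<^sub>R iexp (r * Z \<omega>) \<partial>N)"
    and u: "\<And>x. isCont u x" "\<And>x. norm (u x) \<le> B"
  shows "(\<lambda>n. \<integral>\<omega>. h n \<omega> *\<^sub>R u (Y n \<omega>) \<partial>M n) \<longlonglongrightarrow> (\<integral>\<omega>. h' \<omega> *\<^sub>R u (Z \<omega>) \<partial>N)"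
proof -
  interpret M: prob_space "M n" for n by fact
  interpret N: prob_space N by fact
  note Q = M.weighted_law[OF h Y] and Q' = N.weighted_law[OF h' Z]
  have m: "1 \<le> M.expectation n (h n)" for n using M.expectation_weight_pos(2)[OF h] .
  have m': "1 \<le> N.expectation h'" using N.expectation_weight_pos(2)[OF h'] .
  have "(\<lambda>n. complex_of_real (M.expectation n (h n))) \<longlonglongrightarrow> of_real (N.expectation h')"
    using lim[of 0] by (simp flip: of_real_def)
  then have mlim: "(\<lambda>n. M.expectation n (h n)) \<longlonglongrightarrow> N.expectation h'"
    by (simp only: tendsto_of_real_iff)
  have "(\<lambda>n. char (weighted_law (M n) (h n) (Y n)) r) \<longlonglongrightarrow> char (weighted_law N h' Z) r" for r
    unfolding M.char_weighted_law[OF h Y] N.char_weighted_law[OF h' Z]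
    using m' by (intro tendsto_intros lim mlim) auto
  then have "weak_conv_m (\<lambda>n. weighted_law (M n) (h n) (Y n)) (weighted_law N h' Z)"
    by (intro levy_continuity Q Q')
  then have "(\<lambda>n. \<integral>x. u x \<partial>weighted_law (M n) (h n) (Y n)) \<longlonglongrightarrow> (\<integral>x. u x \<partial>weighted_law N h' Z)"
    using u by (intro weak_conv_imp_integral_bdd_continuous_conv Q Q') auto
  moreover have "u \<in> borel_measurable borel"
    using u by (intro borel_measurable_continuous_onI) (auto simp: continuous_on_eq_continuous_at)
  ultimately have "(\<lambda>n. (\<integral>\<omega>. h n \<omega> *\<^sub>R u (Y n \<omega>) \<partial>M n) /\<^sub>R M.expectation n (h n))
      \<longlonglongrightarrow> (\<integral>\<omega>. h' \<omega> *\<^sub>R u (Z \<omega>) \<partial>N) /\<^sub>R N.expectation h'"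
    by (simp add: Q(2) Q'(2))
  from tendsto_scaleR[OF mlim this] show ?thesis
    using m m' by (simp add: order.strict_implies_not_eq[OF less_le_trans[OF zero_less_one], symmetric])
qed

text \<open>The exact counterpart, with Levy's uniqueness theorem in place of continuity. As the two
  laws coincide, \<open>u\<close> may be any Borel function; indicators are what uniqueness of joint
  laws calls for.\<close>

lemma weighted_integral_eq:
  fixes h :: "'a \<Rightarrow> real" and h' :: "'b \<Rightarrow> real" and u :: "real \<Rightarrow> complex"
  assumes "prob_space M" "prob_space N"
    and h: "h \<in> borel_measurable M" "\<And>\<omega>. 1 \<le> h \<omega>" "\<And>\<omega>. h \<omega> \<le> C"
    and h': "h' \<in> borel_measurable N" "\<And>\<omega>. 1 \<le> h' \<omega>" "\<And>\<omega>. h' \<omega> \<le> C"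
    and Y: "Y \<in> borel_measurable M" and Z: "Z \<in> borel_measurable N"
    and eq: "\<And>r. (\<integral>\<omega>. h \<omega> *\<^sub>R iexp (r * Y \<omega>) \<partial>M) = (\<integral>\<omega>. h' \<omega> *\<^sub>R iexp (r * Z \<omega>) \<partial>N)"
    and u: "u \<in> borel_measurable borel"
  shows "(\<integral>\<omega>. h \<omega> *\<^sub>R u (Y \<omega>) \<partial>M) = (\<integral>\<omega>. h' \<omega> *\<^sub>R u (Z \<omega>) \<partial>N)"
proof -
  interpret M: prob_space M by fact
  interpret N: prob_space N by fact
  note Q = M.weighted_law[OF h Y] and Q' = N.weighted_law[OF h' Z]
  have m: "1 \<le> M.expectation h" using M.expectation_weight_pos[OF h] by simp
  have meq: "M.expectation h = N.expectation h'"
    using eq[of 0] by (simp flip: of_real_def)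
  have "weighted_law M h Y = weighted_law N h' Z"
    by (intro Levy_uniqueness Q Q')
       (simp add: fun_eq_iff M.char_weighted_law[OF h Y] N.char_weighted_law[OF h' Z] meq eq[simplified])
  then have "(\<integral>\<omega>. h \<omega> *\<^sub>R u (Y \<omega>) \<partial>M) /\<^sub>R M.expectation h =
      (\<integral>\<omega>. h' \<omega> *\<^sub>R u (Z \<omega>) \<partial>N) /\<^sub>R N.expectation h'"
    using Q(2)[OF u] Q'(2)[OF u] by simp
  then show ?thesis using m by (simp add: meq)
qed

text \<open>One factor at a time, the exponential in a coordinate is traded for the test function: the
  remaining factors act as a bounded complex weight, which is reduced to positive weights by
  passing to real parts and adding a constant.\<close>

lemma expectation_prod_tendsto:
  fixes Y :: "'i \<Rightarrow> 't \<Rightarrow> 'a \<Rightarrow> real" and Z :: "'t \<Rightarrow> 'b \<Rightarrow> real" and u :: "'t \<Rightarrow> real \<Rightarrow> complex"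
  assumes "\<And>n. prob_space (M n)" "prob_space N" and T: "finite T"
    and Y[measurable]: "\<And>n t. Y n t \<in> borel_measurable (M n)"
    and Z[measurable]: "\<And>t. Z t \<in> borel_measurable N"
    and lim: "\<And>c. ((\<lambda>n. \<integral>\<omega>. iexp (\<Sum>t\<in>T. c t * Y n t \<omega>) \<partial>M n)
        \<longlongrightarrow> (\<integral>\<omega>. iexp (\<Sum>t\<in>T. c t * Z t \<omega>) \<partial>N)) F"
    and u[measurable]: "\<And>t. u t \<in> borel_measurable borel" and uB: "\<And>t x. norm (u t x) \<le> 1"
    and step: "\<And>t C h h'. t \<in> T \<Longrightarrow> (\<And>n. h n \<in> borel_measurable (M n)) \<Longrightarrow> h' \<in> borel_measurable N \<Longrightarrow>
      (\<And>n \<omega>. 1 \<le> h n \<omega>) \<Longrightarrow> (\<And>n \<omega>. h n \<omega> \<le> C) \<Longrightarrow> (\<And>\<omega>. 1 \<le> h' \<omega>) \<Longrightarrow> (\<And>\<omega>. h' \<omega> \<le> C) \<Longrightarrow>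
      (\<And>r. ((\<lambda>n. \<integral>\<omega>. h n \<omega> *\<^sub>R iexp (r * Y n t \<omega>) \<partial>M n)
        \<longlongrightarrow> (\<integral>\<omega>. h' \<omega> *\<^sub>R iexp (r * Z t \<omega>) \<partial>N)) F) \<Longrightarrow>
      ((\<lambda>n. \<integral>\<omega>. h n \<omega> *\<^sub>R u t (Y n t \<omega>) \<partial>M n) \<longlongrightarrow> (\<integral>\<omega>. h' \<omega> *\<^sub>R u t (Z t \<omega>) \<partial>N)) F"
  shows "((\<lambda>n. \<integral>\<omega>. (\<Prod>t\<in>T. u t (Y n t \<omega>)) \<partial>M n) \<longlongrightarrow> (\<integral>\<omega>. (\<Prod>t\<in>T. u t (Z t \<omega>)) \<partial>N)) F"
proof -
  interpret M: prob_space "M n" for n by fact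
  interpret N: prob_space N by fact
  have Mb: "integrable (M n) f" if "f \<in> borel_measurable (M n)" "\<And>\<omega>. norm (f \<omega>) \<le> 1" for n and f :: "'a \<Rightarrow> complex"
    using that by (intro M.integrable_const_bound[where B=1]) auto
  have Nb: "integrable N f" if "f \<in> borel_measurable N" "\<And>\<omega>. norm (f \<omega>) \<le> 1" for f :: "'b \<Rightarrow> complex"
    using that by (intro N.integrable_const_bound[where B=1]) auto
  have char1: "((\<lambda>n. \<integral>\<omega>. iexp (r * Y n t \<omega>) \<partial>M n) \<longlongrightarrow> (\<integral>\<omega>. iexp (r * Z t \<omega>) \<partial>N)) F"
    if t: "t \<in> T" for t r
  proof -
    have "(\<Sum>s\<in>T. (if s = t then r else 0) * y s) = (\<Sum>s\<in>T. if s = t then r * y s else 0)" for y :: "'t \<Rightarrow> real"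
      by (intro sum.cong) auto
    then have *: "(\<Sum>s\<in>T. (if s = t then r else 0) * y s) = r * y t" for y
      using T t by simp
    show ?thesis
      using lim[of "\<lambda>s. if s = t then r else 0"] by (simp only: *)
  qed
  \<comment> \<open>Weight 1. This limit is what gets subtracted when the constant 2 is removed from
    the weight.\<close>
  have u1: "((\<lambda>n. \<integral>\<omega>. u t (Y n t \<omega>) \<partial>M n) \<longlongrightarrow> (\<integral>\<omega>. u t (Z t \<omega>) \<partial>N)) F"
    if t: "t \<in> T" for t
    using step[OF t, where h="\<lambda>_ _. 1" and h'="\<lambda>_. 1" and C=1] char1[OF t] by (simp only: scaleR_one order_refl borel_measurable_const)
  have stepR: "((\<lambda>n. \<integral>\<omega>. Re (h n \<omega>) *\<^sub>R u t (Y n t \<omega>) \<partial>M n) \<longlongrightarrow> (\<integral>\<omega>. Re (h' \<omega>) *\<^sub>R u t (Z t \<omega>) \<partial>N)) F"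
    if t: "t \<in> T" and h[measurable]: "\<And>n. h n \<in> borel_measurable (M n)" "h' \<in> borel_measurable N"
      and b: "\<And>n \<omega>. norm (h n \<omega>) \<le> 1" "\<And>\<omega>. norm (h' \<omega>) \<le> 1"
      and l: "\<And>r. ((\<lambda>n. \<integral>\<omega>. h n \<omega> * iexp (r * Y n t \<omega>) \<partial>M n)
        \<longlongrightarrow> (\<integral>\<omega>. h' \<omega> * iexp (r * Z t \<omega>) \<partial>N)) F"
    for t and h :: "'i \<Rightarrow> 'a \<Rightarrow> complex" and h'
  proof -
    have bR: "\<bar>Re (h n \<omega>)\<bar> \<le> 1" "\<bar>Re (h' \<omega>')\<bar> \<le> 1" for n \<omega> \<omega>'
      using b abs_Re_le_cmod order_trans by blast+
    \<comment> \<open>Taking the real part of the weight mixes the frequencies r and -r, so the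
      limits are assumed for every real r.\<close>
    have ReE: "Re z *\<^sub>R iexp (r * y) = (z * iexp (r * y) + cnj (z * iexp ((- r) * y))) / 2" for z r y
      by (simp add: complex_eq_iff Re_exp Im_exp algebra_simps)
    have normb: "norm (z * iexp x) \<le> 1" if "norm z \<le> 1" for z x
      using that by (simp add: norm_mult)
    have Mi: "integrable (M n) (\<lambda>\<omega>. h n \<omega> * iexp (r * Y n t \<omega>))" for n r
      by (intro Mb normb b) measurable
    have Ni: "integrable N (\<lambda>\<omega>. h' \<omega> * iexp (r * Z t \<omega>))" for r
      by (intro Nb normb b) measurable
    have ReM: "(\<integral>\<omega>. Re (h n \<omega>) *\<^sub>R iexp (r * Y n t \<omega>) \<partial>M n) =
      ((\<integral>\<omega>. h n \<omega> * iexp (r * Y n t \<omega>) \<partial>M n) + cnj (\<integral>\<omega>. h n \<omega> * iexp (- r * Y n t \<omega>) \<partial>M n)) / 2" for n r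
      using Mi[of n r] Mi[of n "- r"] unfolding ReE integral_divide_zero
        by (simp only: Bochner_Integration.integral_add complex_integrable_cnj Bochner_Integration.integral_cnj)
    have ReN: "(\<integral>\<omega>. Re (h' \<omega>) *\<^sub>R iexp (r * Z t \<omega>) \<partial>N) =
      ((\<integral>\<omega>. h' \<omega> * iexp (r * Z t \<omega>) \<partial>N) + cnj (\<integral>\<omega>. h' \<omega> * iexp (- r * Z t \<omega>) \<partial>N)) / 2" for r
      using Ni[of r] Ni[of "- r"] unfolding ReE integral_divide_zero
        by (simp only: Bochner_Integration.integral_add complex_integrable_cnj Bochner_Integration.integral_cnj)
    have lR: "((\<lambda>n. \<integral>\<omega>. Re (h n \<omega>) *\<^sub>R iexp (r * Y n t \<omega>) \<partial>M n)
        \<longlongrightarrow> (\<integral>\<omega>. Re (h' \<omega>) *\<^sub>R iexp (r * Z t \<omega>) \<partial>N)) F" for r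
      unfolding ReM ReN by (intro tendsto_intros l) auto
    have splitM: "(\<integral>\<omega>. (2 + Re (h n \<omega>)) *\<^sub>R f (Y n t \<omega>) \<partial>M n) =
        2 *\<^sub>R (\<integral>\<omega>. f (Y n t \<omega>) \<partial>M n) + (\<integral>\<omega>. Re (h n \<omega>) *\<^sub>R f (Y n t \<omega>) \<partial>M n)"
      if [measurable]: "f \<in> borel_measurable borel" and f: "\<And>x. norm (f x) \<le> 1" for n and f :: "real \<Rightarrow> complex"
    proof -
      have "integrable (M n) (\<lambda>\<omega>. f (Y n t \<omega>))"
        by (intro Mb f) measurable
      moreover have "integrable (M n) (\<lambda>\<omega>. Re (h n \<omega>) *\<^sub>R f (Y n t \<omega>))"
        by (rule Mb) (auto intro!: mult_le_one simp: f bR)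
      ultimately show ?thesis
        unfolding scaleR_add_left by simp
    qed
    have splitN: "(\<integral>\<omega>. (2 + Re (h' \<omega>)) *\<^sub>R f (Z t \<omega>) \<partial>N) =
        2 *\<^sub>R (\<integral>\<omega>. f (Z t \<omega>) \<partial>N) + (\<integral>\<omega>. Re (h' \<omega>) *\<^sub>R f (Z t \<omega>) \<partial>N)"
      if [measurable]: "f \<in> borel_measurable borel" and f: "\<And>x. norm (f x) \<le> 1" for f :: "real \<Rightarrow> complex"
    proof -
      have "integrable N (\<lambda>\<omega>. f (Z t \<omega>))"
        by (intro Nb f) measurable
      moreover have "integrable N (\<lambda>\<omega>. Re (h' \<omega>) *\<^sub>R f (Z t \<omega>))"
        by (rule Nb) (auto intro!: mult_le_one simp: f bR)
      ultimately show ?thesis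
        unfolding scaleR_add_left by simp
    qed
    \<comment> \<open>A real part of modulus at most 1 becomes an admissible positive weight, with
      values in [1, 3], after adding 2.\<close>
    have "((\<lambda>n. \<integral>\<omega>. (2 + Re (h n \<omega>)) *\<^sub>R u t (Y n t \<omega>) \<partial>M n)
        \<longlongrightarrow> (\<integral>\<omega>. (2 + Re (h' \<omega>)) *\<^sub>R u t (Z t \<omega>) \<partial>N)) F"
    proof (rule step[OF t, where C=3])
      show "1 \<le> 2 + Re (h n \<omega>)" "2 + Re (h n \<omega>) \<le> 3" for n \<omega> using bR(1)[of n \<omega>] by linarith+
      show "1 \<le> 2 + Re (h' \<omega>)" "2 + Re (h' \<omega>) \<le> 3" for \<omega> using bR(2)[of \<omega>] by linarith+
      show "((\<lambda>n. \<integral>\<omega>. (2 + Re (h n \<omega>)) *\<^sub>R iexp (r * Y n t \<omega>) \<partial>M n)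
        \<longlongrightarrow> (\<integral>\<omega>. (2 + Re (h' \<omega>)) *\<^sub>R iexp (r * Z t \<omega>) \<partial>N)) F" for r
      proof -
        have e: "(\<lambda>x. iexp (r * x)) \<in> borel_measurable borel" "\<And>x. norm (iexp (r * x)) \<le> 1"
          by (auto simp del: of_real_mult)
        show ?thesis
          unfolding splitM[OF e] splitN[OF e] by (intro tendsto_intros lR char1 t)
      qed
    qed measurable
    then have "((\<lambda>n. 2 *\<^sub>R (\<integral>\<omega>. u t (Y n t \<omega>) \<partial>M n) + (\<integral>\<omega>. Re (h n \<omega>) *\<^sub>R u t (Y n t \<omega>) \<partial>M n))
       \<longlongrightarrow> 2 *\<^sub>R (\<integral>\<omega>. u t (Z t \<omega>) \<partial>N) + (\<integral>\<omega>. Re (h' \<omega>) *\<^sub>R u t (Z t \<omega>) \<partial>N)) F"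
      by (simp only: splitM[OF u uB] splitN[OF u uB])
    from tendsto_diff[OF this tendsto_scaleR[OF tendsto_const u1[OF t]], of 2]
    show ?thesis by simp
  qed
  have stepC: "((\<lambda>n. \<integral>\<omega>. h n \<omega> * u t (Y n t \<omega>) \<partial>M n) \<longlongrightarrow> (\<integral>\<omega>. h' \<omega> * u t (Z t \<omega>) \<partial>N)) F"
    if t: "t \<in> T" and h[measurable]: "\<And>n. h n \<in> borel_measurable (M n)" "h' \<in> borel_measurable N"
      and b: "\<And>n \<omega>. norm (h n \<omega>) \<le> 1" "\<And>\<omega>. norm (h' \<omega>) \<le> 1"
      and l: "\<And>r. ((\<lambda>n. \<integral>\<omega>. h n \<omega> * iexp (r * Y n t \<omega>) \<partial>M n)
        \<longlongrightarrow> (\<integral>\<omega>. h' \<omega> * iexp (r * Z t \<omega>) \<partial>N)) F"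
    for t and h :: "'i \<Rightarrow> 'a \<Rightarrow> complex" and h'
  proof -
    \<comment> \<open>The real part of -i z is the imaginary part of z, so the previous claim covers
      both parts of a complex weight.\<close>
    have "((\<lambda>n. \<integral>\<omega>. Re (- \<i> * h n \<omega>) *\<^sub>R u t (Y n t \<omega>) \<partial>M n) \<longlongrightarrow> (\<integral>\<omega>. Re (- \<i> * h' \<omega>) *\<^sub>R u t (Z t \<omega>) \<partial>N)) F"
    proof (rule stepR[OF t])
      show "((\<lambda>n. \<integral>\<omega>. - \<i> * h n \<omega> * iexp (r * Y n t \<omega>) \<partial>M n)
        \<longlongrightarrow> (\<integral>\<omega>. - \<i> * h' \<omega> * iexp (r * Z t \<omega>) \<partial>N)) F" for r
        unfolding mult.assoc integral_mult_right_zero by (intro tendsto_intros l[unfolded mult.assoc])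
    qed (auto simp: norm_mult b)
    then have I: "((\<lambda>n. \<integral>\<omega>. Im (h n \<omega>) *\<^sub>R u t (Y n t \<omega>) \<partial>M n) \<longlongrightarrow> (\<integral>\<omega>. Im (h' \<omega>) *\<^sub>R u t (Z t \<omega>) \<partial>N)) F"
      by simp
    have CE: "z * w = Re z *\<^sub>R w + \<i> * (Im z *\<^sub>R w)" for z w
      by (simp add: complex_eq_iff)
    have bR: "\<bar>Re (h n \<omega>)\<bar> \<le> 1" "\<bar>Re (h' \<omega>')\<bar> \<le> 1" "\<bar>Im (h n \<omega>)\<bar> \<le> 1" "\<bar>Im (h' \<omega>')\<bar> \<le> 1" for n \<omega> \<omega>'
      using b abs_Re_le_cmod abs_Im_le_cmod order_trans by blast+
    have "(\<integral>\<omega>. h n \<omega> * u t (Y n t \<omega>) \<partial>M n) =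
      (\<integral>\<omega>. Re (h n \<omega>) *\<^sub>R u t (Y n t \<omega>) \<partial>M n) + \<i> * (\<integral>\<omega>. Im (h n \<omega>) *\<^sub>R u t (Y n t \<omega>) \<partial>M n)" for n
    proof -
      have "integrable (M n) (\<lambda>\<omega>. Re (h n \<omega>) *\<^sub>R u t (Y n t \<omega>))"
        "integrable (M n) (\<lambda>\<omega>. Im (h n \<omega>) *\<^sub>R u t (Y n t \<omega>))"
        by (rule Mb; auto intro!: mult_le_one simp: uB bR)+
      then show ?thesis
        unfolding CE[of "h n \<omega>" for \<omega>] by (simp only: Bochner_Integration.integral_add integrable_mult_right integral_mult_right_zero)
    qed
    moreover have "(\<integral>\<omega>. h' \<omega> * u t (Z t \<omega>) \<partial>N) =
      (\<integral>\<omega>. Re (h' \<omega>) *\<^sub>R u t (Z t \<omega>) \<partial>N) + \<i> * (\<integral>\<omega>. Im (h' \<omega>) *\<^sub>R u t (Z t \<omega>) \<partial>N)"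
    proof -
      have "integrable N (\<lambda>\<omega>. Re (h' \<omega>) *\<^sub>R u t (Z t \<omega>))"
        "integrable N (\<lambda>\<omega>. Im (h' \<omega>) *\<^sub>R u t (Z t \<omega>))"
        by (rule Nb; auto intro!: mult_le_one simp: uB bR)+
      then show ?thesis
        unfolding CE[of "h' \<omega>" for \<omega>] by (simp only: Bochner_Integration.integral_add integrable_mult_right integral_mult_right_zero)
    qed
    ultimately show ?thesis
      by (simp only:) (intro tendsto_intros I stepR t h b l)
  qed
  have normp: "norm ((\<Prod>s\<in>S. u s (f s)) * iexp x) \<le> 1" for S f x
    using uB by (simp add: norm_mult prod_norm[symmetric] prod_le_1)
  \<comment> \<open>The exponential runs over all of \<open>T\<close>, including coordinates that
    already carry a test function. An extra factor exp(ir Y_a) then only shifts the coefficient of a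
    by r, so the condition for adding the factor at a is the induction hypothesis for another
    \<open>c\<close>.\<close>
  have "((\<lambda>n. \<integral>\<omega>. (\<Prod>s\<in>S. u s (Y n s \<omega>)) * iexp (\<Sum>t\<in>T. c t * Y n t \<omega>) \<partial>M n)
      \<longlongrightarrow> (\<integral>\<omega>. (\<Prod>s\<in>S. u s (Z s \<omega>)) * iexp (\<Sum>t\<in>T. c t * Z t \<omega>) \<partial>N)) F"
    if "finite S" "S \<subseteq> T" for S c
    using that
  proof (induction S arbitrary: c)
    case empty
    then show ?case using lim[of c] by (simp only: prod.empty mult_1_left)
  next
    case (insert a S)
    have a: "a \<in> T" using insert by auto
    have sh: "(\<Sum>t\<in>T. (c(a := c a + r)) t * y t) = (\<Sum>t\<in>T. c t * y t) + r * y a" for r y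
    proof -
      have "(\<Sum>t\<in>T. (c(a := c a + r)) t * y t) = (\<Sum>t\<in>T. c t * y t + (if t = a then r * y t else 0))"
        by (intro sum.cong) (auto simp: distrib_right)
      then show ?thesis
        using T a by (simp add: sum.distrib)
    qed
    have "((\<lambda>n. \<integral>\<omega>. ((\<Prod>s\<in>S. u s (Y n s \<omega>)) * iexp (\<Sum>t\<in>T. c t * Y n t \<omega>)) * u a (Y n a \<omega>) \<partial>M n)
      \<longlongrightarrow> (\<integral>\<omega>. ((\<Prod>s\<in>S. u s (Z s \<omega>)) * iexp (\<Sum>t\<in>T. c t * Z t \<omega>)) * u a (Z a \<omega>) \<partial>N)) F"
    proof (rule stepC[OF a])
      show "((\<lambda>n. \<integral>\<omega>. (\<Prod>s\<in>S. u s (Y n s \<omega>)) * iexp (\<Sum>t\<in>T. c t * Y n t \<omega>) * iexp (r * Y n a \<omega>) \<partial>M n)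
        \<longlongrightarrow> (\<integral>\<omega>. (\<Prod>s\<in>S. u s (Z s \<omega>)) * iexp (\<Sum>t\<in>T. c t * Z t \<omega>) * iexp (r * Z a \<omega>) \<partial>N)) F" for r
        using insert.IH[of "c(a := c a + r)"] insert.prems unfolding sh of_real_add distrib_left exp_add
        by (simp only: mult.assoc insert_subset)
    qed (measurable, simp_all only: normp)
    moreover have "(\<Prod>s\<in>insert a S. u s (y s)) * z = ((\<Prod>s\<in>S. u s (y s)) * z) * u a (y a)" for y z
      using insert.hyps by simp
    ultimately show ?case by (simp only:)
  qed
  from this[OF T subset_refl, of "\<lambda>_. 0"] show ?thesis
    by (simp only: mult_zero_left sum.neutral_const of_real_0 mult_zero_right exp_zero mult_1_right)
qed

corollary expectation_prod_tendsto_continuous: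
  fixes Y :: "nat \<Rightarrow> 't \<Rightarrow> 'a \<Rightarrow> real" and Z :: "'t \<Rightarrow> 'b \<Rightarrow> real" and u :: "'t \<Rightarrow> real \<Rightarrow> complex"
  assumes "\<And>n. prob_space (M n)" "prob_space N" "finite T"
    and "\<And>n t. Y n t \<in> borel_measurable (M n)" "\<And>t. Z t \<in> borel_measurable N"
    and "\<And>c. (\<lambda>n. \<integral>\<omega>. iexp (\<Sum>t\<in>T. c t * Y n t \<omega>) \<partial>M n)
        \<longlonglongrightarrow> (\<integral>\<omega>. iexp (\<Sum>t\<in>T. c t * Z t \<omega>) \<partial>N)"
    and u: "\<And>t x. isCont (u t) x" "\<And>t x. norm (u t x) \<le> 1"
  shows "(\<lambda>n. \<integral>\<omega>. (\<Prod>t\<in>T. u t (Y n t \<omega>)) \<partial>M n) \<longlonglongrightarrow> (\<integral>\<omega>. (\<Prod>t\<in>T. u t (Z t \<omega>)) \<partial>N)"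
proof (rule expectation_prod_tendsto[OF assms(1-6)])
  show "u t \<in> borel_measurable borel" for t
    using u by (intro borel_measurable_continuous_onI) (auto simp: continuous_on_eq_continuous_at)
  fix t C and h :: "nat \<Rightarrow> 'a \<Rightarrow> real" and h' :: "'b \<Rightarrow> real"
  assume *: "\<And>n. h n \<in> borel_measurable (M n)" "h' \<in> borel_measurable N"
      "\<And>n \<omega>. 1 \<le> h n \<omega>" "\<And>n \<omega>. h n \<omega> \<le> C" "\<And>\<omega>. 1 \<le> h' \<omega>" "\<And>\<omega>. h' \<omega> \<le> C"
      "\<And>r. (\<lambda>n. \<integral>\<omega>. h n \<omega> *\<^sub>R iexp (r * Y n t \<omega>) \<partial>M n)
        \<longlonglongrightarrow> (\<integral>\<omega>. h' \<omega> *\<^sub>R iexp (r * Z t \<omega>) \<partial>N)"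
  show "(\<lambda>n. \<integral>\<omega>. h n \<omega> *\<^sub>R u t (Y n t \<omega>) \<partial>M n) \<longlonglongrightarrow> (\<integral>\<omega>. h' \<omega> *\<^sub>R u t (Z t \<omega>) \<partial>N)"
    by (rule weighted_integral_tendsto[OF assms(1,2) *(1,3,4,2,5,6) assms(4,5) *(7) u])
qed (fact u)+

text \<open>Equality of two expectations is read as a limit along a one-point filter, so that
  \<open>expectation_prod_tendsto\<close> yields uniqueness as well as convergence.\<close>

lemma tendsto_principal_unit:
  fixes f :: "unit \<Rightarrow> 'a::t2_space"
  shows "(f \<longlongrightarrow> l) (principal {()}) \<longleftrightarrow> f () = l"
  using tendsto_unique[of "principal {()}" f l "f ()"] tendsto_principal_singleton[of f "()"]
  by (auto simp: principal_eq_bot_iff)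

text \<open>Boxes determine a finite-dimensional law, and the indicator of a box is a product of
  functions of the single coordinates. Hence the product argument applies with indicators as test
  functions.\<close>

corollary cramer_wold_unique:
  fixes Y :: "'t \<Rightarrow> 'a \<Rightarrow> real" and Z :: "'t \<Rightarrow> 'b \<Rightarrow> real"
  assumes M: "prob_space M" and N: "prob_space N" and T: "finite T"
    and Y[measurable]: "\<And>t. Y t \<in> borel_measurable M" and Z[measurable]: "\<And>t. Z t \<in> borel_measurable N"
    and eq: "\<And>c. (\<integral>\<omega>. iexp (\<Sum>t\<in>T. c t * Y t \<omega>) \<partial>M) = (\<integral>\<omega>. iexp (\<Sum>t\<in>T. c t * Z t \<omega>) \<partial>N)"
  shows "distr M (\<Pi>\<^sub>M t\<in>T. borel) (\<lambda>\<omega>. \<lambda>t\<in>T. Y t \<omega>) = distr N (\<Pi>\<^sub>M t\<in>T. borel) (\<lambda>\<omega>. \<lambda>t\<in>T. Z t \<omega>)"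
proof -
  interpret M: prob_space M by fact
  interpret N: prob_space N by fact
  have E: "(\<integral>\<omega>. (\<Prod>t\<in>T. u t (Y t \<omega>)) \<partial>M) = (\<integral>\<omega>. (\<Prod>t\<in>T. u t (Z t \<omega>)) \<partial>N)"
    if [measurable]: "\<And>t. u t \<in> borel_measurable borel" and ub: "\<And>t x. norm (u t x) \<le> 1"
    for u :: "'t \<Rightarrow> real \<Rightarrow> complex"
  proof -
    have "((\<lambda>n::unit. \<integral>\<omega>. (\<Prod>t\<in>T. u t (Y t \<omega>)) \<partial>M) \<longlongrightarrow> (\<integral>\<omega>. (\<Prod>t\<in>T. u t (Z t \<omega>)) \<partial>N)) (principal {()})"
    proof (rule expectation_prod_tendsto[where M="\<lambda>_. M" and Y="\<lambda>_. Y", OF M N T Y Z _ that])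
      fix t C and h :: "unit \<Rightarrow> 'a \<Rightarrow> real" and h' :: "'b \<Rightarrow> real"
      assume *: "\<And>n. h n \<in> borel_measurable M" "h' \<in> borel_measurable N"
          "\<And>n \<omega>. 1 \<le> h n \<omega>" "\<And>n \<omega>. h n \<omega> \<le> C" "\<And>\<omega>. 1 \<le> h' \<omega>" "\<And>\<omega>. h' \<omega> \<le> C"
        and "\<And>r. ((\<lambda>n. \<integral>\<omega>. h n \<omega> *\<^sub>R iexp (r * Y t \<omega>) \<partial>M)
            \<longlongrightarrow> (\<integral>\<omega>. h' \<omega> *\<^sub>R iexp (r * Z t \<omega>) \<partial>N)) (principal {()})"
      then have "(\<integral>\<omega>. h () \<omega> *\<^sub>R u t (Y t \<omega>) \<partial>M) = (\<integral>\<omega>. h' \<omega> *\<^sub>R u t (Z t \<omega>) \<partial>N)"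
        unfolding tendsto_principal_unit
        by (intro weighted_integral_eq[OF M N *(1,3,4,2,5,6) Y Z _ that(1)])
      then show "((\<lambda>n. \<integral>\<omega>. h n \<omega> *\<^sub>R u t (Y t \<omega>) \<partial>M) \<longlongrightarrow> (\<integral>\<omega>. h' \<omega> *\<^sub>R u t (Z t \<omega>) \<partial>N)) (principal {()})"
        by (simp only: tendsto_principal_unit)
    qed (simp only: eq tendsto_const)
    then show ?thesis by (simp only: tendsto_principal_unit)
  qed
  let ?D = "distr M (\<Pi>\<^sub>M t\<in>T. borel) (\<lambda>\<omega>. \<lambda>t\<in>T. Y t \<omega>)"
  let ?D' = "distr N (\<Pi>\<^sub>M t\<in>T. borel) (\<lambda>\<omega>. \<lambda>t\<in>T. Z t \<omega>)"
  have D: "measure ?D (Pi\<^sub>E T A) = Re (\<integral>\<omega>. (\<Prod>t\<in>T. indicator (A t) (Y t \<omega>)) \<partial>M)"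
    "measure ?D' (Pi\<^sub>E T A) = Re (\<integral>\<omega>. (\<Prod>t\<in>T. indicator (A t) (Z t \<omega>)) \<partial>N)"
    if [measurable]: "\<And>t. t \<in> T \<Longrightarrow> A t \<in> sets borel" for A :: "'t \<Rightarrow> real set"
  proof -
    have A[measurable]: "Pi\<^sub>E T A \<in> sets (\<Pi>\<^sub>M t\<in>T. borel)"
      using T by (intro sets_PiM_I_finite) auto
    have ind: "(\<Prod>t\<in>T. indicator (A t) (y t)) = complex_of_real (indicator (Pi\<^sub>E T A) (\<lambda>t\<in>T. y t))" for y
    proof (cases "\<forall>t\<in>T. y t \<in> A t")
      case True
      then have "(\<Prod>t\<in>T. indicator (A t) (y t)) = (1 :: complex)" by (intro prod.neutral) auto
      moreover have "(\<lambda>t\<in>T. y t) \<in> Pi\<^sub>E T A" using True by auto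
      ultimately show ?thesis by simp
    next
      case False
      then have "(\<Prod>t\<in>T. indicator (A t) (y t)) = (0 :: complex)" using T by (intro prod_zero) (auto simp: indicator_def)
      moreover have "(\<lambda>t\<in>T. y t) \<notin> Pi\<^sub>E T A" using False by auto
      ultimately show ?thesis by simp
    qed
    have "measure ?D (Pi\<^sub>E T A) = (\<integral>x. indicator (Pi\<^sub>E T A) x \<partial>?D)" by simp
    also have "\<dots> = (\<integral>\<omega>. indicator (Pi\<^sub>E T A) (\<lambda>t\<in>T. Y t \<omega>) \<partial>M)"
      by (subst integral_distr) auto
    finally show "measure ?D (Pi\<^sub>E T A) = Re (\<integral>\<omega>. (\<Prod>t\<in>T. indicator (A t) (Y t \<omega>)) \<partial>M)"
      unfolding ind integral_complex_of_real Re_complex_of_real .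
    have "measure ?D' (Pi\<^sub>E T A) = (\<integral>x. indicator (Pi\<^sub>E T A) x \<partial>?D')" by simp
    also have "\<dots> = (\<integral>\<omega>. indicator (Pi\<^sub>E T A) (\<lambda>t\<in>T. Z t \<omega>) \<partial>N)"
      by (subst integral_distr) auto
    finally show "measure ?D' (Pi\<^sub>E T A) = Re (\<integral>\<omega>. (\<Prod>t\<in>T. indicator (A t) (Z t \<omega>)) \<partial>N)"
      unfolding ind integral_complex_of_real Re_complex_of_real .
  qed
  interpret D: prob_space ?D by (rule M.prob_space_distr) simp
  interpret D': prob_space ?D' by (rule N.prob_space_distr) simp
  show ?thesis
  proof (rule measure_eqI_PiM_finite[OF T])
    show "emeasure ?D (Pi\<^sub>E T A) = emeasure ?D' (Pi\<^sub>E T A)" if "\<And>t. t \<in> T \<Longrightarrow> A t \<in> sets borel" for A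
    proof -
      \<comment> \<open>Outside \<open>T\<close> the sets \<open>A t\<close> may fail to be
        measurable, whereas \<open>E\<close> asks for a measurable function at every index; 0 fills
        these places.\<close>
      have "(\<Prod>t\<in>T. indicator (A t) (y t)) = (\<Prod>t\<in>T. (if t \<in> T then indicator (A t) (y t) else 0 :: complex))" for y
        by (intro prod.cong) auto
      moreover have "(\<integral>\<omega>. (\<Prod>t\<in>T. (if t \<in> T then indicator (A t) (Y t \<omega>) else 0 :: complex)) \<partial>M) =
         (\<integral>\<omega>. (\<Prod>t\<in>T. (if t \<in> T then indicator (A t) (Z t \<omega>) else 0 :: complex)) \<partial>N)"
      proof (rule E[of "\<lambda>t x. if t \<in> T then indicator (A t) x else 0"])
        show "(\<lambda>x. if t \<in> T then indicator (A t) x else 0 :: complex) \<in> borel_measurable borel" for t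
          using that by (cases "t \<in> T") simp_all
      qed (simp add: indicator_def)
      ultimately show ?thesis
        using D[OF that] by (simp only: D.emeasure_eq_measure D'.emeasure_eq_measure)
    qed
    show "range (\<lambda>_::nat. \<Pi>\<^sub>E t\<in>T. UNIV) \<subseteq> prod_algebra T (\<lambda>_. borel :: real measure)"
      using T by (auto intro!: prod_algebraI_finite)
    show "(\<Union>i::nat. \<Pi>\<^sub>E t\<in>T. (UNIV :: real set)) = space (\<Pi>\<^sub>M t\<in>T. borel)"
      by (simp add: space_PiM)
    show "emeasure ?D (\<Pi>\<^sub>E t\<in>T. UNIV) \<noteq> \<infinity>" by simp
  qed simp_all
qed

section \<open>Gaussian processes\<close>

text \<open>As an image of the standard normal law, the degenerate case s = 0 no longer needs
  separate treatment in the computation of characteristic functions and moments.\<close>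

lemma centered_normal_eq_distr:
  assumes "0 \<le> s"
  shows "centered_normal s = distr std_normal_distribution borel (\<lambda>x. s * x)"
proof (cases "s = 0")
  case True
  interpret prob_space std_normal_distribution by (rule prob_space_normal_density) simp
  have "distr std_normal_distribution borel (\<lambda>x. 0) = return borel (0::real)"
    by (rule measure_eqI) (auto simp: emeasure_distr emeasure_space_1 indicator_def)
  then show ?thesis using True by (simp add: centered_normal_def)
next
  case False
  interpret prob_space std_normal_distribution by (rule prob_space_normal_density) simp
  have "distributed std_normal_distribution lborel (\<lambda>x. x) std_normal_density"
    unfolding distributed_def by (auto intro!: distr_id2)
  from normal_density_affine[OF this, of s 0] False assms
  show ?thesis
    by (auto simp: distributed_def centered_normal_def cong: distr_cong)
qed

lemma real_distribution_centered_normal: "0 \<le> s \<Longrightarrow> real_distribution (centered_normal s)"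
  unfolding centered_normal_eq_distr
  by (intro prob_space.real_distribution_distr prob_space_normal_density) auto

lemma char_centered_normal:
  assumes "0 \<le> s"
  shows "char (centered_normal s) t = exp (- (s\<^sup>2 * t\<^sup>2) / 2)"
proof -
  have "char (centered_normal s) t = char std_normal_distribution (s * t)"
    unfolding centered_normal_eq_distr[OF assms] char_def by (subst integral_distr) (auto simp: ac_simps)
  then show ?thesis
    by (simp add: char_std_normal_distribution power_mult_distrib flip: exp_of_real)
qed

lemma centered_normal_second_moment:
  assumes "0 \<le> s"
  shows "integrable (centered_normal s) (\<lambda>x. x\<^sup>2)" "(\<integral>x. x\<^sup>2 \<partial>centered_normal s) = s\<^sup>2"
proof -
  have *: "has_bochner_integral lborel (\<lambda>x. std_normal_density x * x\<^sup>2) 1"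
    using std_normal_moment_even[of 1] by simp
  have i: "integrable std_normal_distribution (\<lambda>x. x\<^sup>2)"
    using * by (subst integrable_density) (auto simp: has_bochner_integral_iff)
  have e: "(\<integral>x. x\<^sup>2 \<partial>std_normal_distribution) = 1"
    using * by (subst integral_density) (auto simp: has_bochner_integral_iff)
  show "integrable (centered_normal s) (\<lambda>x. x\<^sup>2)"
    unfolding centered_normal_eq_distr[OF assms] using i
    by (subst integrable_distr_eq) (auto simp: power_mult_distrib)
  show "(\<integral>x. x\<^sup>2 \<partial>centered_normal s) = s\<^sup>2"
    unfolding centered_normal_eq_distr[OF assms] using e
    by (subst integral_distr) (auto simp: power_mult_distrib)
qed

lemma integrable_mult_of_squares:
  fixes f g :: "'a \<Rightarrow> real"
  assumes [measurable]: "f \<in> borel_measurable M" "g \<in> borel_measurable M"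
    and "integrable M (\<lambda>x. (f x)\<^sup>2)" "integrable M (\<lambda>x. (g x)\<^sup>2)"
  shows "integrable M (\<lambda>x. f x * g x)"
proof (rule Bochner_Integration.integrable_bound)
  show "integrable M (\<lambda>x. (f x)\<^sup>2 + (g x)\<^sup>2)" using assms by simp
  have "\<bar>a * b\<bar> \<le> a\<^sup>2 + b\<^sup>2" for a b :: real
    using sum_squares_bound[of "\<bar>a\<bar>" "\<bar>b\<bar>"] zero_le_power2[of a] zero_le_power2[of b]
    using mult_nonneg_nonneg[OF abs_ge_zero[of a] abs_ge_zero[of b]] unfolding abs_mult power2_abs by linarith
  then show "AE x in M. norm (f x * g x) \<le> norm ((f x)\<^sup>2 + (g x)\<^sup>2)" by simp
qed measurable

text \<open>For a covariance kernel this is the variance of the linear combination with coefficients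
  \<open>c\<close>.\<close>

definition quad_form :: "('t \<Rightarrow> 't \<Rightarrow> real) \<Rightarrow> 't set \<Rightarrow> ('t \<Rightarrow> real) \<Rightarrow> real" where
  "quad_form K T c = (\<Sum>s\<in>T. \<Sum>t\<in>T. c s * c t * K s t)"

lemma integral_sum_power2:
  fixes B :: "'t \<Rightarrow> 'a \<Rightarrow> real"
  assumes "\<And>s t. integrable N (\<lambda>\<omega>. B s \<omega> * B t \<omega>)"
  shows "integrable N (\<lambda>\<omega>. (\<Sum>t\<in>T. c t * B t \<omega>)\<^sup>2)"
    and "(\<integral>\<omega>. (\<Sum>t\<in>T. c t * B t \<omega>)\<^sup>2 \<partial>N) = quad_form (\<lambda>s t. \<integral>\<omega>. B s \<omega> * B t \<omega> \<partial>N) T c"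
proof -
  have eq: "(\<Sum>t\<in>T. c t * B t \<omega>)\<^sup>2 = (\<Sum>s\<in>T. \<Sum>t\<in>T. c s * c t * (B s \<omega> * B t \<omega>))" for \<omega>
    by (simp add: power2_eq_square sum_product ac_simps)
  show "integrable N (\<lambda>\<omega>. (\<Sum>t\<in>T. c t * B t \<omega>)\<^sup>2)"
    unfolding eq using assms by simp
  show "(\<integral>\<omega>. (\<Sum>t\<in>T. c t * B t \<omega>)\<^sup>2 \<partial>N) = quad_form (\<lambda>s t. \<integral>\<omega>. B s \<omega> * B t \<omega> \<partial>N) T c"
    unfolding eq quad_form_def using assms by simp
qed

context
  fixes N :: "'w measure" and B :: "'t \<Rightarrow> 'w \<Rightarrow> real" and K
  assumes gp: "centered_gaussian_process N B K"
begin

lemma gaussian_process_integrable_mult: "integrable N (\<lambda>\<omega>. B s \<omega> * B t \<omega>)"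
proof (rule integrable_mult_of_squares)
  have m: "B t \<in> borel_measurable N" for t
    using gp by (simp add: centered_gaussian_process_def)
  have sq: "integrable N (\<lambda>\<omega>. (B t \<omega>)\<^sup>2)" for t
  proof -
    obtain r where "r \<ge> 0" "distr N borel (\<lambda>\<omega>. \<Sum>s\<in>{t}. 1 * B s \<omega>) = centered_normal r"
      using gp unfolding centered_gaussian_process_def
      by (meson finite.emptyI finite.insertI)
    then have "integrable (distr N borel (B t)) (\<lambda>x. x\<^sup>2)"
      using centered_normal_second_moment by simp
    then show ?thesis using m by (subst (asm) integrable_distr_eq) auto
  qed
  show "integrable N (\<lambda>\<omega>. (B s \<omega>)\<^sup>2)" "integrable N (\<lambda>\<omega>. (B t \<omega>)\<^sup>2)" by (fact sq)+
  show "B s \<in> borel_measurable N" "B t \<in> borel_measurable N" using m by auto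
qed

text \<open>The definition of a Gaussian process supplies some scale s for each linear combination.
  Its square is the second moment, which the covariance determines.\<close>

lemma gaussian_process_char:
  assumes T: "finite T"
  shows "(\<integral>\<omega>. iexp (\<Sum>t\<in>T. c t * B t \<omega>) \<partial>N) = exp (- quad_form K T c / 2)"
proof -
  have m[measurable]: "B t \<in> borel_measurable N" for t
    using gp by (simp add: centered_gaussian_process_def)
  have K: "(\<integral>\<omega>. B s \<omega> * B t \<omega> \<partial>N) = K s t" for s t
    using gp by (simp add: centered_gaussian_process_def)
  obtain s where s: "s \<ge> 0" "distr N borel (\<lambda>\<omega>. \<Sum>t\<in>T. c t * B t \<omega>) = centered_normal s"
    using gp T unfolding centered_gaussian_process_def by meson
  have "s\<^sup>2 = (\<integral>x. x\<^sup>2 \<partial>distr N borel (\<lambda>\<omega>. \<Sum>t\<in>T. c t * B t \<omega>))"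
    unfolding s(2) using centered_normal_second_moment s(1) by simp
  also have "\<dots> = quad_form K T c"
    by (subst integral_distr) (auto simp: integral_sum_power2 gaussian_process_integrable_mult K)
  finally have "char (distr N borel (\<lambda>\<omega>. \<Sum>t\<in>T. c t * B t \<omega>)) 1 = exp (- quad_form K T c / 2)"
    unfolding s(2) by (simp add: char_centered_normal s(1))
  then show ?thesis
    unfolding char_def by (subst (asm) integral_distr) (auto simp del: of_real_sum)
qed

end

text \<open>The characteristic functions of all linear combinations depend on the kernel only, and
  they determine the joint laws.\<close>

lemma gaussian_process_is_version:
  fixes B :: "'t \<Rightarrow> 'w \<Rightarrow> real" and B' :: "'t \<Rightarrow> 'v \<Rightarrow> real"
  assumes "centered_gaussian_process N B K" "centered_gaussian_process N' B' K"
  shows "is_version N B N' B'"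
  unfolding is_version_def
proof (intro allI impI)
  fix T :: "'t set" assume T: "finite T"
  show "distr N (\<Pi>\<^sub>M t\<in>T. borel) (\<lambda>\<omega>. \<lambda>t\<in>T. B t \<omega>) =
        distr N' (\<Pi>\<^sub>M t\<in>T. borel) (\<lambda>\<omega>. \<lambda>t\<in>T. B' t \<omega>)"
    using assms unfolding centered_gaussian_process_def
    by (intro cramer_wold_unique T) (simp_all only: gaussian_process_char[OF assms(1) T] gaussian_process_char[OF assms(2) T])
qed

text \<open>Rescaling \<open>c\<close> recovers the whole characteristic function of each linear
  combination, hence its law and its variance. Covariances follow by polarization; symmetry of
  \<open>K\<close> enters there, because a quadratic form sees only the symmetric part of a
  kernel.\<close>

lemma centered_gaussian_processI:
  assumes N: "prob_space N" and B[measurable]: "\<And>t. B t \<in> borel_measurable N"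
    and sym: "\<And>s t. K s t = K t s"
    and char: "\<And>T c. finite T \<Longrightarrow> (\<integral>\<omega>. iexp (\<Sum>t\<in>T. c t * B t \<omega>) \<partial>N) = exp (- quad_form K T c / 2)"
  shows "centered_gaussian_process N B K"
proof -
  interpret N: prob_space N by fact
  \<comment> \<open>A characteristic function has modulus at most 1, which forces the exponent to be
    nonpositive. Positive semidefiniteness of \<open>K\<close> is thus a consequence.\<close>
  have nn: "0 \<le> quad_form K T c" if "finite T" for T c
  proof -
    have "norm (\<integral>\<omega>. iexp (\<Sum>t\<in>T. c t * B t \<omega>) \<partial>N) \<le> (\<integral>\<omega>. norm (iexp (\<Sum>t\<in>T. c t * B t \<omega>)) \<partial>N)"
      by (rule integral_norm_bound)
    also have "\<dots> = 1" by (simp add: N.prob_space del: of_real_sum)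
    finally show ?thesis unfolding char[OF that] by simp
  qed
  have scale: "quad_form K T (\<lambda>t. r * c t) = r\<^sup>2 * quad_form K T c" for T r c
    by (simp add: quad_form_def sum_distrib_left power2_eq_square ac_simps)
  have law: "distr N borel (\<lambda>\<omega>. \<Sum>t\<in>T. c t * B t \<omega>) = centered_normal (sqrt (quad_form K T c))"
    if T: "finite T" for T c
  proof (rule Levy_uniqueness)
    show "char (distr N borel (\<lambda>\<omega>. \<Sum>t\<in>T. c t * B t \<omega>)) = char (centered_normal (sqrt (quad_form K T c)))"
    proof
      fix r
      have "char (distr N borel (\<lambda>\<omega>. \<Sum>t\<in>T. c t * B t \<omega>)) r = (\<integral>\<omega>. iexp (\<Sum>t\<in>T. (r * c t) * B t \<omega>) \<partial>N)"
        unfolding char_def by (subst integral_distr) (auto simp: sum_distrib_left ac_simps)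
      also have "\<dots> = char (centered_normal (sqrt (quad_form K T c))) r"
        unfolding char[OF T] scale using nn[OF T, of c] by (simp add: char_centered_normal ac_simps)
      finally show "char (distr N borel (\<lambda>\<omega>. \<Sum>t\<in>T. c t * B t \<omega>)) r = char (centered_normal (sqrt (quad_form K T c))) r" .
    qed
  qed (use nn[OF T] in \<open>auto intro!: N.real_distribution_distr real_distribution_centered_normal\<close>)
  have m2: "integrable N (\<lambda>\<omega>. (\<Sum>t\<in>T. c t * B t \<omega>)\<^sup>2)"
    "(\<integral>\<omega>. (\<Sum>t\<in>T. c t * B t \<omega>)\<^sup>2 \<partial>N) = quad_form K T c" if T: "finite T" for T c
  proof -
    note mom = centered_normal_second_moment[OF real_sqrt_ge_zero[OF nn[OF T]], folded law[OF T]]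
    have rv: "(\<lambda>\<omega>. \<Sum>t\<in>T. c t * B t \<omega>) \<in> borel_measurable N" by measurable
    show "integrable N (\<lambda>\<omega>. (\<Sum>t\<in>T. c t * B t \<omega>)\<^sup>2)"
      using integrable_distr[OF rv mom(1)] .
    show "(\<integral>\<omega>. (\<Sum>t\<in>T. c t * B t \<omega>)\<^sup>2 \<partial>N) = quad_form K T c"
      using mom(2)[of c] integral_distr[OF rv, of "\<lambda>x. x\<^sup>2"] nn[OF T, of c] by simp
  qed
  have sq: "integrable N (\<lambda>\<omega>. (B t \<omega>)\<^sup>2)" "(\<integral>\<omega>. (B t \<omega>)\<^sup>2 \<partial>N) = K t t" for t
    using m2[of "{t}" "\<lambda>_. 1"] by (auto simp: quad_form_def)
  have cov: "(\<integral>\<omega>. B s \<omega> * B t \<omega> \<partial>N) = K s t" for s t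
  proof (cases "s = t")
    case True
    then show ?thesis using sq(2)[of t] by (simp add: power2_eq_square)
  next
    case False
    have i: "integrable N (\<lambda>\<omega>. B s \<omega> * B t \<omega>)" for s t
      by (intro integrable_mult_of_squares sq B)
    have "quad_form (\<lambda>s t. \<integral>\<omega>. B s \<omega> * B t \<omega> \<partial>N) {s, t} (\<lambda>_. 1) = quad_form K {s, t} (\<lambda>_. 1)"
      using m2(2)[of "{s, t}" "\<lambda>_. 1"] integral_sum_power2(2)[OF i, where T="{s, t}" and c="\<lambda>_. 1"] by simp
    then show ?thesis
      using False sq(2)[of s] sq(2)[of t] sym[of s t]
      by (simp add: quad_form_def power2_eq_square mult.commute)
  qed
  show ?thesis
    unfolding centered_gaussian_process_def using law nn cov N B
    by (auto intro!: exI[of _ "sqrt (quad_form K _ _)"])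
qed

section \<open>The one-dimensional central limit theorem in terms of characteristic
  functions\<close>

lemma (in prob_space) clt_char:
  fixes f :: "'b \<Rightarrow> real" and X :: "nat \<Rightarrow> 'a \<Rightarrow> 'b"
  assumes indep: "indep_vars (\<lambda>_. S) X UNIV" and distr: "\<And>i. distr M S (X i) = P"
    and f[measurable]: "f \<in> borel_measurable S"
    and mean: "(\<integral>x. f x \<partial>P) = 0" and sq: "integrable P (\<lambda>x. (f x)\<^sup>2)"
  shows "(\<lambda>n. \<integral>\<omega>. iexp ((\<Sum>i<n. f (X i \<omega>)) / sqrt n) \<partial>M) \<longlonglongrightarrow> exp (- (\<integral>x. (f x)\<^sup>2 \<partial>P) / 2)"
proof -
  have X[measurable]: "X i \<in> measurable M S" for i
    using indep by (simp add: indep_vars_def)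
  define v where "v = (\<integral>x. (f x)\<^sup>2 \<partial>P)"
  have v0: "0 \<le> v" by (simp add: v_def)
  have sqM: "integrable M (\<lambda>\<omega>. (f (X i \<omega>))\<^sup>2)" "expectation (\<lambda>\<omega>. (f (X i \<omega>))\<^sup>2) = v"
      and m0: "expectation (\<lambda>\<omega>. f (X i \<omega>)) = 0" for i
    using sq mean unfolding v_def distr[of i, symmetric]
    by (simp_all add: integral_distr integrable_distr_eq)
  show ?thesis
  proof (cases "v = 0")
    \<comment> \<open>With variance 0 all summands vanish almost surely, and both sides equal
      1.\<close>
    case True
    have "AE \<omega> in M. f (X i \<omega>) = 0" for i
      using integral_nonneg_eq_0_iff_AE[OF sqM(1)[of i]] sqM(2)[of i] True by simp
    then have ae: "AE \<omega> in M. \<forall>i. f (X i \<omega>) = 0"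
      by (subst AE_all_countable) (rule allI)
    have "(\<integral>\<omega>. iexp ((\<Sum>i<n. f (X i \<omega>)) / sqrt n) \<partial>M) = (\<integral>\<omega>. 1 \<partial>M)" for n
      by (rule integral_cong_AE) (use ae in \<open>auto simp del: of_real_sum\<close>)
    then show ?thesis using True by (simp add: v_def prob_space)
  next
    case False
    have wc: "weak_conv_m (\<lambda>n. distr M borel (\<lambda>x. (\<Sum>i<n. f (X i x)) / sqrt (n * (sqrt v)\<^sup>2))) std_normal_distribution"
    proof (rule central_limit_theorem_zero_mean)
      show "indep_vars (\<lambda>i. borel) (\<lambda>i x. f (X i x)) UNIV"
        using indep by (rule indep_vars_compose2) auto
      show "distr M borel (\<lambda>x. f (X n x)) = distr P borel f" for n
        unfolding distr[of n, symmetric] by (subst distr_distr) (auto simp: comp_def)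
      show "variance (\<lambda>x. f (X n x)) = (sqrt v)\<^sup>2" for n
        using v0 sqM(2)[of n] by (simp add: m0)
    qed (use v0 False sqM m0 in auto)
    \<comment> \<open>Evaluation at \<open>sqrt v\<close> undoes the division by the standard
      deviation in the normalized sums.\<close>
    have "(\<lambda>n. char (distr M borel (\<lambda>x. (\<Sum>i<n. f (X i x)) / sqrt (n * (sqrt v)\<^sup>2))) (sqrt v))
      \<longlonglongrightarrow> char std_normal_distribution (sqrt v)"
      by (rule levy_continuity1[OF _ _ wc]) (auto intro!: real_distribution_distr real_dist_normal_dist)
    moreover have "char (distr M borel (\<lambda>x. (\<Sum>i<n. f (X i x)) / sqrt (n * (sqrt v)\<^sup>2))) (sqrt v) =
        (\<integral>\<omega>. iexp ((\<Sum>i<n. f (X i \<omega>)) / sqrt n) \<partial>M)" for n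
    proof -
      have "sqrt v * (x / sqrt (n * (sqrt v)\<^sup>2)) = x / sqrt n" for x
        using v0 False by (simp add: real_sqrt_mult)
      then show ?thesis
        unfolding char_def by (subst integral_distr) (auto simp del: of_real_sum of_real_divide of_real_mult real_sqrt_pow2)
    qed
    ultimately show ?thesis
      using v0 by (simp add: char_std_normal_distribution v_def del: of_real_sum of_real_divide)
  qed
qed

section \<open>Factorization of positive semidefinite kernels\<close>

text \<open>Points are listed by an index and may repeat, so a point can be appended to a list
  without asking whether it already occurs there.\<close>

definition psd_kernel :: "('x \<Rightarrow> 'x \<Rightarrow> real) \<Rightarrow> bool" where
  "psd_kernel K \<longleftrightarrow> (\<forall>x y. K x y = K y x) \<and>
     (\<forall>(n::nat) x c. 0 \<le> (\<Sum>i<n. \<Sum>j<n. c i * c j * K (x i) (x j)))"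

lemma psd_kernel_sym: "psd_kernel K \<Longrightarrow> K x y = K y x"
  by (simp add: psd_kernel_def)

lemma psd_kernel_nonneg: "psd_kernel K \<Longrightarrow> 0 \<le> (\<Sum>i<n::nat. \<Sum>j<n. c i * c j * K (x i) (x j))"
  by (simp add: psd_kernel_def)

lemma psd_kernel_pair:
  assumes "psd_kernel K"
  shows "0 \<le> a\<^sup>2 * K x x + 2 * a * b * K x y + b\<^sup>2 * K y y"
  using psd_kernel_nonneg[OF assms, where n=2 and c="\<lambda>i. if i = 0 then a else b" and x="\<lambda>i. if i = 0 then x else y"]
    psd_kernel_sym[OF assms, of x y]
  by (simp add: numeral_2_eq_2 power2_eq_square algebra_simps)

lemma psd_kernel_diag: "psd_kernel K \<Longrightarrow> 0 \<le> K x x"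
  using psd_kernel_pair[of K 1 x 0 x] by simp

lemma psd_kernel_zero:
  assumes K: "psd_kernel K" and 0: "K y y = 0"
  shows "K x y = 0"
proof (rule ccontr)
  assume n: "K x y \<noteq> 0"
  have "0 \<le> 1\<^sup>2 * K x x + 2 * 1 * b * K x y + b\<^sup>2 * K y y" for b
    by (rule psd_kernel_pair[OF K])
  then have "0 \<le> K x x + 2 * b * K x y" for b by (simp add: 0)
  \<comment> \<open>With \<open>K y y = 0\<close> the form is affine in b, and this b makes it equal
    to -1.\<close>
  from this[of "- (K x x + 1) / (2 * K x y)"] n show False
    by (simp add: field_simps)
qed

text \<open>The Schur complement: the covariance that remains after projecting out the variable at
  \<open>a\<close>. If \<open>K a a = 0\<close>, division by zero yields 0 and \<open>K\<close> is
  unchanged.\<close>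

definition schur_step :: "'x \<Rightarrow> ('x \<Rightarrow> 'x \<Rightarrow> real) \<Rightarrow> 'x \<Rightarrow> 'x \<Rightarrow> real" where
  "schur_step a K x y = K x y - K x a * K y a / K a a"

text \<open>Append the point \<open>a\<close> to the list and give it the coefficient that minimizes
  the quadratic form of \<open>K\<close>, namely \<gamma> = - \<beta> / K a a. The minimum,
  nonnegative by hypothesis, is the quadratic form of the Schur complement.\<close>

lemma psd_kernel_schur_step:
  assumes K: "psd_kernel K"
  shows "psd_kernel (schur_step a K)"
  unfolding psd_kernel_def
proof (intro conjI allI)
  show "schur_step a K x y = schur_step a K y x" for x y
    by (simp add: schur_step_def psd_kernel_sym[OF K, of x y] mult.commute)
  show "0 \<le> (\<Sum>i<n. \<Sum>j<n. c i * c j * schur_step a K (x i) (x j))" for n :: nat and x c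
  proof (cases "K a a = 0")
    case True
    then have "schur_step a K = K" by (simp add: schur_step_def fun_eq_iff)
    then show ?thesis using psd_kernel_nonneg[OF K] by simp
  next
    case False
    define \<beta> where "\<beta> = (\<Sum>i<n. c i * K (x i) a)"
    let ?c = "c(n := - \<beta> / K a a)" and ?x = "x(n := a)"
    have "0 \<le> (\<Sum>i<Suc n. \<Sum>j<Suc n. ?c i * ?c j * K (?x i) (?x j))"
      by (rule psd_kernel_nonneg[OF K])
    also have "\<dots> = (\<Sum>i<n. \<Sum>j<n. c i * c j * K (x i) (x j)) + 2 * (- \<beta> / K a a) * \<beta> + (\<beta> / K a a)\<^sup>2 * K a a"
    proof -
      define \<gamma> where "\<gamma> = - \<beta> / K a a"
      have "(\<Sum>i<n. c i * \<gamma> * K (x i) a) = \<gamma> * \<beta>"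
        by (simp add: \<beta>_def sum_distrib_left ac_simps)
      moreover from this have "(\<Sum>j<n. \<gamma> * c j * K a (x j)) = \<gamma> * \<beta>"
        by (simp add: psd_kernel_sym[OF K, of a] ac_simps)
      moreover have "(\<Sum>i<n. \<Sum>j<n. (c(n := \<gamma>)) i * (c(n := \<gamma>)) j * K (?x i) (?x j)) = (\<Sum>i<n. \<Sum>j<n. c i * c j * K (x i) (x j))"
        "(\<Sum>i<n. (c(n := \<gamma>)) i * \<gamma> * K (?x i) a) = (\<Sum>i<n. c i * \<gamma> * K (x i) a)"
        "(\<Sum>j<n. \<gamma> * (c(n := \<gamma>)) j * K a (?x j)) = (\<Sum>j<n. \<gamma> * c j * K a (x j))"
        by (intro sum.cong refl; simp)+
      ultimately show ?thesis
        unfolding sum.lessThan_Suc sum.distrib \<gamma>_def[symmetric] fun_upd_same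
        by (simp only:) (simp add: \<gamma>_def power2_eq_square)
    qed
    also have "\<dots> = (\<Sum>i<n. \<Sum>j<n. c i * c j * K (x i) (x j)) - \<beta> * \<beta> / K a a"
      using False by (simp add: field_simps power2_eq_square)
    also have "\<beta> * \<beta> / K a a = (\<Sum>i<n. \<Sum>j<n. c i * c j * (K (x i) a * K (x j) a / K a a))"
      by (simp add: \<beta>_def sum_product sum_divide_distrib ac_simps)
    finally show ?thesis
      by (simp add: schur_step_def right_diff_distrib sum_subtractf)
  qed
qed

primrec schur_kernel :: "(nat \<Rightarrow> 'x) \<Rightarrow> ('x \<Rightarrow> 'x \<Rightarrow> real) \<Rightarrow> nat \<Rightarrow> 'x \<Rightarrow> 'x \<Rightarrow> real" where
  "schur_kernel a K 0 = K"
| "schur_kernel a K (Suc n) = schur_step (a n) (schur_kernel a K n)"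

text \<open>A normalized column of the residual kernel at its pivot. For a zero pivot, division by
  zero makes the factor vanish, in agreement with \<open>schur_step\<close>.\<close>

definition cholesky :: "(nat \<Rightarrow> 'x) \<Rightarrow> ('x \<Rightarrow> 'x \<Rightarrow> real) \<Rightarrow> nat \<Rightarrow> 'x \<Rightarrow> real" where
  "cholesky a K n x = schur_kernel a K n x (a n) / sqrt (schur_kernel a K n (a n) (a n))"

lemma psd_schur_kernel: "psd_kernel K \<Longrightarrow> psd_kernel (schur_kernel a K n)"
  by (induction n) (auto intro: psd_kernel_schur_step)

lemma schur_kernel_Suc:
  assumes "psd_kernel K"
  shows "schur_kernel a K (Suc n) x y = schur_kernel a K n x y - cholesky a K n x * cholesky a K n y"
  using psd_kernel_diag[OF psd_schur_kernel[OF assms, of a n], of "a n"]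
  by (simp add: schur_step_def cholesky_def)

lemma sum_cholesky:
  assumes "psd_kernel K"
  shows "(\<Sum>j<n. cholesky a K j x * cholesky a K j y) = K x y - schur_kernel a K n x y"
  by (induction n) (simp_all add: schur_kernel_Suc[OF assms] del: schur_kernel.simps(2))

text \<open>The residual variance at \<open>a m\<close> becomes 0 in step m. Later steps only
  subtract squares while it stays nonnegative, so it remains 0, and a zero on the diagonal kills the
  whole column.\<close>

lemma schur_kernel_vanish:
  assumes K: "psd_kernel K" and "m < n"
  shows "schur_kernel a K n x (a m) = 0"
proof (rule psd_kernel_zero[OF psd_schur_kernel[OF K]])
  show "schur_kernel a K n (a m) (a m) = 0"
    using \<open>m < n\<close>
  proof (induction n)
    case (Suc n)
    show ?case
    proof (cases "m = n")
      case True
      then show ?thesis by (simp add: schur_step_def)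
    next
      case False
      then have "schur_kernel a K n (a m) (a m) = 0" using Suc by simp
      moreover have "0 \<le> schur_kernel a K (Suc n) (a m) (a m)"
        by (rule psd_kernel_diag[OF psd_schur_kernel[OF K]])
      ultimately show ?thesis
        using schur_kernel_Suc[OF K, of a n "a m" "a m"] zero_le_square[of "cholesky a K n (a m)"]
        by linarith
    qed
  qed simp
qed

text \<open>The right side is the squared distance between the variables at x and at
  \<open>a m\<close>. The factorization splits it into the squared differences of the first n
  factors and a residual distance, and the latter is the residual variance at x because
  \<open>a m\<close> has already been eliminated.\<close>

lemma schur_kernel_le:
  assumes K: "psd_kernel K" and "m < n"
  shows "schur_kernel a K n x x \<le> K x x - 2 * K x (a m) + K (a m) (a m)"
proof -
  have "schur_kernel a K n x x = schur_kernel a K n x x - 2 * schur_kernel a K n x (a m) + schur_kernel a K n (a m) (a m)"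
    using schur_kernel_vanish[OF assms] by simp
  moreover have "0 \<le> (\<Sum>j<n. (cholesky a K j x - cholesky a K j (a m))\<^sup>2)" by (intro sum_nonneg) simp
  moreover have "(\<Sum>j<n. (p j - q j)\<^sup>2) = (\<Sum>j<n. p j * p j) - 2 * (\<Sum>j<n. p j * q j) + (\<Sum>j<n. q j * q j)" for p q :: "nat \<Rightarrow> real"
    unfolding power2_diff sum.distrib sum_subtractf
    by (simp add: power2_eq_square sum_distrib_left mult.assoc)
  ultimately show ?thesis
    using sum_cholesky[OF K, of a x x n] sum_cholesky[OF K, of a x "a m" n] sum_cholesky[OF K, of a "a m" "a m" n]
    by simp
qed

text \<open>Cruder than the Cauchy-Schwarz inequality, but linear in the diagonal: a residual kernel
  tends to 0 everywhere as soon as its diagonal does.\<close>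

lemma psd_kernel_abs_le:
  assumes K: "psd_kernel K"
  shows "\<bar>K x y\<bar> \<le> K x x + K y y"
  using psd_kernel_pair[OF K, of 1 x 1 y] psd_kernel_pair[OF K, of 1 x "-1" y]
    psd_kernel_diag[OF K, of x] psd_kernel_diag[OF K, of y] by simp

text \<open>Some \<open>a m\<close> lies so close to x that their squared distance in the kernel is
  below any given bound; from step m + 1 on, the residual variance at x stays below that
  bound.\<close>

lemma cholesky_sums:
  fixes K :: "'x::metric_space \<Rightarrow> 'x \<Rightarrow> real"
  assumes K: "psd_kernel K"
    and cont: "\<And>x. ((\<lambda>y. K x x - 2 * K x y + K y y) \<longlongrightarrow> 0) (at x)"
    and dense: "\<And>S. open S \<Longrightarrow> S \<noteq> {} \<Longrightarrow> \<exists>m. a m \<in> S"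
  shows "(\<lambda>j. cholesky a K j x * cholesky a K j y) sums K x y"
proof -
  have diag: "(\<lambda>n. schur_kernel a K n x x) \<longlonglongrightarrow> 0" for x
  proof (rule LIMSEQ_I)
    fix r :: real assume "0 < r"
    with cont[of x] have "eventually (\<lambda>y. K x x - 2 * K x y + K y y < r) (at x)"
      by (rule order_tendstoD(2))
    then obtain d where d: "d > 0" "\<And>y. y \<noteq> x \<Longrightarrow> dist y x < d \<Longrightarrow> K x x - 2 * K x y + K y y < r"
      unfolding eventually_at by auto
    obtain m where m: "a m \<in> ball x d" using dense[of "ball x d"] d by auto
    \<comment> \<open>The limit at x says nothing about x itself; there the expression is 0.\<close>
    have lt: "K x x - 2 * K x (a m) + K (a m) (a m) < r"
      using d(2)[of "a m"] m \<open>0 < r\<close> by (cases "a m = x") (auto simp: dist_commute)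
    show "\<exists>no. \<forall>n\<ge>no. norm (schur_kernel a K n x x - 0) < r"
    proof (intro exI allI impI)
      fix n assume "Suc m \<le> n"
      then show "norm (schur_kernel a K n x x - 0) < r"
        using schur_kernel_le[OF K, of m n a x] lt psd_kernel_diag[OF psd_schur_kernel[OF K], of a n x] by simp
    qed
  qed
  have "(\<lambda>n. schur_kernel a K n x y) \<longlonglongrightarrow> 0"
  proof (rule Lim_null_comparison)
    show "(\<lambda>n. schur_kernel a K n x x + schur_kernel a K n y y) \<longlonglongrightarrow> 0"
      using tendsto_add[OF diag[of x] diag[of y]] by simp
    show "\<forall>\<^sub>F n in sequentially. norm (schur_kernel a K n x y) \<le> schur_kernel a K n x x + schur_kernel a K n y y"
      using psd_kernel_abs_le[OF psd_schur_kernel[OF K]] by simp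
  qed
  from tendsto_diff[OF tendsto_const this, of "K x y"] show ?thesis
    unfolding sums_def sum_cholesky[OF K] by simp
qed

lemma borel_measurable_cholesky:
  assumes [measurable]: "\<And>y. (\<lambda>x. K x y) \<in> borel_measurable M"
  shows "cholesky a K n \<in> borel_measurable M"
proof -
  have [measurable]: "(\<lambda>x. schur_kernel a K n x y) \<in> borel_measurable M" for y n
    by (induction n arbitrary: y) (auto simp: schur_step_def)
  show ?thesis unfolding cholesky_def by measurable
qed

section \<open>Construction of Gaussian processes with integrable paths\<close>

lemma (in prob_space) expectation_abs_le_sqrt:
  fixes Y :: "'a \<Rightarrow> real"
  assumes [measurable]: "Y \<in> borel_measurable M" and sq: "integrable M (\<lambda>\<omega>. (Y \<omega>)\<^sup>2)"
  shows "integrable M Y" "expectation (\<lambda>\<omega>. \<bar>Y \<omega>\<bar>) \<le> sqrt (expectation (\<lambda>\<omega>. (Y \<omega>)\<^sup>2))"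
proof -
  show Y: "integrable M Y"
    by (rule square_integrable_imp_integrable) (use sq in auto)
  have "variance (\<lambda>\<omega>. \<bar>Y \<omega>\<bar>) = expectation (\<lambda>\<omega>. \<bar>Y \<omega>\<bar>\<^sup>2) - (expectation (\<lambda>\<omega>. \<bar>Y \<omega>\<bar>))\<^sup>2"
    by (rule variance_eq) (use Y sq in auto)
  then show "expectation (\<lambda>\<omega>. \<bar>Y \<omega>\<bar>) \<le> sqrt (expectation (\<lambda>\<omega>. (Y \<omega>)\<^sup>2))"
    using variance_positive[of "\<lambda>\<omega>. \<bar>Y \<omega>\<bar>"] by (intro real_le_rsqrt) simp
qed

section \<open>The i.i.d. standard normal sequence\<close>

definition iid_normal :: "(nat \<Rightarrow> real) measure" where
  "iid_normal = (\<Pi>\<^sub>M i\<in>UNIV. std_normal_distribution)"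

interpretation iid_normal: prob_space iid_normal
  unfolding iid_normal_def by (intro prob_space_PiM prob_space_normal_density) simp

lemma measurable_iid_normal[measurable]: "(\<lambda>\<omega>. \<omega> i) \<in> borel_measurable iid_normal"
proof -
  have "(\<lambda>\<omega>. \<omega> i) \<in> measurable iid_normal (density lborel std_normal_density)"
    unfolding iid_normal_def by (rule measurable_component_singleton) simp
  then show ?thesis by (simp cong: measurable_cong_sets)
qed

lemma indep_vars_iid_normal: "iid_normal.indep_vars (\<lambda>_. borel) (\<lambda>i \<omega>. \<omega> i) UNIV"
  and distr_iid_normal: "distr iid_normal borel (\<lambda>\<omega>. \<omega> i) = std_normal_distribution"
proof -
  interpret product_prob_space "\<lambda>_. std_normal_distribution" "UNIV :: nat set"
    by (simp add: product_prob_spaceI prob_space_normal_density)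
  have *: "distr iid_normal borel (\<lambda>\<omega>. \<omega> i) = std_normal_distribution" for i
    using PiM_component[of i] unfolding iid_normal_def
    by (simp cong: distr_cong)
  then show "distr iid_normal borel (\<lambda>\<omega>. \<omega> i) = std_normal_distribution" .
  have "sets (\<Pi>\<^sub>M i\<in>(UNIV::nat set). borel :: real measure) = sets iid_normal"
    unfolding iid_normal_def by (intro sets_PiM_cong) auto
  then have "distr iid_normal (\<Pi>\<^sub>M i\<in>(UNIV::nat set). borel) (\<lambda>\<omega>. \<omega>) = iid_normal"
    by (intro distr_id2)
  then show "iid_normal.indep_vars (\<lambda>_. borel) (\<lambda>i \<omega>. \<omega> i) UNIV"
    by (subst iid_normal.indep_vars_iff_distr_eq_PiM') (simp_all add: * iid_normal_def[symmetric] restrict_def)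
qed

lemma iid_normal_char:
  assumes "finite T"
  shows "(\<integral>\<omega>. iexp (\<Sum>t\<in>T. c t * \<omega> t) \<partial>iid_normal) = exp (- (\<Sum>t\<in>T. (c t)\<^sup>2) / 2)"
proof -
  have "iid_normal.indep_vars (\<lambda>_. borel) (\<lambda>i \<omega>. \<omega> i) T"
    by (rule iid_normal.indep_vars_subset[OF indep_vars_iid_normal]) simp
  then have ind: "iid_normal.indep_vars (\<lambda>_. borel) (\<lambda>i \<omega>. c i * \<omega> i) T"
    by (rule iid_normal.indep_vars_compose2[where Y="\<lambda>i x. c i * x"]) simp
  have one: "char (distr iid_normal borel (\<lambda>\<omega>. c i * \<omega> i)) 1 = exp (- ((c i)\<^sup>2) / 2)" for i
  proof -
    have "char (distr iid_normal borel (\<lambda>\<omega>. c i * \<omega> i)) 1 = char (distr iid_normal borel (\<lambda>\<omega>. \<omega> i)) (c i)"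
      unfolding char_def by (simp add: integral_distr)
    then show ?thesis unfolding distr_iid_normal by (simp add: char_std_normal_distribution)
  qed
  have "(\<integral>\<omega>. iexp (\<Sum>t\<in>T. c t * \<omega> t) \<partial>iid_normal) = char (distr iid_normal borel (\<lambda>\<omega>. \<Sum>t\<in>T. c t * \<omega> t)) 1"
    unfolding char_def by (subst integral_distr) (auto simp del: of_real_sum)
  also have "\<dots> = (\<Prod>t\<in>T. of_real (exp (- ((c t)\<^sup>2) / 2)))"
    unfolding iid_normal.char_distr_sum[OF ind] one ..
  also have "\<dots> = of_real (exp (\<Sum>t\<in>T. - ((c t)\<^sup>2) / 2))"
    unfolding exp_sum[OF assms] by simp
  also have "(\<Sum>t\<in>T. - ((c t)\<^sup>2) / 2) = - (\<Sum>t\<in>T. (c t)\<^sup>2) / 2"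
    by (simp add: sum_negf sum_divide_distrib)
  finally show ?thesis .
qed

lemma quad_form_delta:
  assumes "finite T"
  shows "quad_form (\<lambda>i j. if i = j then 1 else 0) T c = (\<Sum>t\<in>T. (c t)\<^sup>2)"
proof -
  have "c s * c t * (if s = t then 1 else 0) = (if t = s then (c s)\<^sup>2 else 0)" for s t
    by (simp add: power2_eq_square)
  then show ?thesis unfolding quad_form_def using assms by simp
qed

lemma iid_normal_gaussian:
  "centered_gaussian_process iid_normal (\<lambda>i \<omega>. \<omega> i) (\<lambda>i j. if i = j then 1 else 0)"
proof (rule centered_gaussian_processI)
  show "(\<integral>\<omega>. iexp (\<Sum>t\<in>T. c t * \<omega> t) \<partial>iid_normal) =
      exp (- quad_form (\<lambda>i j. if i = j then 1 else 0) T c / 2)" if "finite T" for T c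
    using iid_normal_char[OF that] by (simp only: quad_form_delta[OF that])
qed (auto intro: iid_normal.prob_space_axioms)

lemma iid_normal_abs_le:
  assumes "finite T"
  shows "integrable iid_normal (\<lambda>\<omega>. \<Sum>t\<in>T. c t * \<omega> t)"
    and "(\<integral>\<omega>. \<bar>\<Sum>t\<in>T. c t * \<omega> t\<bar> \<partial>iid_normal) \<le> sqrt (\<Sum>t\<in>T. (c t)\<^sup>2)"
proof -
  note i = gaussian_process_integrable_mult[OF iid_normal_gaussian]
  have K: "(\<integral>\<omega>. \<omega> i * \<omega> j \<partial>iid_normal) = (if i = j then 1 else 0)" for i j
    using iid_normal_gaussian by (simp add: centered_gaussian_process_def)
  have "(\<integral>\<omega>. (\<Sum>t\<in>T. c t * \<omega> t)\<^sup>2 \<partial>iid_normal) = (\<Sum>t\<in>T. (c t)\<^sup>2)"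
    unfolding integral_sum_power2(2)[where B="\<lambda>i \<omega>. \<omega> i", OF i] K by (rule quad_form_delta[OF assms])
  then show "integrable iid_normal (\<lambda>\<omega>. \<Sum>t\<in>T. c t * \<omega> t)"
    "(\<integral>\<omega>. \<bar>\<Sum>t\<in>T. c t * \<omega> t\<bar> \<partial>iid_normal) \<le> sqrt (\<Sum>t\<in>T. (c t)\<^sup>2)"
    using iid_normal.expectation_abs_le_sqrt[OF _ integral_sum_power2(1)[where B="\<lambda>i \<omega>. \<omega> i", OF i, where c=c and T=T]] by auto
qed

text \<open>Each point \<open>x\<close> uses its own subsequence of partial sums, along which the variance of the
  remainder is at most \<open>1/4\<^sup>k\<close>. This gives almost sure convergence at every \<open>x\<close>,
  and the subsequence depends measurably on \<open>x\<close>.\<close>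

lemma gaussian_series_exists:
  fixes f :: "nat \<Rightarrow> 'x::topological_space \<Rightarrow> real"
  assumes f[measurable]: "\<And>j. f j \<in> borel_measurable borel"
    and sums: "\<And>s t. (\<lambda>j. f j s * f j t) sums K s t"
  shows "\<exists>B. centered_gaussian_process iid_normal B K \<and>
    (\<lambda>(x, \<omega>). B x \<omega>) \<in> borel_measurable (borel \<Otimes>\<^sub>M iid_normal)"
proof -
  define S where "S m x \<omega> = (\<Sum>j<m. f j x * \<omega> j)" for m x and \<omega> :: "nat \<Rightarrow> real"
  define \<tau> where "\<tau> m x = K x x - (\<Sum>j<m. (f j x)\<^sup>2)" for m x
  \<comment> \<open>The condition \<open>k \<le> m\<close> makes the stopping index tend to infinity
    at every x; the convergence of the covariances at two points with different indices rests on
    it.\<close>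
  define p where "p k x m \<longleftrightarrow> k \<le> m \<and> \<tau> m x \<le> (1/4)^k" for k m :: nat and x
  \<comment> \<open>The least admissible index is measurable in x, and it is increasing in k because
    the conditions become stricter.\<close>
  define n where "n k x = (LEAST m. p k x m)" for k x
  have sums2: "(\<lambda>j. (f j x)\<^sup>2) sums K x x" for x
    using sums[of x x] by (simp add: power2_eq_square)
  have tau0: "(\<lambda>m. \<tau> m x) \<longlonglongrightarrow> 0" for x
    using tendsto_diff[OF tendsto_const[of "K x x"] sums2[of x, unfolded sums_def]] by (simp add: \<tau>_def)
  have tau_nn: "0 \<le> \<tau> m x" for m x
    using sum_le_suminf[OF sums_summable[OF sums2[of x]], of "{..<m}"] sums_unique[OF sums2[of x]]
    by (simp add: \<tau>_def)
  have p_n: "p k x (n k x)" for k x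
  proof -
    have "eventually (\<lambda>m. k \<le> m \<and> \<tau> m x < (1/4)^k) sequentially"
      by (intro eventually_conj eventually_ge_at_top order_tendstoD(2)[OF tau0]) simp
    then obtain m where "k \<le> m \<and> \<tau> m x < (1/4)^k" unfolding eventually_sequentially by blast
    then have "p k x m" by (simp add: p_def)
    then show ?thesis unfolding n_def by (rule LeastI)
  qed
  have n_ge: "k \<le> n k x" and n_tau: "\<tau> (n k x) x \<le> (1/4)^k" for k x
    using p_n by (auto simp: p_def)
  have n_mono: "n k x \<le> n (Suc k) x" for k x
  proof -
    have "p k x (n (Suc k) x)"
      using p_n[of "Suc k" x] tau_nn[of "n (Suc k) x" x] by (auto simp: p_def)
    then show ?thesis unfolding n_def[of k] by (rule Least_le)
  qed
  have n_meas: "n k \<in> measurable borel (count_space UNIV)" for k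
  proof -
    have [measurable]: "(\<lambda>x. K x x) \<in> borel_measurable borel"
      unfolding sums_unique[OF sums2] by measurable
    show ?thesis unfolding n_def p_def \<tau>_def by measurable
  qed
  have S_meas[measurable]: "S m x \<in> borel_measurable iid_normal" for m x
    unfolding S_def by measurable
  have S_joint: "(\<lambda>(x, \<omega>). S (n k x) x \<omega>) \<in> borel_measurable (borel \<Otimes>\<^sub>M iid_normal)" for k
  proof -
    have "(\<lambda>z. S m (fst z) (snd z)) \<in> borel_measurable (borel \<Otimes>\<^sub>M iid_normal)" for m
      unfolding S_def by measurable
    moreover have "(\<lambda>z. n k (fst z)) \<in> measurable (borel \<Otimes>\<^sub>M iid_normal) (count_space UNIV)"
      using n_meas by measurable
    ultimately show ?thesis
      unfolding case_prod_beta by (rule measurable_compose_countable)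
  qed
  \<comment> \<open>\<open>lim\<close> is total, so measurability holds everywhere. Where the
    partial sums diverge its value is arbitrary; for each fixed x this happens on a null set
    only.\<close>
  define B where "B x \<omega> = lim (\<lambda>k. S (n k x) x \<omega>)" for x \<omega>
  have B_joint: "(\<lambda>(x, \<omega>). B x \<omega>) \<in> borel_measurable (borel \<Otimes>\<^sub>M iid_normal)"
    using S_joint unfolding B_def case_prod_beta by (rule borel_measurable_lim_metric)
  have B_meas[measurable]: "B x \<in> borel_measurable iid_normal" for x
    unfolding B_def by (rule borel_measurable_lim_metric) measurable
  have conv: "AE \<omega> in iid_normal. (\<lambda>k. S (n k x) x \<omega>) \<longlonglongrightarrow> B x \<omega>" for x
  proof -
    define D where "D k \<omega> = S (n (Suc k) x) x \<omega> - S (n k x) x \<omega>" for k \<omega>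
    have [measurable]: "D k \<in> borel_measurable iid_normal" for k
      unfolding D_def by measurable
    \<comment> \<open>An increment has variance at most \<open>(1/4)^k\<close>, hence first absolute
      moment at most \<open>(1/2)^k\<close>. Summability of these bounds gives absolute convergence
      of the increments almost surely.\<close>
    have D_le: "(\<integral>\<^sup>+\<omega>. ennreal \<bar>D k \<omega>\<bar> \<partial>iid_normal) \<le> ennreal ((1/2)^k)" for k
    proof -
      let ?T = "{n k x..<n (Suc k) x}"
      have D_eq: "D k \<omega> = (\<Sum>j\<in>?T. f j x * \<omega> j)" for \<omega>
        unfolding D_def S_def
        using sum.atLeastLessThan_concat[OF le0 n_mono, of "\<lambda>j. f j x * \<omega> j" k x]
        by (simp add: atLeast0LessThan)
      have "(\<Sum>j\<in>?T. (f j x)\<^sup>2) = \<tau> (n k x) x - \<tau> (n (Suc k) x) x"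
        unfolding \<tau>_def
        using sum.atLeastLessThan_concat[OF le0 n_mono, of "\<lambda>j. (f j x)\<^sup>2" k x]
        by (simp add: atLeast0LessThan)
      also have "\<dots> \<le> (1/4)^k" using n_tau[of k x] tau_nn[of "n (Suc k) x" x] by simp
      finally have "sqrt (\<Sum>j\<in>?T. (f j x)\<^sup>2) \<le> sqrt ((1/4)^k)" by simp
      also have "sqrt ((1/4)^k) = (1/2::real)^k"
        by (simp add: real_sqrt_power real_sqrt_divide)
      finally have "(\<integral>\<omega>. \<bar>D k \<omega>\<bar> \<partial>iid_normal) \<le> (1/2)^k"
        using iid_normal_abs_le(2)[of ?T "\<lambda>j. f j x"] unfolding D_eq by simp
      moreover have "integrable iid_normal (\<lambda>\<omega>. \<bar>D k \<omega>\<bar>)"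
        unfolding D_eq by (intro integrable_abs iid_normal_abs_le) simp
      ultimately show ?thesis
        by (subst nn_integral_eq_integral) (auto intro: ennreal_leI)
    qed
    have "(\<integral>\<^sup>+\<omega>. (\<Sum>k. ennreal \<bar>D k \<omega>\<bar>) \<partial>iid_normal) = (\<Sum>k. \<integral>\<^sup>+\<omega>. ennreal \<bar>D k \<omega>\<bar> \<partial>iid_normal)"
      by (rule nn_integral_suminf) measurable
    also have "\<dots> \<le> (\<Sum>k. ennreal ((1/2)^k))"
      by (intro suminf_le D_le summableI)
    also have "\<dots> < \<infinity>"
      by (subst suminf_ennreal2) (auto intro: summable_geometric)
    finally have "(\<integral>\<^sup>+\<omega>. (\<Sum>k. ennreal \<bar>D k \<omega>\<bar>) \<partial>iid_normal) \<noteq> \<infinity>" by simp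
    then have "AE \<omega> in iid_normal. (\<Sum>k. ennreal \<bar>D k \<omega>\<bar>) \<noteq> \<infinity>"
      by (intro nn_integral_PInf_AE) measurable
    then show ?thesis
    proof eventually_elim
      case (elim \<omega>)
      then have "summable (\<lambda>k. \<bar>D k \<omega>\<bar>)"
        by (intro summable_suminf_not_top) auto
      then have "summable (\<lambda>k. D k \<omega>)" by (rule summable_rabs_cancel)
      then have "convergent (\<lambda>k. S (n 0 x) x \<omega> + (\<Sum>i<k. D i \<omega>))"
        by (intro convergent_add convergent_const) (simp add: summable_iff_convergent)
      moreover have "S (n 0 x) x \<omega> + (\<Sum>i<k. D i \<omega>) = S (n k x) x \<omega>" for k
        unfolding D_def by (simp add: sum_lessThan_telescope[of "\<lambda>k. S (n k x) x \<omega>"])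
      ultimately show ?case unfolding B_def by (simp add: convergent_LIMSEQ_iff)
    qed
  qed
  have "centered_gaussian_process iid_normal B K"
  proof (rule centered_gaussian_processI)
    show "K s t = K t s" for s t
      using sums_unique2[OF sums[of s t]] sums[of t s] by (simp add: mult.commute)
    show "(\<integral>\<omega>. iexp (\<Sum>t\<in>T. c t * B t \<omega>) \<partial>iid_normal) = exp (- quad_form K T c / 2)"
      if T: "finite T" for T c
    proof (rule LIMSEQ_unique)
      let ?W = "\<lambda>k \<omega>. \<Sum>t\<in>T. c t * S (n k t) t \<omega>"
      have "AE \<omega> in iid_normal. \<forall>t\<in>T. (\<lambda>k. S (n k t) t \<omega>) \<longlonglongrightarrow> B t \<omega>"
        using T conv by (simp add: AE_finite_all)
      then have "AE \<omega> in iid_normal. (\<lambda>k. iexp (?W k \<omega>)) \<longlonglongrightarrow> iexp (\<Sum>t\<in>T. c t * B t \<omega>)"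
        by eventually_elim (intro tendsto_intros; simp)
      then show "(\<lambda>k. \<integral>\<omega>. iexp (?W k \<omega>) \<partial>iid_normal) \<longlonglongrightarrow> (\<integral>\<omega>. iexp (\<Sum>t\<in>T. c t * B t \<omega>) \<partial>iid_normal)"
        by (intro integral_dominated_convergence[where w="\<lambda>_. 1"]) (auto simp del: of_real_sum)
      \<comment> \<open>Different points stop at different indices. Padding with zeros lets all
        partial sums run up to the common bound \<open>J k\<close>, so that a linear combination of
        them is a single sum of independent terms.\<close>
      define g where "g k j t = (if j < n k t then f j t else 0)" for k j t
      define J where "J k = (\<Sum>t\<in>T. n k t)" for k
      have J: "n k t \<le> J k" if "t \<in> T" for k t
        unfolding J_def using T that by (intro member_le_sum) auto
      have W: "?W k \<omega> = (\<Sum>j<J k. (\<Sum>t\<in>T. c t * g k j t) * \<omega> j)" for k \<omega>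
      proof -
        have "?W k \<omega> = (\<Sum>t\<in>T. \<Sum>j<J k. c t * g k j t * \<omega> j)"
          unfolding S_def sum_distrib_left
          by (intro sum.cong refl sum.mono_neutral_cong_left) (auto simp: g_def dest: J)
        also have "\<dots> = (\<Sum>j<J k. (\<Sum>t\<in>T. c t * g k j t) * \<omega> j)"
          by (subst sum.swap) (simp add: sum_distrib_right)
        finally show ?thesis .
      qed
      \<comment> \<open>A product of two padded factors vanishes from the smaller of the two
        stopping indices on.\<close>
      have V: "(\<Sum>j<J k. (\<Sum>t\<in>T. c t * g k j t)\<^sup>2) =
          quad_form (\<lambda>s t. \<Sum>j<min (n k s) (n k t). f j s * f j t) T c" for k
      proof -
        have "(\<Sum>j<J k. (\<Sum>t\<in>T. c t * g k j t)\<^sup>2) = (\<Sum>j<J k. \<Sum>s\<in>T. \<Sum>t\<in>T. c s * c t * (g k j s * g k j t))"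
          by (simp add: power2_eq_square sum_product ac_simps)
        also have "\<dots> = (\<Sum>s\<in>T. \<Sum>j<J k. \<Sum>t\<in>T. c s * c t * (g k j s * g k j t))"
          by (rule sum.swap)
        also have "\<dots> = (\<Sum>s\<in>T. \<Sum>t\<in>T. \<Sum>j<J k. c s * c t * (g k j s * g k j t))"
          by (intro sum.cong refl sum.swap)
        also have "\<dots> = quad_form (\<lambda>s t. \<Sum>j<min (n k s) (n k t). f j s * f j t) T c"
        proof -
          have "(\<Sum>j<J k. c s * c t * (g k j s * g k j t)) = (\<Sum>j<min (n k s) (n k t). c s * c t * (f j s * f j t))"
            if "s \<in> T" "t \<in> T" for s t
            by (rule sum.mono_neutral_cong_right) (use J[OF that(1), of k] in \<open>auto simp: g_def\<close>)
          then show ?thesis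
            unfolding quad_form_def sum_distrib_left by simp
        qed
        finally show ?thesis .
      qed
      have "filterlim (\<lambda>k. min (n k s) (n k t)) sequentially sequentially" for s t
        by (rule filterlim_at_top_mono[OF filterlim_ident]) (simp add: n_ge)
      then have "(\<lambda>k. \<Sum>j<min (n k s) (n k t). f j s * f j t) \<longlonglongrightarrow> K s t" for s t
        using sums[of s t] unfolding sums_def by (rule filterlim_compose[rotated])
      then have "(\<lambda>k. quad_form (\<lambda>s t. \<Sum>j<min (n k s) (n k t). f j s * f j t) T c) \<longlonglongrightarrow> quad_form K T c"
        unfolding quad_form_def by (intro tendsto_intros)
      then have "(\<lambda>k. complex_of_real (exp (- quad_form (\<lambda>s t. \<Sum>j<min (n k s) (n k t). f j s * f j t) T c / 2)))
        \<longlonglongrightarrow> exp (- quad_form K T c / 2)"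
        by (intro tendsto_intros) auto
      then show "(\<lambda>k. \<integral>\<omega>. iexp (?W k \<omega>) \<partial>iid_normal) \<longlonglongrightarrow> exp (- quad_form K T c / 2)"
        unfolding W iid_normal_char[OF finite_lessThan] V .
    qed
  qed (auto intro: iid_normal.prob_space_axioms)
  with B_joint show ?thesis by blast
qed

section \<open>Passing to integrable paths\<close>

lemma gaussian_process_abs_le:
  assumes gp: "centered_gaussian_process N B K"
  shows "integrable N (B x)" "(\<integral>\<omega>. \<bar>B x \<omega>\<bar> \<partial>N) \<le> sqrt (K x x)"
proof -
  interpret prob_space N using gp by (simp add: centered_gaussian_process_def)
  have m: "B x \<in> borel_measurable N" and v: "expectation (\<lambda>\<omega>. (B x \<omega>)\<^sup>2) = K x x"
    using gp by (simp_all add: centered_gaussian_process_def power2_eq_square)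
  have sq: "integrable N (\<lambda>\<omega>. (B x \<omega>)\<^sup>2)"
    using gaussian_process_integrable_mult[OF gp, of x x] by (simp add: power2_eq_square)
  show "integrable N (B x)" "(\<integral>\<omega>. \<bar>B x \<omega>\<bar> \<partial>N) \<le> sqrt (K x x)"
    using expectation_abs_le_sqrt[OF m sq] unfolding v .
qed

text \<open>By Fubini's theorem the expected L^1 norm of a path is at most the integral of the
  standard deviations, so almost every path is integrable. \<open>L1_valued\<close> asks for every
  path: the remaining ones are replaced by 0, which alters the process on a null set that is the
  same for all x.\<close>

lemma gaussian_process_L1_version:
  fixes B :: "'x::euclidean_space \<Rightarrow> 'w \<Rightarrow> real"
  assumes gp: "centered_gaussian_process N B K"
    and joint[measurable]: "(\<lambda>(x, \<omega>). B x \<omega>) \<in> borel_measurable (borel \<Otimes>\<^sub>M N)"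
    and fin: "(\<integral>\<^sup>+x. ennreal (sqrt (K x x)) \<partial>lborel) < \<infinity>"
  shows "\<exists>B'. centered_gaussian_process N B' K \<and> L1_valued N B'"
proof -
  interpret prob_space N using gp by (simp add: centered_gaussian_process_def)
  interpret pair_sigma_finite lborel N ..
  have Bx[measurable]: "B x \<in> borel_measurable N" for x
    using gp by (simp add: centered_gaussian_process_def)
  have lb[measurable]: "(\<lambda>(x, \<omega>). B x \<omega>) \<in> borel_measurable (lborel \<Otimes>\<^sub>M N)"
    using joint by (subst measurable_cong_sets[OF sets_pair_measure_cong[OF sets_lborel refl] refl])
  define I where "I \<omega> = (\<integral>\<^sup>+x. ennreal \<bar>B x \<omega>\<bar> \<partial>lborel)" for \<omega>
  have I_meas[measurable]: "I \<in> borel_measurable N"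
    unfolding I_def by measurable
  have "(\<integral>\<^sup>+\<omega>. I \<omega> \<partial>N) = (\<integral>\<^sup>+x. \<integral>\<^sup>+\<omega>. ennreal \<bar>B x \<omega>\<bar> \<partial>N \<partial>lborel)"
    unfolding I_def by (rule Fubini') measurable
  also have "\<dots> \<le> (\<integral>\<^sup>+x. ennreal (sqrt (K x x)) \<partial>lborel)"
    using gaussian_process_abs_le[OF gp]
    by (intro nn_integral_mono) (simp add: nn_integral_eq_integral ennreal_leI)
  finally have "(\<integral>\<^sup>+\<omega>. I \<omega> \<partial>N) \<noteq> \<infinity>" using fin by auto
  then have AE_fin: "AE \<omega> in N. I \<omega> \<noteq> \<infinity>" by (intro nn_integral_PInf_AE) auto
  define B' where "B' x \<omega> = (if I \<omega> \<noteq> \<infinity> then B x \<omega> else 0)" for x \<omega>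
  have joint': "(\<lambda>(x, \<omega>). B' x \<omega>) \<in> borel_measurable (borel \<Otimes>\<^sub>M N)"
    unfolding B'_def by measurable
  have B'x[measurable]: "B' x \<in> borel_measurable N" for x
    unfolding B'_def by measurable
  have "centered_gaussian_process N B' K"
  proof (rule centered_gaussian_processI)
    show "K s t = K t s" for s t
    proof -
      have "K s t = (\<integral>\<omega>. B s \<omega> * B t \<omega> \<partial>N)" "K t s = (\<integral>\<omega>. B t \<omega> * B s \<omega> \<partial>N)"
        using gp by (simp_all add: centered_gaussian_process_def)
      then show ?thesis by (simp only: mult.commute)
    qed
    show "(\<integral>\<omega>. iexp (\<Sum>t\<in>T. c t * B' t \<omega>) \<partial>N) = exp (- quad_form K T c / 2)" if "finite T" for T c
      unfolding gaussian_process_char[OF gp that, symmetric]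
    proof (rule integral_cong_AE)
      show "AE \<omega> in N. iexp (\<Sum>t\<in>T. c t * B' t \<omega>) = iexp (\<Sum>t\<in>T. c t * B t \<omega>)"
        using AE_fin by eventually_elim (simp add: B'_def)
    qed measurable
  qed (auto intro: prob_space_axioms)
  moreover have "L1_valued N B'"
    unfolding L1_valued_def
  proof (intro conjI ballI joint')
    fix \<omega> assume \<omega>: "\<omega> \<in> space N"
    have [measurable]: "(\<lambda>x. B x \<omega>) \<in> borel_measurable lborel"
      using measurable_compose[OF measurable_Pair2'[OF \<omega>] joint] by simp
    show "integrable lborel (\<lambda>x. B' x \<omega>)"
    proof (cases "I \<omega> = \<infinity>")
      case False
      then show ?thesis
        unfolding integrable_iff_bounded B'_def by (simp add: I_def less_top)
    qed (simp add: B'_def)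
  qed
  ultimately show ?thesis by blast
qed

section \<open>Gaussian smoothing and total variation\<close>

lemma gauss_density_nonneg: "0 \<le> gauss_density \<sigma> x"
  by (simp add: gauss_density_def)

lemma gauss_density_le: "gauss_density \<sigma> (x :: real ^ 'd) \<le> gauss_density \<sigma> (0 :: real ^ 'd)"
  by (simp add: gauss_density_def mult_left_le divide_nonpos_nonneg)

lemma continuous_gauss_density: "continuous_on UNIV (gauss_density \<sigma>)"
  unfolding gauss_density_def by (cases "\<sigma> = 0") (auto intro!: continuous_intros)

lemma borel_measurable_gauss_density[measurable]: "gauss_density \<sigma> \<in> borel_measurable borel"
  by (intro borel_measurable_continuous_onI continuous_gauss_density)

text \<open>The exponential of the squared norm factors over the coordinates, and each factor is a
  multiple of a one-dimensional normal density.\<close>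

lemma nn_integral_gauss_density_finite:
  assumes "\<sigma> > 0"
  shows "(\<integral>\<^sup>+x. ennreal (gauss_density \<sigma> (x :: real ^ 'd)) \<partial>lborel) < \<infinity>"
proof -
  let ?e = "\<lambda>b y. exp (- y\<^sup>2 / (2 * \<sigma>\<^sup>2))"
  have "exp (- (norm x)\<^sup>2 / (2 * \<sigma>\<^sup>2)) = (\<Prod>b\<in>Basis. ?e b (x \<bullet> b))" for x :: "real ^ 'd"
  proof -
    have "(norm x)\<^sup>2 = (\<Sum>b\<in>Basis. (x \<bullet> b)\<^sup>2)"
      by (subst power2_norm_eq_inner, subst euclidean_inner) (simp only: power2_eq_square)
    then have "- (norm x)\<^sup>2 / (2 * \<sigma>\<^sup>2) = (\<Sum>b\<in>Basis. - (x \<bullet> b)\<^sup>2 / (2 * \<sigma>\<^sup>2))"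
      by (simp only: sum_negf minus_divide_left[symmetric] sum_divide_distrib)
    then show ?thesis by (simp only: exp_sum finite_Basis)
  qed
  then have "(\<integral>\<^sup>+x. ennreal (exp (- (norm (x :: real ^ 'd))\<^sup>2 / (2 * \<sigma>\<^sup>2))) \<partial>lborel) =
      (\<integral>\<^sup>+x. (\<Prod>b\<in>Basis. ennreal (?e b ((x :: real ^ 'd) \<bullet> b))) \<partial>lborel)"
    by (simp add: prod_ennreal)
  also have "\<dots> = (\<Prod>b\<in>(Basis :: (real ^ 'd) set). \<integral>\<^sup>+y. ennreal (?e b y) \<partial>lborel)"
    by (rule nn_integral_lborel_prod) auto
  also have "\<dots> < \<infinity>"
  proof -
    have "(\<integral>\<^sup>+y. ennreal (?e b y) \<partial>lborel) = ennreal (sqrt (2 * pi * \<sigma>\<^sup>2))" for b :: "real ^ 'd"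
    proof -
      have "?e b y = sqrt (2 * pi * \<sigma>\<^sup>2) * normal_density 0 \<sigma> y" for y
        using assms by (simp add: normal_density_def)
      then have "(\<integral>\<^sup>+y. ennreal (?e b y) \<partial>lborel) = (\<integral>\<^sup>+y. ennreal (sqrt (2 * pi * \<sigma>\<^sup>2) * normal_density 0 \<sigma> y) \<partial>lborel)"
        by simp
      also have "\<dots> = ennreal (\<integral>y. sqrt (2 * pi * \<sigma>\<^sup>2) * normal_density 0 \<sigma> y \<partial>lborel)"
        using assms by (intro nn_integral_eq_integral) auto
      finally show ?thesis using assms by simp
    qed
    then show ?thesis by (simp add: ennreal_power)
  qed
  finally have "(\<integral>\<^sup>+x. ennreal (exp (- (norm (x :: real ^ 'd))\<^sup>2 / (2 * \<sigma>\<^sup>2))) \<partial>lborel) < \<infinity>" .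
  then show ?thesis
    unfolding gauss_density_def
    by (simp add: ennreal_mult nn_integral_cmult ennreal_mult_less_top)
qed

lemma nn_integral_lborel_shift:
  fixes f :: "'a::euclidean_space \<Rightarrow> ennreal"
  assumes [measurable]: "f \<in> borel_measurable borel"
  shows "(\<integral>\<^sup>+x. f (t + x) \<partial>lborel) = (\<integral>\<^sup>+x. f x \<partial>lborel)"
proof -
  have "lborel = distr lborel borel (\<lambda>x. t + x)"
    using lborel_affine[of 1 t] by (simp add: density_1)
  then have "(\<integral>\<^sup>+x. f x \<partial>lborel) = (\<integral>\<^sup>+x. f x \<partial>distr lborel borel (\<lambda>x. t + x))" by metis
  also have "\<dots> = (\<integral>\<^sup>+x. f (t + x) \<partial>lborel)" by (rule nn_integral_distr) auto
  finally show ?thesis by simp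
qed

lemma finite_gauss_measure:
  assumes "\<sigma> > 0"
  shows "finite_measure (gauss_measure \<sigma> :: (real ^ 'd) measure)"
  using nn_integral_gauss_density_finite[OF assms, where 'd='d]
  by (intro finite_measureI) (simp add: gauss_measure_def emeasure_density less_top)

lemma integrable_gauss_density_shift:
  assumes "\<sigma> > 0"
  shows "integrable lborel (\<lambda>x. gauss_density \<sigma> (x - z :: real ^ 'd))"
    and "(\<integral>x. gauss_density \<sigma> (x - z :: real ^ 'd) \<partial>lborel) = (\<integral>x. gauss_density \<sigma> (x :: real ^ 'd) \<partial>lborel)"
proof -
  have eq: "(\<integral>\<^sup>+x. ennreal (gauss_density \<sigma> (x - z)) \<partial>lborel) =
      (\<integral>\<^sup>+x. ennreal (gauss_density \<sigma> (x :: real ^ 'd)) \<partial>lborel)"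
    using nn_integral_lborel_shift[of "\<lambda>x. ennreal (gauss_density \<sigma> (x :: real ^ 'd))" "- z"] by simp
  show "integrable lborel (\<lambda>x. gauss_density \<sigma> (x - z))"
    using nn_integral_gauss_density_finite[OF assms, where 'd='d] eq
    by (intro integrableI_nonneg) (auto simp: gauss_density_nonneg)
  show "(\<integral>x. gauss_density \<sigma> (x - z) \<partial>lborel) = (\<integral>x. gauss_density \<sigma> (x :: real ^ 'd) \<partial>lborel)"
    using eq by (simp add: integral_eq_nn_integral gauss_density_nonneg)
qed

lemma integrable_gauss_density:
  fixes P :: "(real ^ 'd) measure"
  assumes "finite_measure P" "sets P = sets borel"
  shows "integrable P (\<lambda>z. gauss_density \<sigma> (x - z))"
  using assms(2)
  by (intro finite_measure.integrable_const_bound[OF assms(1), where B="gauss_density \<sigma> (0 :: real ^ 'd)"])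
     (auto simp: gauss_density_nonneg gauss_density_le cong: measurable_cong_sets)

text \<open>Translation invariance of Lebesgue measure turns the inner integral into one against the
  Gaussian density centred at z; Fubini's theorem then averages these densities over
  \<open>P\<close>.\<close>

lemma convolution_gauss_measure:
  fixes P :: "(real ^ 'd) measure"
  assumes "\<sigma> > 0" "finite_measure P" and P: "sets P = sets borel"
  shows "convolution P (gauss_measure \<sigma>) =
    density lborel (\<lambda>x. ennreal (\<integral>z. gauss_density \<sigma> (x - z) \<partial>P))"
proof (rule measure_eqI)
  interpret P: finite_measure P by fact
  interpret pair_sigma_finite P lborel ..
  note [measurable_cong] = P
  fix A assume "A \<in> sets (convolution P (gauss_measure \<sigma>))"
  then have A[measurable]: "A \<in> sets borel" by simp
  have "emeasure (convolution P (gauss_measure \<sigma>)) A =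
      (\<integral>\<^sup>+z. \<integral>\<^sup>+y. indicator A (z + y) \<partial>gauss_measure \<sigma> \<partial>P)"
    by (rule convolution_emeasure'[OF A assms(2) finite_gauss_measure[OF assms(1)] _ P])
       (simp add: gauss_measure_def)
  also have "\<dots> = (\<integral>\<^sup>+z. \<integral>\<^sup>+y. ennreal (gauss_density \<sigma> y) * indicator A (z + y) \<partial>lborel \<partial>P)"
    unfolding gauss_measure_def by (simp add: nn_integral_density)
  also have "\<dots> = (\<integral>\<^sup>+z. \<integral>\<^sup>+x. ennreal (gauss_density \<sigma> (x - z)) * indicator A x \<partial>lborel \<partial>P)"
  proof -
    have "(\<integral>\<^sup>+y. ennreal (gauss_density \<sigma> y) * indicator A (z + y) \<partial>lborel) =
        (\<integral>\<^sup>+x. ennreal (gauss_density \<sigma> (x - z)) * indicator A x \<partial>lborel)" for z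
      using nn_integral_lborel_shift[of "\<lambda>x. ennreal (gauss_density \<sigma> (x - z)) * indicator A x" z] by simp
    then show ?thesis by simp
  qed
  also have "\<dots> = (\<integral>\<^sup>+x. \<integral>\<^sup>+z. ennreal (gauss_density \<sigma> (x - z)) * indicator A x \<partial>P \<partial>lborel)"
    by (rule Fubini'[symmetric]) measurable
  also have "\<dots> = (\<integral>\<^sup>+x. ennreal (\<integral>z. gauss_density \<sigma> (x - z) \<partial>P) * indicator A x \<partial>lborel)"
    by (intro nn_integral_cong)
       (simp add: nn_integral_multc nn_integral_eq_integral[OF integrable_gauss_density[OF assms(2) P]] gauss_density_nonneg)
  also have "\<dots> = emeasure (density lborel (\<lambda>x. ennreal (\<integral>z. gauss_density \<sigma> (x - z) \<partial>P))) A"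
    by (subst emeasure_density) auto
  finally show "emeasure (convolution P (gauss_measure \<sigma>)) A =
      emeasure (density lborel (\<lambda>x. ennreal (\<integral>z. gauss_density \<sigma> (x - z) \<partial>P))) A" .
qed simp

text \<open>As d = f - g has integral 0, the difference of the masses of A is half of the integral
  of d over A minus that over the complement. Its modulus is at most half the L^1 norm of d, with
  equality for A = {g \<le> f}. The common mass is arbitrary.\<close>

lemma tv_dist_density:
  fixes f g :: "'a::euclidean_space \<Rightarrow> real"
  assumes f: "integrable lborel f" "\<And>x. 0 \<le> f x" and g: "integrable lborel g" "\<And>x. 0 \<le> g x"
    and eq: "(\<integral>x. f x \<partial>lborel) = (\<integral>x. g x \<partial>lborel)"
  shows "tv_dist (density lborel (\<lambda>x. ennreal (f x))) (density lborel (\<lambda>x. ennreal (g x))) =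
    1 / 2 * (\<integral>x. \<bar>f x - g x\<bar> \<partial>lborel)"
proof -
  have [measurable]: "f \<in> borel_measurable borel" "g \<in> borel_measurable borel"
    using f g by auto
  have m: "measure (density lborel (\<lambda>x. ennreal (h x))) A = (\<integral>x. h x * indicator A x \<partial>lborel)"
    if h: "integrable lborel h" "\<And>x. 0 \<le> h x" and [measurable]: "A \<in> sets borel" for h :: "'a \<Rightarrow> real" and A
  proof -
    have [measurable]: "h \<in> borel_measurable borel" using h by auto
    have "emeasure (density lborel (\<lambda>x. ennreal (h x))) A = (\<integral>\<^sup>+x. ennreal (h x * indicator A x) \<partial>lborel)"
      by (subst emeasure_density) (auto intro!: nn_integral_cong split: split_indicator)
    also have "\<dots> = ennreal (\<integral>x. h x * indicator A x \<partial>lborel)"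
      using h by (intro nn_integral_eq_integral integrable_real_mult_indicator) auto
    finally show ?thesis using h by (simp add: measure_def)
  qed
  let ?d = "\<lambda>x. f x - g x"
  have d: "integrable lborel ?d" using f g by simp
  have d0: "(\<integral>x. ?d x \<partial>lborel) = 0" using f g eq by simp
  have diff: "measure (density lborel (\<lambda>x. ennreal (f x))) A - measure (density lborel (\<lambda>x. ennreal (g x))) A =
      1 / 2 * (\<integral>x. (if x \<in> A then ?d x else - ?d x) \<partial>lborel)" if A[measurable]: "A \<in> sets borel" for A
  proof -
    have i: "integrable lborel (\<lambda>x. h x * indicator A x)" if "integrable lborel h" for h :: "'a \<Rightarrow> real"
      using that by (intro integrable_real_mult_indicator) auto
    have "(if x \<in> A then ?d x else - ?d x) = 2 * (?d x * indicator A x) - ?d x" for x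
      by (simp split: split_indicator)
    then have "(\<integral>x. (if x \<in> A then ?d x else - ?d x) \<partial>lborel) = 2 * (\<integral>x. ?d x * indicator A x \<partial>lborel)"
      using d0 d i[OF d] by (simp del: left_diff_distrib)
    also have "(\<integral>x. ?d x * indicator A x \<partial>lborel) =
      measure (density lborel (\<lambda>x. ennreal (f x))) A - measure (density lborel (\<lambda>x. ennreal (g x))) A"
      using i[OF f(1)] i[OF g(1)] unfolding m[OF f A] m[OF g A] by (simp add: left_diff_distrib)
    finally show ?thesis by simp
  qed
  show ?thesis
    unfolding tv_dist_def
  proof (rule cSup_eq_maximum)
    let ?A = "{x. g x \<le> f x}"
    have A: "?A \<in> sets borel" by measurable
    have e: "(if x \<in> ?A then ?d x else - ?d x) = \<bar>?d x\<bar>" for x by simp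
    show "1 / 2 * (\<integral>x. \<bar>?d x\<bar> \<partial>lborel) \<in>
        (\<lambda>A. \<bar>measure (density lborel (\<lambda>x. ennreal (f x))) A - measure (density lborel (\<lambda>x. ennreal (g x))) A\<bar>) ` sets borel"
      using diff[OF A] unfolding e by (intro image_eqI[OF _ A]) (simp only: abs_of_nonneg[OF mult_nonneg_nonneg] Bochner_Integration.integral_nonneg abs_ge_zero zero_le_divide_1_iff zero_le_numeral)
  next
    fix y assume "y \<in> (\<lambda>A. \<bar>measure (density lborel (\<lambda>x. ennreal (f x))) A - measure (density lborel (\<lambda>x. ennreal (g x))) A\<bar>) ` sets borel"
    then obtain A where A[measurable]: "A \<in> sets borel" and
      y: "y = \<bar>measure (density lborel (\<lambda>x. ennreal (f x))) A - measure (density lborel (\<lambda>x. ennreal (g x))) A\<bar>" by auto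
    have "\<bar>\<integral>x. (if x \<in> A then ?d x else - ?d x) \<partial>lborel\<bar> \<le> (\<integral>x. \<bar>if x \<in> A then ?d x else - ?d x\<bar> \<partial>lborel)"
      by (rule integral_abs_bound)
    also have "\<dots> = (\<integral>x. \<bar>?d x\<bar> \<partial>lborel)" by (intro Bochner_Integration.integral_cong) auto
    finally show "y \<le> 1 / 2 * (\<integral>x. \<bar>?d x\<bar> \<partial>lborel)"
      unfolding y diff[OF A] by simp
  qed
qed

text \<open>As an image of the uniform law on the indices, the empirical measure is visibly a
  probability measure, and integrals against it become averages.\<close>

lemma empirical_measure_eq_distr:
  assumes "n \<ge> 1"
  shows "empirical_measure n x = distr (uniform_count_measure {..<n}) borel x"
proof (rule measure_eqI)
  show s: "sets (empirical_measure n x) = sets (distr (uniform_count_measure {..<n}) borel x)"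
    by (simp add: empirical_measure_def sets.sigma_sets_eq[of borel, unfolded space_borel])
  fix A assume "A \<in> sets (empirical_measure n x)"
  then have A[measurable]: "A \<in> sets borel" using s by simp
  have x: "x \<in> measurable (uniform_count_measure {..<n}) borel"
    by (simp cong: measurable_cong_sets)
  have "emeasure (distr (uniform_count_measure {..<n}) borel x) A =
      (\<integral>\<^sup>+i. indicator A (x i) \<partial>uniform_count_measure {..<n})"
    using A x by (simp add: nn_integral_distr flip: nn_integral_indicator)
  also have "\<dots> = (\<Sum>i<n. indicator A (x i)) / of_nat n"
  proof -
    have "ennreal (1 / real n) = 1 / of_nat n"
      using assms divide_ennreal[of 1 "real n"] by (simp add: ennreal_of_nat_eq_real_of_nat)
    then show ?thesis
      unfolding uniform_count_measure_def nn_integral_point_measure_finite[OF finite_lessThan] card_lessThan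
        sum_distrib_left[symmetric]
      by (simp only: divide_ennreal_def mult_1_left mult.commute)
  qed
  finally show "emeasure (empirical_measure n x) A = emeasure (distr (uniform_count_measure {..<n}) borel x) A"
    unfolding emeasure_empirical_measure[OF A] by simp
qed

lemma smooth_tv_dist_empirical:
  fixes P :: "(real ^ 'd) measure"
  assumes \<sigma>: "\<sigma> > 0" and "prob_space P" and P: "sets P = sets borel" and n: "n \<ge> 1"
  defines "h \<equiv> \<lambda>y z. gauss_density \<sigma> (y - z) - (\<integral>z. gauss_density \<sigma> (y - z) \<partial>P)"
  shows "sqrt n * smooth_tv_dist \<sigma> (empirical_measure n x) P =
    1 / 2 * (\<integral>y. \<bar>(\<Sum>i<n. h y (x i)) / sqrt n\<bar> \<partial>lborel)"
    and "integrable lborel (\<lambda>y. h y z)"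
proof -
  interpret P: prob_space P by fact
  interpret pair_sigma_finite P lborel ..
  note [measurable_cong] = P
  let ?c = "\<integral>x. gauss_density \<sigma> (x :: real ^ 'd) \<partial>lborel"
  let ?p = "\<lambda>y. \<integral>z. gauss_density \<sigma> (y - z) \<partial>P"
  let ?q = "\<lambda>y. (\<Sum>i<n. gauss_density \<sigma> (y - x i)) / n"
  interpret U: prob_space "uniform_count_measure {..<n}"
    using n by (intro prob_space_uniform_count_measure) (auto simp: lessThan_empty_iff)
  have xm: "x \<in> measurable (uniform_count_measure {..<n}) borel"
    by (simp cong: measurable_cong_sets)
  have eq: "(\<integral>z. gauss_density \<sigma> (y - z) \<partial>empirical_measure n x) = ?q y" for y
    unfolding empirical_measure_eq_distr[OF n] using xm
    by (subst integral_distr) (auto simp: integral_uniform_count_measure)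
  have e: "convolution (empirical_measure n x) (gauss_measure \<sigma>) = density lborel (\<lambda>y. ennreal (?q y))"
    unfolding eq[symmetric]
    by (rule convolution_gauss_measure[OF \<sigma>]) (auto simp: empirical_measure_eq_distr[OF n] intro: U.finite_measure_distr xm)
  have c: "convolution P (gauss_measure \<sigma>) = density lborel (\<lambda>y. ennreal (?p y))"
    by (rule convolution_gauss_measure[OF \<sigma> _ P]) unfold_locales
  note shift = integrable_gauss_density_shift[OF \<sigma>]
  have qi: "integrable lborel ?q"
    by (intro integrable_divide_zero Bochner_Integration.integrable_sum shift)
  have qc: "(\<integral>y. ?q y \<partial>lborel) = ?c"
    unfolding integral_divide_zero Bochner_Integration.integral_sum[OF shift(1)] shift(2) using n by simp
  have pp: "integrable (P \<Otimes>\<^sub>M lborel) (\<lambda>(z, y). gauss_density \<sigma> (y - z))"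
  proof (rule Fubini_integrable)
    show "integrable P (\<lambda>z. \<integral>y. norm (case (z, y) of (z, y) \<Rightarrow> gauss_density \<sigma> (y - z)) \<partial>lborel)"
      by (simp add: gauss_density_nonneg integrable_gauss_density_shift[OF \<sigma>])
    show "AE z in P. integrable lborel (\<lambda>y. case (z, y) of (z, y) \<Rightarrow> gauss_density \<sigma> (y - z))"
      by (simp add: integrable_gauss_density_shift[OF \<sigma>])
  qed measurable
  have pi: "integrable lborel ?p" using integrable_snd[OF pp] by simp
  \<comment> \<open>Every shifted Gaussian density has mass \<open>?c\<close>, and averaging over a
    probability measure preserves it. So both smoothed densities have equal mass, as
    \<open>tv_dist_density\<close> demands.\<close>
  have pc: "(\<integral>y. ?p y \<partial>lborel) = ?c"
    using Fubini_integral[OF pp] by (simp add: integrable_gauss_density_shift[OF \<sigma>] P.prob_space)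
  show "integrable lborel (\<lambda>y. h y z)"
    unfolding h_def by (intro Bochner_Integration.integrable_diff shift pi)
  have "smooth_tv_dist \<sigma> (empirical_measure n x) P = 1 / 2 * (\<integral>y. \<bar>?q y - ?p y\<bar> \<partial>lborel)"
    unfolding smooth_tv_dist_def e c
    by (rule tv_dist_density[OF qi _ pi])
      (auto simp: gauss_density_nonneg qc pc simp del: Bochner_Integration.integral_divide integral_divide_zero intro!: sum_nonneg divide_nonneg_nonneg)
  then have "sqrt n * smooth_tv_dist \<sigma> (empirical_measure n x) P = 1 / 2 * (\<integral>y. sqrt n * \<bar>?q y - ?p y\<bar> \<partial>lborel)"
    by simp
  moreover have "sqrt n * \<bar>?q y - ?p y\<bar> = \<bar>(\<Sum>i<n. h y (x i)) / sqrt n\<bar>" for y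
  proof -
    have a: "?q y - ?p y = (\<Sum>i<n. h y (x i)) / n"
      using n by (simp add: h_def sum_subtractf diff_divide_distrib)
    have "sqrt n * ((\<Sum>i<n. h y (x i)) / n) = (\<Sum>i<n. h y (x i)) * (sqrt n / n)"
      by simp
    also have "\<dots> = (\<Sum>i<n. h y (x i)) / sqrt n"
      unfolding sqrt_divide_self_eq[OF of_nat_0_le_iff] by (simp only: divide_inverse)
    finally have b: "sqrt n * ((\<Sum>i<n. h y (x i)) / n) = (\<Sum>i<n. h y (x i)) / sqrt n" .
    have "sqrt n * \<bar>?q y - ?p y\<bar> = \<bar>sqrt n * (?q y - ?p y)\<bar>" by (simp add: abs_mult)
    then show ?thesis unfolding a b .
  qed
  ultimately show "sqrt n * smooth_tv_dist \<sigma> (empirical_measure n x) P =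
    1 / 2 * (\<integral>y. \<bar>(\<Sum>i<n. h y (x i)) / sqrt n\<bar> \<partial>lborel)"
    by (simp only:)
qed

section \<open>The central limit theorem in \<open>L\<^sup>1\<close>\<close>

text \<open>The common ground of the empirical process and its Gaussian limit: integrable paths and
  second moments given by \<open>K\<close>.\<close>

definition second_order_process :: "'w measure \<Rightarrow> ('x::euclidean_space \<Rightarrow> 'w \<Rightarrow> real) \<Rightarrow> ('x \<Rightarrow> 'x \<Rightarrow> real) \<Rightarrow> bool" where
  "second_order_process N g K \<longleftrightarrow> prob_space N \<and> L1_valued N g \<and> (\<forall>x. g x \<in> borel_measurable N) \<and>
     (\<forall>x y. integrable N (\<lambda>\<omega>. g x \<omega> * g y \<omega>) \<and> (\<integral>\<omega>. g x \<omega> * g y \<omega> \<partial>N) = K x y)"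

lemma gaussian_second_order_process:
  assumes "centered_gaussian_process N B K" "L1_valued N B"
  shows "second_order_process N B K"
  using assms gaussian_process_integrable_mult[OF assms(1)]
  by (simp add: second_order_process_def centered_gaussian_process_def)

text \<open>\<open>f\<close> may be arbitrary, since composing it with a simple function gives a
  simple function; \<open>D\<close> of finite measure makes the result integrable.\<close>

lemma simple_function_integral_eq_sum:
  fixes q :: "'a \<Rightarrow> 'a" and f :: "'a \<Rightarrow> real"
  assumes q: "simple_function M q" and D[measurable]: "D \<in> sets M" and fin: "emeasure M D < \<infinity>"
  shows "integrable M (\<lambda>x. indicator D x * f (q x))"
    and "(\<integral>x. indicator D x * f (q x) \<partial>M) = (\<Sum>y\<in>q ` space M. measure M (D \<inter> (q -` {y} \<inter> space M)) * f y)"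
proof -
  have fq: "finite (q ` space M)" using q by (simp add: simple_function_def)
  have s: "D \<inter> (q -` {y} \<inter> space M) \<in> sets M" for y
    using simple_functionD(2)[OF q, of "{y}"] by auto
  have eq: "indicator D x * f (q x) = (\<Sum>y\<in>q ` space M. indicator (D \<inter> (q -` {y} \<inter> space M)) x * f y)"
    if x: "x \<in> space M" for x
  proof -
    have "(\<Sum>y\<in>q ` space M. indicator (D \<inter> (q -` {y} \<inter> space M)) x * f y) =
        (\<Sum>y\<in>q ` space M. if y = q x then indicator D x * f y else 0)"
      using x by (intro sum.cong) (auto split: split_indicator)
    then show ?thesis using fq x by simp
  qed
  have i: "has_bochner_integral M (\<lambda>x. indicator (D \<inter> (q -` {y} \<inter> space M)) x * f y)
      (measure M (D \<inter> (q -` {y} \<inter> space M)) * f y)" for y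
  proof (rule has_bochner_integral_mult_left, rule has_bochner_integral_real_indicator)
    show "emeasure M (D \<inter> (q -` {y} \<inter> space M)) < \<infinity>"
      using emeasure_mono[of "D \<inter> (q -` {y} \<inter> space M)" D M] fin D by (auto intro: le_less_trans)
  qed (use s in auto)
  have "has_bochner_integral M (\<lambda>x. indicator D x * f (q x))
      (\<Sum>y\<in>q ` space M. measure M (D \<inter> (q -` {y} \<inter> space M)) * f y)"
    using has_bochner_integral_sum[of "q ` space M" M, OF i] eq
    by (subst has_bochner_integral_cong[OF refl _ refl]) auto
  then show "integrable M (\<lambda>x. indicator D x * f (q x))"
    "(\<integral>x. indicator D x * f (q x) \<partial>M) = (\<Sum>y\<in>q ` space M. measure M (D \<inter> (q -` {y} \<inter> space M)) * f y)"
    by (auto simp: has_bochner_integral_iff)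
qed

text \<open>The factor \<open>c\<close> will be the value of the indicator of \<open>D\<close> at x,
  so that one bound serves inside and outside \<open>D\<close>.\<close>

lemma second_order_process_nn_abs_le:
  assumes g: "second_order_process N g K"
  shows "(\<integral>\<^sup>+\<omega>. ennreal \<bar>g x \<omega> - c * g y \<omega>\<bar> \<partial>N) \<le> ennreal (sqrt (K x x - 2 * c * K x y + c\<^sup>2 * K y y))"
proof -
  interpret prob_space N using g by (simp add: second_order_process_def)
  have m[measurable]: "g x \<in> borel_measurable N" for x
    using g by (simp add: second_order_process_def)
  have i: "integrable N (\<lambda>\<omega>. g x \<omega> * g y \<omega>)" and e: "(\<integral>\<omega>. g x \<omega> * g y \<omega> \<partial>N) = K x y" for x y
    using g by (simp_all add: second_order_process_def)
  have eq: "(g x \<omega> - c * g y \<omega>)\<^sup>2 = g x \<omega> * g x \<omega> - (2 * c) * (g x \<omega> * g y \<omega>) + c\<^sup>2 * (g y \<omega> * g y \<omega>)" for \<omega>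
    by (simp add: power2_eq_square algebra_simps)
  have i2: "integrable N (\<lambda>\<omega>. (g x \<omega> - c * g y \<omega>)\<^sup>2)"
    unfolding eq by (intro Bochner_Integration.integrable_add Bochner_Integration.integrable_diff integrable_mult_right i)
  have e2: "(\<integral>\<omega>. (g x \<omega> - c * g y \<omega>)\<^sup>2 \<partial>N) = K x x - 2 * c * K x y + c\<^sup>2 * K y y"
    unfolding eq by (simp add: i e)
  have "(\<integral>\<^sup>+\<omega>. ennreal \<bar>g x \<omega> - c * g y \<omega>\<bar> \<partial>N) = ennreal (expectation (\<lambda>\<omega>. \<bar>g x \<omega> - c * g y \<omega>\<bar>))"
    using expectation_abs_le_sqrt(1)[OF _ i2] by (intro nn_integral_eq_integral) auto
  also have "\<dots> \<le> ennreal (sqrt (K x x - 2 * c * K x y + c\<^sup>2 * K y y))"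
    using expectation_abs_le_sqrt(2)[OF _ i2] unfolding e2 by (intro ennreal_leI) auto
  finally show ?thesis .
qed

lemma second_order_process_measurable:
  assumes g: "second_order_process N g K"
  shows "(\<lambda>(x, \<omega>). g x \<omega>) \<in> borel_measurable (lborel \<Otimes>\<^sub>M N)"
    and "(\<lambda>\<omega>. \<integral>x. \<bar>g x \<omega>\<bar> \<partial>lborel) \<in> borel_measurable N"
proof -
  show [measurable]: "(\<lambda>(x, \<omega>). g x \<omega>) \<in> borel_measurable (lborel \<Otimes>\<^sub>M N)"
    using g unfolding second_order_process_def L1_valued_def
    by (subst measurable_cong_sets[OF sets_pair_measure_cong[OF sets_lborel refl] refl]) simp
  interpret N: prob_space N using g by (simp add: second_order_process_def)
  interpret pair_sigma_finite N lborel ..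
  have "(\<lambda>(\<omega>, x). \<bar>g x \<omega>\<bar>) \<in> borel_measurable (N \<Otimes>\<^sub>M lborel)"
    by measurable
  then show "(\<lambda>\<omega>. \<integral>x. \<bar>g x \<omega>\<bar> \<partial>lborel) \<in> borel_measurable N"
    by (rule lborel.borel_measurable_lebesgue_integral)
qed

text \<open>The indicator is nonnegative and can be moved inside the absolute value; the reverse
  triangle inequality then bounds the error, path by path, by the L^1 distance between g and its
  discretized copy. Fubini's theorem reduces the expectation to the second-moment bound at each
  x.\<close>

lemma second_order_process_discretize:
  assumes g: "second_order_process N g K"
    and q: "simple_function lborel q" and D[measurable]: "D \<in> sets lborel" and fin: "emeasure lborel D < \<infinity>"
  shows "(\<integral>\<^sup>+\<omega>. ennreal \<bar>(\<integral>x. \<bar>g x \<omega>\<bar> \<partial>lborel) - (\<Sum>y\<in>range q. measure lborel (D \<inter> q -` {y}) * \<bar>g y \<omega>\<bar>)\<bar> \<partial>N)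
    \<le> (\<integral>\<^sup>+x. ennreal (sqrt (K x x - 2 * indicator D x * K x (q x) + (indicator D x)\<^sup>2 * K (q x) (q x))) \<partial>lborel)"
proof -
  interpret N: prob_space N using g by (simp add: second_order_process_def)
  interpret pair_sigma_finite lborel N ..
  note [measurable] = second_order_process_measurable(1)[OF g]
  have [measurable]: "q \<in> lborel \<rightarrow>\<^sub>M lborel"
    using borel_measurable_simple_function[OF q] by simp
  have joint[measurable]: "(\<lambda>(x, \<omega>). g (q x) \<omega>) \<in> borel_measurable (lborel \<Otimes>\<^sub>M N)"
  proof -
    have "(\<lambda>z. (\<lambda>(x, \<omega>). g x \<omega>) (q (fst z), snd z)) \<in> borel_measurable (lborel \<Otimes>\<^sub>M N)"
      by (rule measurable_compose[OF _ second_order_process_measurable(1)[OF g]]) measurable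
    then show ?thesis by (simp add: case_prod_beta)
  qed
  have "(\<integral>\<^sup>+\<omega>. ennreal \<bar>(\<integral>x. \<bar>g x \<omega>\<bar> \<partial>lborel) - (\<Sum>y\<in>range q. measure lborel (D \<inter> q -` {y}) * \<bar>g y \<omega>\<bar>)\<bar> \<partial>N)
    \<le> (\<integral>\<^sup>+\<omega>. \<integral>\<^sup>+x. ennreal \<bar>g x \<omega> - indicator D x * g (q x) \<omega>\<bar> \<partial>lborel \<partial>N)"
  proof (rule nn_integral_mono)
    fix \<omega> assume \<omega>: "\<omega> \<in> space N"
    have gi: "integrable lborel (\<lambda>x. g x \<omega>)"
      using g \<omega> by (simp add: second_order_process_def L1_valued_def)
    note sf = simple_function_integral_eq_sum[OF q D fin]
    have "(\<integral>x. \<bar>g x \<omega>\<bar> \<partial>lborel) - (\<Sum>y\<in>range q. measure lborel (D \<inter> q -` {y}) * \<bar>g y \<omega>\<bar>)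
      = (\<integral>x. \<bar>g x \<omega>\<bar> - indicator D x * \<bar>g (q x) \<omega>\<bar> \<partial>lborel)"
      using sf[of "\<lambda>y. \<bar>g y \<omega>\<bar>"] gi by (simp add: space_borel)
    also have "\<bar>\<dots>\<bar> \<le> (\<integral>x. \<bar>\<bar>g x \<omega>\<bar> - indicator D x * \<bar>g (q x) \<omega>\<bar>\<bar> \<partial>lborel)"
      by (rule integral_abs_bound)
    also have "\<dots> \<le> (\<integral>x. \<bar>g x \<omega> - indicator D x * g (q x) \<omega>\<bar> \<partial>lborel)"
      using sf(1)[of "\<lambda>y. \<bar>g y \<omega>\<bar>"] sf(1)[of "\<lambda>y. g y \<omega>"] gi
      by (intro integral_mono) (auto split: split_indicator)
    finally have "ennreal \<bar>(\<integral>x. \<bar>g x \<omega>\<bar> \<partial>lborel) - (\<Sum>y\<in>range q. measure lborel (D \<inter> q -` {y}) * \<bar>g y \<omega>\<bar>)\<bar>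
      \<le> ennreal (\<integral>x. \<bar>g x \<omega> - indicator D x * g (q x) \<omega>\<bar> \<partial>lborel)" by (rule ennreal_leI)
    also have "\<dots> = (\<integral>\<^sup>+x. ennreal \<bar>g x \<omega> - indicator D x * g (q x) \<omega>\<bar> \<partial>lborel)"
      using sf(1)[of "\<lambda>y. g y \<omega>"] gi by (intro nn_integral_eq_integral[symmetric]) auto
    finally show "ennreal \<bar>(\<integral>x. \<bar>g x \<omega>\<bar> \<partial>lborel) - (\<Sum>y\<in>range q. measure lborel (D \<inter> q -` {y}) * \<bar>g y \<omega>\<bar>)\<bar>
      \<le> (\<integral>\<^sup>+x. ennreal \<bar>g x \<omega> - indicator D x * g (q x) \<omega>\<bar> \<partial>lborel)" .
  qed
  also have "\<dots> = (\<integral>\<^sup>+x. \<integral>\<^sup>+\<omega>. ennreal \<bar>g x \<omega> - indicator D x * g (q x) \<omega>\<bar> \<partial>N \<partial>lborel)"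
    by (rule Fubini') measurable
  also have "\<dots> \<le> (\<integral>\<^sup>+x. ennreal (sqrt (K x x - 2 * indicator D x * K x (q x) + (indicator D x)\<^sup>2 * K (q x) (q x))) \<partial>lborel)"
    by (intro nn_integral_mono second_order_process_nn_abs_le[OF g])
  finally show ?thesis .
qed

lemma second_order_process_L1_norm:
  assumes g: "second_order_process N g K"
    and fin: "(\<integral>\<^sup>+x. ennreal (sqrt (K x x)) \<partial>lborel) < \<infinity>"
  shows "integrable N (\<lambda>\<omega>. \<integral>x. \<bar>g x \<omega>\<bar> \<partial>lborel)"
    and "ennreal (\<integral>\<omega>. (\<integral>x. \<bar>g x \<omega>\<bar> \<partial>lborel) \<partial>N) \<le> (\<integral>\<^sup>+x. ennreal (sqrt (K x x)) \<partial>lborel)"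
proof -
  \<comment> \<open>For empty \<open>D\<close> the discrete sum is 0 and the error is the L^1 norm
    itself.\<close>
  have *: "(\<integral>\<^sup>+\<omega>. ennreal (\<integral>x. \<bar>g x \<omega>\<bar> \<partial>lborel) \<partial>N) \<le> (\<integral>\<^sup>+x. ennreal (sqrt (K x x)) \<partial>lborel)"
    using second_order_process_discretize[OF g, of "\<lambda>_. 0" "{}"] by simp
  show i: "integrable N (\<lambda>\<omega>. \<integral>x. \<bar>g x \<omega>\<bar> \<partial>lborel)"
    using second_order_process_measurable(2)[OF g] le_less_trans[OF * fin]
    by (intro integrableI_nonneg) auto
  show "ennreal (\<integral>\<omega>. (\<integral>x. \<bar>g x \<omega>\<bar> \<partial>lborel) \<partial>N) \<le> (\<integral>\<^sup>+x. ennreal (sqrt (K x x)) \<partial>lborel)"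
    using * by (subst (asm) nn_integral_eq_integral[OF i]) auto
qed

text \<open>The map a \<mapsto> exp(ia) is 1-Lipschitz on the real line.\<close>

lemma (in prob_space) char_diff_le:
  assumes [measurable]: "U \<in> borel_measurable M" "V \<in> borel_measurable M"
    and le: "(\<integral>\<^sup>+\<omega>. ennreal \<bar>U \<omega> - V \<omega>\<bar> \<partial>M) \<le> ennreal \<epsilon>" and "0 \<le> \<epsilon>"
  shows "norm ((\<integral>\<omega>. iexp (t * U \<omega>) \<partial>M) - (\<integral>\<omega>. iexp (t * V \<omega>) \<partial>M)) \<le> \<bar>t\<bar> * \<epsilon>"
proof -
  have i: "integrable M (\<lambda>\<omega>. \<bar>U \<omega> - V \<omega>\<bar>)"
    using le by (intro integrableI_nonneg) (auto intro: le_less_trans)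
  then have d: "(\<integral>\<omega>. \<bar>U \<omega> - V \<omega>\<bar> \<partial>M) \<le> \<epsilon>"
    using le \<open>0 \<le> \<epsilon>\<close> by (subst (asm) nn_integral_eq_integral) auto
  have e: "norm (iexp a - iexp b) \<le> \<bar>a - b\<bar>" for a b
  proof -
    have "iexp a - iexp b = iexp b * (iexp (a - b) - 1)"
      by (simp add: right_diff_distrib exp_add[symmetric])
    then have "norm (iexp a - iexp b) = norm (iexp (a - b) - 1)"
      by (simp add: norm_mult del: of_real_diff)
    then show ?thesis using iexp_approx1[of "a - b" 0] by simp
  qed
  have iU: "integrable M (\<lambda>\<omega>. iexp (t * U \<omega>))" and iV: "integrable M (\<lambda>\<omega>. iexp (t * V \<omega>))"
    by (intro integrable_const_bound[where B=1]; simp del: of_real_mult)+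
  have "norm ((\<integral>\<omega>. iexp (t * U \<omega>) \<partial>M) - (\<integral>\<omega>. iexp (t * V \<omega>) \<partial>M)) = norm (\<integral>\<omega>. iexp (t * U \<omega>) - iexp (t * V \<omega>) \<partial>M)"
    by (simp only: Bochner_Integration.integral_diff[OF iU iV])
  also have "\<dots> \<le> (\<integral>\<omega>. norm (iexp (t * U \<omega>) - iexp (t * V \<omega>)) \<partial>M)"
    by (rule integral_norm_bound)
  also have "\<dots> \<le> (\<integral>\<omega>. \<bar>t\<bar> * \<bar>U \<omega> - V \<omega>\<bar> \<partial>M)"
  proof (rule integral_mono)
    show "norm (iexp (t * U \<omega>) - iexp (t * V \<omega>)) \<le> \<bar>t\<bar> * \<bar>U \<omega> - V \<omega>\<bar>" for \<omega>
      using e[of "t * U \<omega>" "t * V \<omega>"] by (simp only: right_diff_distrib[symmetric] abs_mult)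
    show "integrable M (\<lambda>\<omega>. norm (iexp (t * U \<omega>) - iexp (t * V \<omega>)))"
      by (intro integrable_norm Bochner_Integration.integrable_diff iU iV)
    show "integrable M (\<lambda>\<omega>. \<bar>t\<bar> * \<bar>U \<omega> - V \<omega>\<bar>)"
      using i by (rule integrable_mult_right)
  qed
  also have "\<dots> = \<bar>t\<bar> * (\<integral>\<omega>. \<bar>U \<omega> - V \<omega>\<bar> \<partial>M)" by simp
  also have "\<dots> \<le> \<bar>t\<bar> * \<epsilon>" using d by (intro mult_left_mono) auto
  finally show ?thesis .
qed

lemma discretization_exists:
  fixes K :: "'x::euclidean_space \<Rightarrow> 'x \<Rightarrow> real"
  assumes K: "psd_kernel K"
    and Km: "(\<lambda>(x, y). K x y) \<in> borel_measurable (borel \<Otimes>\<^sub>M borel)"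
    and bound: "\<And>x. K x x \<le> C"
    and cont: "\<And>x. ((\<lambda>y. K x x - 2 * K x y + K y y) \<longlongrightarrow> 0) (at x)"
    and fin: "(\<integral>\<^sup>+x. ennreal (sqrt (K x x)) \<partial>lborel) < \<infinity>"
    and "\<epsilon> > 0"
  shows "\<exists>D q. D \<in> sets lborel \<and> emeasure lborel D < \<infinity> \<and> simple_function lborel q \<and>
    (\<integral>\<^sup>+x. ennreal (sqrt (K x x - 2 * indicator D x * K x (q x) + (indicator D x)\<^sup>2 * K (q x) (q x))) \<partial>lborel)
      \<le> ennreal \<epsilon>"
proof -
  have Kcomp: "(\<lambda>x. K (a x) (b x)) \<in> borel_measurable M"
    if "a \<in> borel_measurable M" "b \<in> borel_measurable M" for a b and M :: "'x measure"
    using measurable_compose[OF measurable_Pair[OF that] Km] by simp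
  have [measurable]: "(\<lambda>x. K x x) \<in> borel_measurable lborel"
    by (rule Kcomp) auto
  let ?D = "\<lambda>R::nat. ball (0::'x) (real R)"
  have [measurable]: "?D R \<in> sets borel" for R by simp
  let ?u = "\<lambda>R x. indicator (- ?D R) x * ennreal (sqrt (K x x))"
  \<comment> \<open>Outside a large ball nothing is approximated, and the tail of the integrable
    standard deviation costs at most \<epsilon> / 2.\<close>
  have "(\<lambda>R. \<integral>\<^sup>+x. ?u R x \<partial>lborel) \<longlonglongrightarrow> (\<integral>\<^sup>+x. 0 \<partial>(lborel :: 'x measure))"
  proof (rule nn_integral_dominated_convergence[where w="\<lambda>x. ennreal (sqrt (K x x))"])
    show "AE x in lborel. (\<lambda>R. ?u R x) \<longlonglongrightarrow> 0"
    proof (rule AE_I2, rule tendsto_eventually)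
      fix x :: 'x
      show "\<forall>\<^sub>F R in sequentially. ?u R x = 0"
        using eventually_gt_at_top[of "nat \<lceil>norm x\<rceil>"]
        by eventually_elim (auto simp: dist_norm split: split_indicator; linarith)
    qed
  qed (use fin in \<open>auto split: split_indicator\<close>)
  then have "eventually (\<lambda>R. (\<integral>\<^sup>+x. ?u R x \<partial>lborel) < ennreal (\<epsilon> / 2)) sequentially"
    using \<open>\<epsilon> > 0\<close> by (intro order_tendstoD(2)) auto
  then obtain R where R: "(\<integral>\<^sup>+x. ?u R x \<partial>lborel) < ennreal (\<epsilon> / 2)"
    by (auto simp: eventually_sequentially)
  let ?d = "\<lambda>x y. K x x - 2 * K x y + K y y"
  \<comment> \<open>Nonnegativity of the form with coefficients 1, 1 gives
    \<open>?d x y \<le> 2 * (K x x + K y y)\<close>, hence the constant 4 C.\<close>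
  have d_le: "?d x y \<le> 4 * C" for x y
    using psd_kernel_pair[OF K, of 1 x 1 y] bound[of x] bound[of y] by simp
  obtain q :: "nat \<Rightarrow> 'x \<Rightarrow> 'x" where q: "\<And>i. simple_function lborel (q i)" "\<And>x. (\<lambda>i. q i x) \<longlonglongrightarrow> x"
  proof -
    have "\<exists>q. (\<forall>i. simple_function lborel (q i)) \<and> (\<forall>x. (\<lambda>i. q i x) \<longlonglongrightarrow> (x :: 'x))"
      using borel_measurable_implies_sequence_metric[of "\<lambda>x::'x. x" lborel 0] by auto
    then show ?thesis using that by blast
  qed
  have [measurable]: "q i \<in> borel_measurable lborel" for i
    using borel_measurable_simple_function[OF q(1)] .
  have [measurable]: "(\<lambda>x. K x (q i x)) \<in> borel_measurable lborel" "(\<lambda>x. K (q i x) (q i x)) \<in> borel_measurable lborel" for i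
    by (rule Kcomp; measurable)+
  let ?v = "\<lambda>i x. indicator (?D R) x * ennreal (sqrt (?d x (q i x)))"
  \<comment> \<open>Inside the ball simple functions tend pointwise to the identity. The kernel
    distance from x to \<open>q i x\<close> tends to 0 and is bounded on a set of finite measure, so
    dominated convergence gives the other \<epsilon> / 2.\<close>
  have "(\<lambda>i. \<integral>\<^sup>+x. ?v i x \<partial>lborel) \<longlonglongrightarrow> (\<integral>\<^sup>+x. 0 \<partial>(lborel :: 'x measure))"
  proof (rule nn_integral_dominated_convergence[where w="\<lambda>x. indicator (?D R) x * ennreal (sqrt (4 * C))"])
    show "AE x in lborel. (\<lambda>i. ?v i x) \<longlonglongrightarrow> 0"
    proof (rule AE_I2)
      fix x :: 'x
      have "isCont (\<lambda>y. ?d x y) x" unfolding isCont_def using cont[of x] by simp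
      from isCont_tendsto_compose[OF this q(2)[of x]]
      have "(\<lambda>i. ?d x (q i x)) \<longlonglongrightarrow> 0" by simp
      then have "(\<lambda>i. ennreal (sqrt (?d x (q i x)))) \<longlonglongrightarrow> ennreal (sqrt 0)"
        by (intro tendsto_ennrealI tendsto_real_sqrt)
      then show "(\<lambda>i. ?v i x) \<longlonglongrightarrow> 0" by (cases "x \<in> ?D R") simp_all
    qed
    show "(\<integral>\<^sup>+x. indicator (?D R) x * ennreal (sqrt (4 * C)) \<partial>lborel) < \<infinity>"
      using emeasure_bounded_finite[of "?D R"]
      by (subst nn_integral_multc) (auto simp: ennreal_mult_less_top less_top)
    show "AE x in lborel. ?v i x \<le> indicator (?D R) x * ennreal (sqrt (4 * C))" for i
      by (intro AE_I2 mult_left_mono ennreal_leI real_sqrt_le_mono d_le) simp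
  qed measurable
  then have "eventually (\<lambda>i. (\<integral>\<^sup>+x. ?v i x \<partial>lborel) < ennreal (\<epsilon> / 2)) sequentially"
    using \<open>\<epsilon> > 0\<close> by (intro order_tendstoD(2)) auto
  then obtain i where i: "(\<integral>\<^sup>+x. ?v i x \<partial>lborel) < ennreal (\<epsilon> / 2)"
    by (auto simp: eventually_sequentially)
  have "(\<integral>\<^sup>+x. ennreal (sqrt (K x x - 2 * indicator (?D R) x * K x (q i x) + (indicator (?D R) x)\<^sup>2 * K (q i x) (q i x))) \<partial>lborel)
    = (\<integral>\<^sup>+x. ?u R x + ?v i x \<partial>lborel)"
    by (intro nn_integral_cong) (simp split: split_indicator)
  also have "\<dots> = (\<integral>\<^sup>+x. ?u R x \<partial>lborel) + (\<integral>\<^sup>+x. ?v i x \<partial>lborel)"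
    by (rule nn_integral_add) measurable
  also have "\<dots> \<le> ennreal (\<epsilon> / 2) + ennreal (\<epsilon> / 2)"
    using R i by (intro add_mono) auto
  also have "\<dots> = ennreal \<epsilon>" using \<open>\<epsilon> > 0\<close> by (subst ennreal_plus[symmetric]) auto
  finally show ?thesis
    using q(1)[of i] emeasure_bounded_finite[of "?D R"]
    by (intro exI[of _ "?D R"] exI[of _ "q i"]) (auto simp: less_top)
qed

lemma second_order_process_L1_norm_tendsto:
  fixes G :: "nat \<Rightarrow> 'x::euclidean_space \<Rightarrow> 'a \<Rightarrow> real" and B :: "'x \<Rightarrow> 'b \<Rightarrow> real"
  assumes K: "psd_kernel K"
    and Km: "(\<lambda>(x, y). K x y) \<in> borel_measurable (borel \<Otimes>\<^sub>M borel)"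
    and bound: "\<And>x. K x x \<le> C"
    and cont: "\<And>x. ((\<lambda>y. K x x - 2 * K x y + K y y) \<longlongrightarrow> 0) (at x)"
    and fin: "(\<integral>\<^sup>+x. ennreal (sqrt (K x x)) \<partial>lborel) < \<infinity>"
    and M: "prob_space M" and Gm: "\<And>n x. G n x \<in> borel_measurable M"
    and G: "\<And>n. n \<ge> 1 \<Longrightarrow> second_order_process M (G n) K"
    and B: "second_order_process N B K"
    and lim: "\<And>T c. finite T \<Longrightarrow> (\<lambda>n. \<integral>\<omega>. iexp (\<Sum>t\<in>T. c t * G n t \<omega>) \<partial>M)
      \<longlonglongrightarrow> (\<integral>\<omega>. iexp (\<Sum>t\<in>T. c t * B t \<omega>) \<partial>N)"
  shows "(\<lambda>n. \<integral>\<omega>. iexp (t * (\<integral>x. \<bar>G n x \<omega>\<bar> \<partial>lborel)) \<partial>M) \<longlonglongrightarrow> (\<integral>\<omega>. iexp (t * (\<integral>x. \<bar>B x \<omega>\<bar> \<partial>lborel)) \<partial>N)"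
proof (rule LIMSEQ_I)
  interpret M: prob_space M by fact
  interpret N: prob_space N using B by (simp add: second_order_process_def)
  have Bm[measurable]: "B x \<in> borel_measurable N" for x using B by (simp add: second_order_process_def)
  note [measurable] = Gm
  fix r :: real assume "0 < r"
  \<comment> \<open>Both discretization errors are then at most r / 4, and with r / 4 for the
    discrete sums the total stays below r. The summand 1 covers t = 0.\<close>
  define \<epsilon> where "\<epsilon> = r / (4 * (\<bar>t\<bar> + 1))"
  have \<epsilon>: "\<epsilon> > 0" using \<open>0 < r\<close> by (simp add: \<epsilon>_def)
  have t\<epsilon>: "\<bar>t\<bar> * \<epsilon> \<le> r / 4"
    using \<open>0 < r\<close> unfolding \<epsilon>_def by (simp add: field_simps)
  obtain D q where D: "D \<in> sets lborel" "emeasure lborel D < \<infinity>" and q: "simple_function lborel q"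
    and le: "(\<integral>\<^sup>+x. ennreal (sqrt (K x x - 2 * indicator D x * K x (q x) + (indicator D x)\<^sup>2 * K (q x) (q x))) \<partial>lborel)
      \<le> ennreal \<epsilon>"
    using discretization_exists[OF K Km bound cont fin \<epsilon>] by blast
  define a where "a y = measure lborel (D \<inter> q -` {y})" for y
  define S where "S y = (\<Sum>x\<in>range q. a x * \<bar>y x\<bar>)" for y
  have fq: "finite (range q)" using q by (simp add: simple_function_def)
  have errG: "norm ((\<integral>\<omega>. iexp (t * (\<integral>x. \<bar>G n x \<omega>\<bar> \<partial>lborel)) \<partial>M) - (\<integral>\<omega>. iexp (t * S (\<lambda>x. G n x \<omega>)) \<partial>M)) \<le> \<bar>t\<bar> * \<epsilon>"
    if n: "n \<ge> 1" for n
  proof (rule M.char_diff_le)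
    show "(\<lambda>\<omega>. \<integral>x. \<bar>G n x \<omega>\<bar> \<partial>lborel) \<in> borel_measurable M"
      by (rule second_order_process_measurable(2)[OF G[OF n]])
    show "(\<integral>\<^sup>+\<omega>. ennreal \<bar>(\<integral>x. \<bar>G n x \<omega>\<bar> \<partial>lborel) - S (\<lambda>x. G n x \<omega>)\<bar> \<partial>M) \<le> ennreal \<epsilon>"
      using order_trans[OF second_order_process_discretize[OF G[OF n] q D] le] unfolding S_def a_def .
    show "(\<lambda>\<omega>. S (\<lambda>x. G n x \<omega>)) \<in> borel_measurable M" unfolding S_def by measurable
  qed (use \<epsilon> in simp)
  have errB: "norm ((\<integral>\<omega>. iexp (t * (\<integral>x. \<bar>B x \<omega>\<bar> \<partial>lborel)) \<partial>N) - (\<integral>\<omega>. iexp (t * S (\<lambda>x. B x \<omega>)) \<partial>N)) \<le> \<bar>t\<bar> * \<epsilon>"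
  proof (rule N.char_diff_le)
    show "(\<lambda>\<omega>. \<integral>x. \<bar>B x \<omega>\<bar> \<partial>lborel) \<in> borel_measurable N"
      by (rule second_order_process_measurable(2)[OF B])
    show "(\<integral>\<^sup>+\<omega>. ennreal \<bar>(\<integral>x. \<bar>B x \<omega>\<bar> \<partial>lborel) - S (\<lambda>x. B x \<omega>)\<bar> \<partial>N) \<le> ennreal \<epsilon>"
      using order_trans[OF second_order_process_discretize[OF B q D] le] unfolding S_def a_def .
    show "(\<lambda>\<omega>. S (\<lambda>x. B x \<omega>)) \<in> borel_measurable N" unfolding S_def by measurable
  qed (use \<epsilon> in simp)
  have S_prod: "iexp (t * S y) = (\<Prod>x\<in>range q. iexp (t * a x * \<bar>y x\<bar>))" for y
    unfolding S_def by (simp add: exp_sum[OF fq, symmetric] sum_distrib_left mult.assoc)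
  have "(\<lambda>n. \<integral>\<omega>. iexp (t * S (\<lambda>x. G n x \<omega>)) \<partial>M) \<longlonglongrightarrow> (\<integral>\<omega>. iexp (t * S (\<lambda>x. B x \<omega>)) \<partial>N)"
    unfolding S_prod
  proof (rule expectation_prod_tendsto_continuous[OF M N.prob_space_axioms fq Gm Bm lim[OF fq]])
    show "isCont (\<lambda>v. iexp (t * a x * \<bar>v\<bar>)) v" for x v
      by (intro continuous_intros)
    show "norm (iexp (t * a x * \<bar>v\<bar>)) \<le> 1" for x v by (simp del: of_real_mult)
  qed
  then obtain n0 where n0: "\<And>n. n \<ge> n0 \<Longrightarrow>
      norm ((\<integral>\<omega>. iexp (t * S (\<lambda>x. G n x \<omega>)) \<partial>M) - (\<integral>\<omega>. iexp (t * S (\<lambda>x. B x \<omega>)) \<partial>N)) < r / 4"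
    using \<open>0 < r\<close> LIMSEQ_D[of _ _ "r / 4"] by (metis divide_pos_pos zero_less_numeral)
  show "\<exists>no. \<forall>n\<ge>no. norm ((\<integral>\<omega>. iexp (t * (\<integral>x. \<bar>G n x \<omega>\<bar> \<partial>lborel)) \<partial>M) - (\<integral>\<omega>. iexp (t * (\<integral>x. \<bar>B x \<omega>\<bar> \<partial>lborel)) \<partial>N)) < r"
  proof (intro exI allI impI)
    fix n assume "max 1 n0 \<le> n"
    then have n: "1 \<le> n" "n0 \<le> n" by auto
    have tri: "norm (u - v) \<le> norm (u - u') + norm (u' - v') + norm (v - v')" for u u' v v' :: complex
      using norm_triangle_ineq[of "u - u'" "u' - v"] norm_triangle_ineq[of "u' - v'" "v' - v"]
      by (simp add: norm_minus_commute)
    show "norm ((\<integral>\<omega>. iexp (t * (\<integral>x. \<bar>G n x \<omega>\<bar> \<partial>lborel)) \<partial>M) - (\<integral>\<omega>. iexp (t * (\<integral>x. \<bar>B x \<omega>\<bar> \<partial>lborel)) \<partial>N)) < r"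
      using tri[of "\<integral>\<omega>. iexp (t * (\<integral>x. \<bar>G n x \<omega>\<bar> \<partial>lborel)) \<partial>M" "\<integral>\<omega>. iexp (t * (\<integral>x. \<bar>B x \<omega>\<bar> \<partial>lborel)) \<partial>N"
          "\<integral>\<omega>. iexp (t * S (\<lambda>x. G n x \<omega>)) \<partial>M" "\<integral>\<omega>. iexp (t * S (\<lambda>x. B x \<omega>)) \<partial>N"]
        errG[OF n(1)] errB n0[OF n(2)] t\<epsilon> \<open>0 < r\<close> by linarith
  qed
qed

section \<open>Empirical processes of bounded centred kernels\<close>

lemma (in prob_space) iid_covariance:
  fixes f g :: "'z \<Rightarrow> real" and X :: "nat \<Rightarrow> 'a \<Rightarrow> 'z"
  assumes indep: "indep_vars (\<lambda>_. S) X UNIV" and distr: "\<And>i. distr M S (X i) = P"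
    and [measurable]: "f \<in> borel_measurable S" "g \<in> borel_measurable S"
    and int: "integrable P f" "integrable P g" "integrable P (\<lambda>z. f z * g z)"
    and mean: "(\<integral>z. f z \<partial>P) = 0"
  shows "integrable M (\<lambda>\<omega>. (\<Sum>i<n. f (X i \<omega>)) * (\<Sum>i<n. g (X i \<omega>)))"
    and "(\<integral>\<omega>. (\<Sum>i<n. f (X i \<omega>)) * (\<Sum>i<n. g (X i \<omega>)) \<partial>M) = n * (\<integral>z. f z * g z \<partial>P)"
proof -
  have [measurable]: "X i \<in> measurable M S" for i
    using indep by (simp add: indep_vars_def)
  have i: "integrable M (\<lambda>\<omega>. k (X i \<omega>))" "(\<integral>\<omega>. k (X i \<omega>) \<partial>M) = (\<integral>z. k z \<partial>P)"
    if "k \<in> borel_measurable S" "integrable P k" for k :: "'z \<Rightarrow> real" and i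
    using that integrable_distr[of "X i" M S k] integral_distr[of "X i" M S k] distr[of i] by auto
  have *: "integrable M (\<lambda>\<omega>. f (X i \<omega>) * g (X j \<omega>)) \<and>
      (\<integral>\<omega>. f (X i \<omega>) * g (X j \<omega>) \<partial>M) = (if i = j then \<integral>z. f z * g z \<partial>P else 0)" for i j
  proof (cases "i = j")
    case True
    then show ?thesis using i[of "\<lambda>z. f z * g z" i] int by simp
  next
    case False
    \<comment> \<open>One indexed family holds both functions, so that the product rule for
      independent variables applies over {i, j}. The product of means vanishes because f is
      centred.\<close>
    define Y where "Y k = (if k = i then f else g)" for k
    have Y: "indep_vars (\<lambda>_. borel) (\<lambda>k \<omega>. Y k (X k \<omega>)) {i, j}"
      by (rule indep_vars_compose2[OF indep_vars_subset[OF indep]]) (auto simp: Y_def)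
    have "integrable M (\<lambda>\<omega>. Y k (X k \<omega>))" for k
      unfolding Y_def by (rule i(1)) (auto simp: int)
    note prod = indep_vars_lebesgue_integral[OF _ Y this] indep_vars_integrable[OF _ Y this]
    have "(\<Prod>k\<in>{i, j}. Y k (X k \<omega>)) = f (X i \<omega>) * g (X j \<omega>)" for \<omega>
      using False by (simp add: Y_def)
    moreover have "(\<Prod>k\<in>{i, j}. \<integral>\<omega>. Y k (X k \<omega>) \<partial>M) = 0"
      using i(2)[of f i] int mean by (simp add: Y_def)
    ultimately show ?thesis using prod False by simp
  qed
  have eq: "(\<Sum>i<n. f (X i \<omega>)) * (\<Sum>i<n. g (X i \<omega>)) = (\<Sum>i<n. \<Sum>j<n. f (X i \<omega>) * g (X j \<omega>))" for \<omega>
    by (rule sum_product)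
  show "integrable M (\<lambda>\<omega>. (\<Sum>i<n. f (X i \<omega>)) * (\<Sum>i<n. g (X i \<omega>)))"
    unfolding eq using * by (intro Bochner_Integration.integrable_sum) blast
  show "(\<integral>\<omega>. (\<Sum>i<n. f (X i \<omega>)) * (\<Sum>i<n. g (X i \<omega>)) \<partial>M) = n * (\<integral>z. f z * g z \<partial>P)"
    unfolding eq using * by simp
qed

text \<open>Only these features of the centred Gaussian kernel enter the limit theorem: boundedness
  provides all moments and the dominating constants, and continuity in x makes the covariance kernel
  continuous.\<close>

locale bounded_kernel_sample = prob_space M
  for M :: "'a measure" +
  fixes h :: "'x::euclidean_space \<Rightarrow> 'z \<Rightarrow> real" and X :: "nat \<Rightarrow> 'a \<Rightarrow> 'z" and S :: "'z measure"
    and P :: "'z measure" and C :: real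
  assumes indep: "indep_vars (\<lambda>_. S) X UNIV" and distr: "\<And>i. distr M S (X i) = P"
    and hm: "(\<lambda>(x, z). h x z) \<in> borel_measurable (borel \<Otimes>\<^sub>M S)"
    and mean: "\<And>x. (\<integral>z. h x z \<partial>P) = 0"
    and bound: "\<And>x z. \<bar>h x z\<bar> \<le> C"
    and cont: "\<And>x z. isCont (\<lambda>x. h x z) x"
    and int: "\<And>z. integrable lborel (\<lambda>x. h x z)"
begin

text \<open>As every \<open>h x\<close> has mean 0 under \<open>P\<close>, this is a covariance
  kernel.\<close>

definition "kcov = (\<lambda>x y. \<integral>z. h x z * h y z \<partial>P)"

lemma X_measurable: "X i \<in> measurable M S"
  using indep by (simp add: indep_vars_def)

lemma sets_P: "sets P = sets S"
  using sets_distr[of M S "X 0", unfolded distr] .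

lemma prob_space_P: "prob_space P"
  using prob_space_distr[OF X_measurable[of 0]] distr[of 0] by simp

lemma h_measurable: "h x \<in> borel_measurable S"
  using measurable_compose[OF measurable_Pair1'[of x borel S] hm] by simp

lemma h_measurable_P: "h x \<in> borel_measurable P"
  using h_measurable by (simp only: measurable_cong_sets[OF sets_P refl])

lemma h_mult_measurable: "(\<lambda>z. h x z * h y z) \<in> borel_measurable P"
  by (intro borel_measurable_times h_measurable_P)

lemma measurable_h: "a \<in> borel_measurable R \<Longrightarrow> b \<in> measurable R S \<Longrightarrow> (\<lambda>r. h (a r) (b r)) \<in> borel_measurable R"
  using measurable_compose[OF measurable_Pair hm] by simp

lemma h_mult_bound: "\<bar>h x z * h y z\<bar> \<le> C * C"
  unfolding abs_mult using bound order_trans[OF abs_ge_zero bound[of x z]] by (intro mult_mono) auto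

lemma h_integrable: "integrable P (h x)" and h_integrable2: "integrable P (\<lambda>z. h x z * h y z)"
proof -
  interpret P: prob_space P by (rule prob_space_P)
  show "integrable P (h x)"
  proof (rule P.integrable_const_bound)
    show "AE z in P. norm (h x z) \<le> C" using bound by (intro AE_I2) simp
    show "h x \<in> borel_measurable P" by (rule h_measurable_P)
  qed
  show "integrable P (\<lambda>z. h x z * h y z)"
  proof (rule P.integrable_const_bound)
    show "AE z in P. norm (h x z * h y z) \<le> C * C" using h_mult_bound by (intro AE_I2) simp
    show "(\<lambda>z. h x z * h y z) \<in> borel_measurable P" by (rule h_mult_measurable)
  qed
qed

lemma kcov_quad_form: "integrable P (\<lambda>z. (\<Sum>t\<in>T. c t * h t z)\<^sup>2)"
  "(\<integral>z. (\<Sum>t\<in>T. c t * h t z)\<^sup>2 \<partial>P) = quad_form kcov T c"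
  unfolding kcov_def by (rule integral_sum_power2[where B=h and N=P, OF h_integrable2])+

lemma psd_kcov: "psd_kernel kcov"
  unfolding psd_kernel_def
proof (intro conjI allI)
  show "kcov x y = kcov y x" for x y by (simp add: kcov_def mult.commute)
  show "0 \<le> (\<Sum>i<n. \<Sum>j<n. c i * c j * kcov (x i) (x j))" for n :: nat and x c
  proof -
    have "0 \<le> (\<integral>z. (\<Sum>i<n. c i * h (x i) z)\<^sup>2 \<partial>P)" by simp
    also have "\<dots> = (\<Sum>i<n. \<Sum>j<n. c i * c j * kcov (x i) (x j))"
      unfolding kcov_def
      by (rule integral_sum_power2(2)[where B="\<lambda>i. h (x i)", OF h_integrable2, where T="{..<n}" and c=c, unfolded quad_form_def])
    finally show ?thesis .
  qed
qed

lemma kcov_measurable: "(\<lambda>(x, y). kcov x y) \<in> borel_measurable (borel \<Otimes>\<^sub>M borel)"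
proof -
  interpret P: prob_space P by (rule prob_space_P)
  have "(\<lambda>(w, z). h (fst w) z * h (snd w) z) \<in> borel_measurable ((borel \<Otimes>\<^sub>M borel) \<Otimes>\<^sub>M P)"
  proof -
    have m: "(\<lambda>r. fst (fst r)) \<in> borel_measurable ((borel \<Otimes>\<^sub>M borel) \<Otimes>\<^sub>M P)"
      "(\<lambda>r. snd (fst r)) \<in> borel_measurable ((borel \<Otimes>\<^sub>M borel) \<Otimes>\<^sub>M P)"
      "(\<lambda>r. snd r) \<in> measurable ((borel \<Otimes>\<^sub>M borel) \<Otimes>\<^sub>M P) S"
      using measurable_compose[OF measurable_fst measurable_fst] measurable_compose[OF measurable_fst measurable_snd]
        measurable_snd[of "borel \<Otimes>\<^sub>M borel" P] by (simp_all only: measurable_cong_sets[OF refl sets_P])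
    show ?thesis
      unfolding case_prod_beta
      by (rule borel_measurable_times[OF measurable_h[OF m(1) m(3)] measurable_h[OF m(2) m(3)]])
  qed
  then have "(\<lambda>w. \<integral>z. h (fst w) z * h (snd w) z \<partial>P) \<in> borel_measurable (borel \<Otimes>\<^sub>M borel)"
    by (rule P.borel_measurable_lebesgue_integral)
  then show ?thesis unfolding kcov_def case_prod_beta .
qed

lemma kcov_tendsto:
  assumes "a \<longlonglongrightarrow> x" "b \<longlonglongrightarrow> y"
  shows "(\<lambda>i. kcov (a i) (b i)) \<longlonglongrightarrow> kcov x y"
  unfolding kcov_def
proof (rule integral_dominated_convergence[where w="\<lambda>_. C * C"])
  interpret P: prob_space P by (rule prob_space_P)
  show "integrable P (\<lambda>_. C * C)" by simp
  show "AE z in P. (\<lambda>i. h (a i) z * h (b i) z) \<longlonglongrightarrow> h x z * h y z"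
    by (intro AE_I2 tendsto_mult isCont_tendsto_compose[OF cont] assms)
  show "AE z in P. norm (h (a i) z * h (b i) z) \<le> C * C" for i
    using h_mult_bound by simp
qed (rule h_mult_measurable)+

lemma kcov_continuous: "((\<lambda>y. kcov x x - 2 * kcov x y + kcov y y) \<longlongrightarrow> 0) (at x)"
  unfolding tendsto_at_iff_sequentially comp_def
proof (intro allI impI)
  fix a assume "a \<longlonglongrightarrow> x"
  then have "(\<lambda>i. kcov x x - 2 * kcov x (a i) + kcov (a i) (a i)) \<longlonglongrightarrow> kcov x x - 2 * kcov x x + kcov x x"
    by (intro tendsto_intros kcov_tendsto)
  then show "(\<lambda>i. kcov x x - 2 * kcov x (a i) + kcov (a i) (a i)) \<longlonglongrightarrow> 0" by simp
qed

text \<open>At n = 0 this is the zero function, which is why the second-order property begins at n =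
  1.\<close>

definition "emp n x \<omega> = (\<Sum>i<n. h x (X i \<omega>)) / sqrt (real n)"

lemma emp_measurable: "emp n x \<in> borel_measurable M"
  unfolding emp_def
  by (intro borel_measurable_divide borel_measurable_sum borel_measurable_const
    measurable_compose[OF X_measurable h_measurable])

text \<open>By independence and centring, the normalized sums have covariance exactly
  \<open>kcov\<close> for every n >= 1, not merely in the limit.\<close>

lemma emp_second_order:
  assumes n: "n \<ge> 1"
  shows "second_order_process M (emp n) kcov"
  unfolding second_order_process_def L1_valued_def
proof (intro conjI allI ballI)
  show "prob_space M" by unfold_locales
  show "(\<lambda>(x, \<omega>). emp n x \<omega>) \<in> borel_measurable (borel \<Otimes>\<^sub>M M)"
  proof -
    have m: "(\<lambda>r. fst r) \<in> borel_measurable (borel \<Otimes>\<^sub>M M)" "(\<lambda>r. X i (snd r)) \<in> measurable (borel \<Otimes>\<^sub>M M) S" for i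
      using measurable_fst measurable_compose[OF measurable_snd X_measurable] by this+
    show ?thesis
      unfolding emp_def case_prod_beta
      by (rule borel_measurable_divide[OF borel_measurable_sum[OF measurable_h[OF m]] borel_measurable_const])
  qed
  show "integrable lborel (\<lambda>x. emp n x \<omega>)" for \<omega>
    unfolding emp_def by (intro integrable_divide_zero Bochner_Integration.integrable_sum int)
  fix x y
  show "emp n x \<in> borel_measurable M" by (rule emp_measurable)
  note cov = iid_covariance[OF indep distr h_measurable[of x] h_measurable[of y] h_integrable[of x] h_integrable[of y] h_integrable2[of x y] mean[of x], of n]
  have eq: "emp n x \<omega> * emp n y \<omega> = ((\<Sum>i<n. h x (X i \<omega>)) * (\<Sum>i<n. h y (X i \<omega>))) / n" for \<omega>
    unfolding emp_def times_divide_times_eq by simp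
  show "integrable M (\<lambda>\<omega>. emp n x \<omega> * emp n y \<omega>)"
    unfolding eq using cov(1) by simp
  show "(\<integral>\<omega>. emp n x \<omega> * emp n y \<omega> \<partial>M) = kcov x y"
    unfolding eq using cov(2) n by (simp add: kcov_def)
qed

text \<open>Exchanging the two sums shows a linear combination of coordinates to be the normalized
  sum of i.i.d. values of one centred function, whose second moment is
  \<open>quad_form kcov T c\<close>.\<close>

lemma emp_char_tendsto:
  assumes "finite T"
  shows "(\<lambda>n. \<integral>\<omega>. iexp (\<Sum>t\<in>T. c t * emp n t \<omega>) \<partial>M) \<longlonglongrightarrow> exp (- quad_form kcov T c / 2)"
proof -
  have sum_measurable: "(\<lambda>z. \<Sum>t\<in>T. c t * h t z) \<in> borel_measurable S"
    by (intro borel_measurable_sum borel_measurable_times borel_measurable_const h_measurable)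
  have "(\<integral>z. (\<Sum>t\<in>T. c t * h t z) \<partial>P) = 0"
    by (simp add: h_integrable mean)
  from clt_char[OF indep distr sum_measurable this kcov_quad_form(1)]
  have "(\<lambda>n. \<integral>\<omega>. iexp ((\<Sum>i<n. \<Sum>t\<in>T. c t * h t (X i \<omega>)) / sqrt (real n)) \<partial>M) \<longlonglongrightarrow> exp (- quad_form kcov T c / 2)"
    unfolding kcov_quad_form(2) by simp
  moreover have "(\<Sum>i<n. \<Sum>t\<in>T. c t * h t (X i \<omega>)) / sqrt (real n) = (\<Sum>t\<in>T. c t * emp n t \<omega>)" for n \<omega>
    unfolding emp_def by (subst sum.swap) (simp add: sum_divide_distrib sum_distrib_left)
  ultimately show ?thesis by (simp only:)
qed

lemma L1_clt:
  assumes fin: "(\<integral>\<^sup>+x. ennreal (sqrt (kcov x x)) \<partial>lborel) < \<infinity>"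
  shows "\<exists>B. centered_gaussian_process iid_normal B kcov \<and> L1_valued iid_normal B \<and>
    (\<forall>t. (\<lambda>n. \<integral>\<omega>. iexp (t * (\<integral>x. \<bar>emp n x \<omega>\<bar> \<partial>lborel)) \<partial>M)
      \<longlonglongrightarrow> (\<integral>\<omega>. iexp (t * (\<integral>x. \<bar>B x \<omega>\<bar> \<partial>lborel)) \<partial>iid_normal))"
proof -
  obtain D :: "'x set" where D: "countable D" "\<And>U. open U \<Longrightarrow> U \<noteq> {} \<Longrightarrow> \<exists>d\<in>D. d \<in> U"
    by (rule countable_dense_setE[where 'a='x]) blast
  have "D \<noteq> {}" using D(2)[of UNIV] by auto
  then have dense: "\<exists>m. from_nat_into D m \<in> U" if U: "open U" "U \<noteq> {}" for U
  proof -
    obtain d where "d \<in> D" "d \<in> U" using D(2)[OF U] by blast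
    then show ?thesis using from_nat_into_surj[OF D(1)] by blast
  qed
  let ?f = "cholesky (from_nat_into D) kcov"
  have "?f j \<in> borel_measurable borel" for j
  proof (rule borel_measurable_cholesky)
    show "(\<lambda>x. kcov x y) \<in> borel_measurable borel" for y
      using measurable_compose[OF measurable_Pair2'[of y borel borel] kcov_measurable] by simp
  qed
  moreover have "(\<lambda>j. ?f j s * ?f j t) sums kcov s t" for s t
    by (rule cholesky_sums[OF psd_kcov kcov_continuous dense])
  ultimately obtain B0 where "centered_gaussian_process iid_normal B0 kcov"
      "(\<lambda>(x, \<omega>). B0 x \<omega>) \<in> borel_measurable (borel \<Otimes>\<^sub>M iid_normal)"
    using gaussian_series_exists[of ?f kcov] by blast
  from gaussian_process_L1_version[OF this fin]
  obtain B where B: "centered_gaussian_process iid_normal B kcov" "L1_valued iid_normal B" by blast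
  have lim: "(\<lambda>n. \<integral>\<omega>. iexp (t * (\<integral>x. \<bar>emp n x \<omega>\<bar> \<partial>lborel)) \<partial>M)
      \<longlonglongrightarrow> (\<integral>\<omega>. iexp (t * (\<integral>x. \<bar>B x \<omega>\<bar> \<partial>lborel)) \<partial>iid_normal)" for t
  proof (rule second_order_process_L1_norm_tendsto[OF psd_kcov kcov_measurable _ kcov_continuous fin])
    show "kcov x x \<le> C * C" for x
    proof -
      interpret P: prob_space P by (rule prob_space_P)
      have "kcov x x \<le> (\<integral>z. C * C \<partial>P)"
        unfolding kcov_def by (intro integral_mono h_integrable2) (auto intro: abs_le_D1[OF h_mult_bound])
      then show ?thesis by (simp add: P.prob_space)
    qed
    show "prob_space M" by unfold_locales
    show "second_order_process iid_normal B kcov" by (rule gaussian_second_order_process[OF B])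
    show "(\<lambda>n. \<integral>\<omega>. iexp (\<Sum>t\<in>T. c t * emp n t \<omega>) \<partial>M) \<longlonglongrightarrow>
        (\<integral>\<omega>. iexp (\<Sum>t\<in>T. c t * B t \<omega>) \<partial>iid_normal)" if "finite T" for T c
      unfolding gaussian_process_char[OF B(1) that] by (rule emp_char_tendsto[OF that])
    show "emp n x \<in> borel_measurable M" "n \<ge> 1 \<Longrightarrow> second_order_process M (emp n) kcov" for n x
      by (rule emp_measurable emp_second_order; assumption)+
  qed
  with B show ?thesis by blast
qed

end

section \<open>Smooth total variation distance of empirical measures\<close>

theorem theorem1:
  fixes P :: "(real ^ 'd) measure"
    and M :: "'w measure"
    and X :: "nat \<Rightarrow> 'w \<Rightarrow> real ^ 'd"
    and \<sigma> :: real
  assumes "\<sigma> > 0"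
    and "prob_space P" and "sets P = sets borel"
    and "prob_space M"
    and "prob_space.indep_vars M (\<lambda>_. borel) X UNIV"
    and "\<And>i. distr M borel (X i) = P"
    and "(\<integral>\<^sup>+x. ennreal (sqrt (prob_space.variance P (\<lambda>y. gauss_density \<sigma> (x - y)))) \<partial>lborel) < \<infinity>"
  shows "(\<exists>(N :: (nat \<Rightarrow> real) measure) (B :: real ^ 'd \<Rightarrow> (nat \<Rightarrow> real) \<Rightarrow> real).
            centered_gaussian_process N B
              (\<lambda>x y. covariance P (\<lambda>z. gauss_density \<sigma> (x - z)) (\<lambda>z. gauss_density \<sigma> (y - z))) \<and>
            (\<forall>(N' :: 'v measure) B'.
               centered_gaussian_process N' B'
                 (\<lambda>x y. covariance P (\<lambda>z. gauss_density \<sigma> (x - z)) (\<lambda>z. gauss_density \<sigma> (y - z)))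
               \<longrightarrow> is_version N B N' B') \<and>
            L1_valued N B \<and>
            weak_conv_m
              (\<lambda>n. distr M borel
                 (\<lambda>\<omega>. sqrt (real n) * smooth_tv_dist \<sigma> (empirical_measure n (\<lambda>i. X i \<omega>)) P))
              (distr N borel (\<lambda>\<omega>. 1 / 2 * (\<integral>x. \<bar>B x \<omega>\<bar> \<partial>lborel)))) \<and>
         (\<forall>n\<ge>1.
            integrable M (\<lambda>\<omega>. smooth_tv_dist \<sigma> (empirical_measure n (\<lambda>i. X i \<omega>)) P) \<and>
            sqrt (real n) * (\<integral>\<omega>. smooth_tv_dist \<sigma> (empirical_measure n (\<lambda>i. X i \<omega>)) P \<partial>M)
              \<le> 1 / 2 * (\<integral>x. sqrt (prob_space.variance P (\<lambda>y. gauss_density \<sigma> (x - y))) \<partial>lborel))"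
proof -
  interpret P: prob_space P by fact
  interpret M: prob_space M by fact
  note [measurable_cong] = \<open>sets P = sets borel\<close>
  define m where "m y = (\<integral>z. gauss_density \<sigma> (y - z) \<partial>P)" for y
  define h where "h y z = gauss_density \<sigma> (y - z) - m y" for y z
  note integ = integrable_gauss_density[OF P.finite_measure_axioms assms(3)]
  let ?c = "gauss_density \<sigma> (0 :: real ^ 'd)"
  have tv: "sqrt n * smooth_tv_dist \<sigma> (empirical_measure n x) P =
      1 / 2 * (\<integral>y. \<bar>(\<Sum>i<n. h y (x i)) / sqrt n\<bar> \<partial>lborel)" for n x
  \<comment> \<open>At n = 0 the factor \<open>sqrt 0\<close> annihilates the left side, and the
    empty sum the right side.\<close>
  proof (cases "n = 0")
    case False
    then show ?thesis
      using smooth_tv_dist_empirical(1)[OF assms(1-3), of n x] unfolding h_def m_def by simp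
  qed simp
  have m_range: "0 \<le> m y" "m y \<le> ?c" for y
  proof -
    show "0 \<le> m y" unfolding m_def by (intro Bochner_Integration.integral_nonneg gauss_density_nonneg)
    have "m y \<le> (\<integral>z. ?c \<partial>P)"
      unfolding m_def by (intro integral_mono integ gauss_density_le) simp
    then show "m y \<le> ?c" by (simp add: P.prob_space)
  qed
  have gcont: "isCont (\<lambda>y. gauss_density \<sigma> (y - z)) y" for y z :: "real ^ 'd"
  proof -
    have c: "isCont (gauss_density \<sigma>) w" for w :: "real ^ 'd"
      by (rule bspec[OF continuous_on_eq_continuous_at[OF open_UNIV, THEN iffD1, OF continuous_gauss_density]]) simp
    show ?thesis
      by (rule isCont_o2[where f="\<lambda>y. y - z", OF _ c]) (intro continuous_intros)
  qed
  have mcont: "isCont m y" for y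
    unfolding continuous_at_sequentially comp_def
  proof (intro allI impI)
    fix a assume a: "a \<longlonglongrightarrow> y"
    show "(\<lambda>i. m (a i)) \<longlonglongrightarrow> m y"
      unfolding m_def
    proof (rule integral_dominated_convergence[where w="\<lambda>_. ?c"])
      show "AE z in P. (\<lambda>i. gauss_density \<sigma> (a i - z)) \<longlonglongrightarrow> gauss_density \<sigma> (y - z)"
        by (intro AE_I2 isCont_tendsto_compose[OF gcont a])
      show "AE z in P. norm (gauss_density \<sigma> (a i - z)) \<le> ?c" for i
        by (intro AE_I2) (simp add: gauss_density_nonneg gauss_density_le)
    qed (use integ in \<open>auto intro: borel_measurable_integrable\<close>)
  qed
  interpret bounded_kernel_sample M h X borel P ?c
  proof
    show "M.indep_vars (\<lambda>_. borel) X UNIV" by fact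
    show "distr M borel (X i) = P" for i by fact
    have [measurable]: "m \<in> borel_measurable borel"
      using mcont by (intro borel_measurable_continuous_onI) (simp add: continuous_on_eq_continuous_at)
    show "(\<lambda>(x, z). h x z) \<in> borel_measurable (borel \<Otimes>\<^sub>M borel)"
      unfolding h_def by measurable
    show "(\<integral>z. h x z \<partial>P) = 0" for x
      unfolding h_def using integ by (simp add: m_def P.prob_space)
    \<comment> \<open>Both terms of \<open>h\<close> lie between 0 and \<open>?c\<close>, so their
      difference has modulus at most \<open>?c\<close>.\<close>
    show "\<bar>h x z\<bar> \<le> ?c" for x z
      using m_range[of x] gauss_density_nonneg[of \<sigma> "x - z"] gauss_density_le[of \<sigma> "x - z"]
      unfolding h_def by linarith
    show "isCont (\<lambda>x. h x z) x" for x z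
      unfolding h_def by (intro continuous_intros gcont mcont)
    show "integrable lborel (\<lambda>x. h x z)" for z
      \<comment> \<open>The claim does not involve n; 1 is an admissible value for the
        lemma.\<close>
      using smooth_tv_dist_empirical(2)[OF assms(1-3), of 1 z] unfolding h_def m_def by simp
  qed
  have cov: "kcov = (\<lambda>x y. covariance P (\<lambda>z. gauss_density \<sigma> (x - z)) (\<lambda>z. gauss_density \<sigma> (y - z)))"
    unfolding kcov_def covariance_def h_def m_def ..
  have var: "prob_space.variance P (\<lambda>z. gauss_density \<sigma> (x - z)) = kcov x x" for x
    unfolding kcov_def h_def m_def power2_eq_square ..
  have fin: "(\<integral>\<^sup>+x. ennreal (sqrt (kcov x x)) \<partial>lborel) < \<infinity>"
    using assms(7) unfolding var .
  have emp_eq: "emp n y \<omega> = (\<Sum>i<n. h y (X i \<omega>)) / sqrt n" for n y \<omega>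
    by (simp add: emp_def)
  have tv_emp: "sqrt n * smooth_tv_dist \<sigma> (empirical_measure n (\<lambda>i. X i \<omega>)) P =
      1 / 2 * (\<integral>y. \<bar>emp n y \<omega>\<bar> \<partial>lborel)" for n \<omega>
    unfolding tv emp_eq ..
  have meas: "(\<lambda>\<omega>. \<integral>y. \<bar>emp n y \<omega>\<bar> \<partial>lborel) \<in> borel_measurable M" for n
  proof (cases "n = 0")
    case True
    then show ?thesis by (simp add: emp_eq)
  next
    case False
    then show ?thesis by (intro second_order_process_measurable(2)[OF emp_second_order]) simp
  qed
  obtain B where B: "centered_gaussian_process iid_normal B kcov" "L1_valued iid_normal B"
    and lim: "\<And>t. (\<lambda>n. \<integral>\<omega>. iexp (t * (\<integral>x. \<bar>emp n x \<omega>\<bar> \<partial>lborel)) \<partial>M)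
      \<longlonglongrightarrow> (\<integral>\<omega>. iexp (t * (\<integral>x. \<bar>B x \<omega>\<bar> \<partial>lborel)) \<partial>iid_normal)"
    using L1_clt[OF fin] by blast
  have Bmeas: "(\<lambda>\<omega>. \<integral>x. \<bar>B x \<omega>\<bar> \<partial>lborel) \<in> borel_measurable iid_normal"
    by (rule second_order_process_measurable(2)[OF gaussian_second_order_process[OF B]])
  \<comment> \<open>The factor 1/2 moves into the frequency, so that \<open>lim\<close> at t / 2 is
    the convergence required by Levy's theorem.\<close>
  have char_half: "char (distr R borel (\<lambda>\<omega>. 1 / 2 * Y \<omega>)) t = (\<integral>\<omega>. iexp (t / 2 * Y \<omega>) \<partial>R)"
    if [measurable]: "Y \<in> borel_measurable R" for R :: "'r measure" and Y t
    unfolding char_def by (subst integral_distr) auto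
  have weak: "weak_conv_m
      (\<lambda>n. distr M borel (\<lambda>\<omega>. sqrt (real n) * smooth_tv_dist \<sigma> (empirical_measure n (\<lambda>i. X i \<omega>)) P))
      (distr iid_normal borel (\<lambda>\<omega>. 1 / 2 * (\<integral>x. \<bar>B x \<omega>\<bar> \<partial>lborel)))"
    unfolding tv_emp
  proof (rule levy_continuity)
    show "real_distribution (distr M borel (\<lambda>\<omega>. 1 / 2 * (\<integral>y. \<bar>emp n y \<omega>\<bar> \<partial>lborel)))" for n
      by (intro M.real_distribution_distr borel_measurable_times borel_measurable_const meas)
    show "real_distribution (distr iid_normal borel (\<lambda>\<omega>. 1 / 2 * (\<integral>x. \<bar>B x \<omega>\<bar> \<partial>lborel)))"
      by (intro iid_normal.real_distribution_distr borel_measurable_times borel_measurable_const Bmeas)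
    show "(\<lambda>n. char (distr M borel (\<lambda>\<omega>. 1 / 2 * (\<integral>y. \<bar>emp n y \<omega>\<bar> \<partial>lborel))) t)
        \<longlonglongrightarrow> char (distr iid_normal borel (\<lambda>\<omega>. 1 / 2 * (\<integral>x. \<bar>B x \<omega>\<bar> \<partial>lborel))) t" for t
      unfolding char_half[OF meas] char_half[OF Bmeas] by (rule lim)
  qed
  have mean: "integrable M (\<lambda>\<omega>. smooth_tv_dist \<sigma> (empirical_measure n (\<lambda>i. X i \<omega>)) P)"
      "sqrt (real n) * (\<integral>\<omega>. smooth_tv_dist \<sigma> (empirical_measure n (\<lambda>i. X i \<omega>)) P \<partial>M)
        \<le> 1 / 2 * (\<integral>x. sqrt (kcov x x) \<partial>lborel)" if n: "n \<ge> 1" for n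
  proof -
    note L1 = second_order_process_L1_norm[OF emp_second_order[OF n] fin]
    have tv': "smooth_tv_dist \<sigma> (empirical_measure n (\<lambda>i. X i \<omega>)) P =
        1 / (2 * sqrt n) * (\<integral>y. \<bar>emp n y \<omega>\<bar> \<partial>lborel)" for \<omega>
      using tv_emp[of n \<omega>] n by (simp add: field_simps)
    show "integrable M (\<lambda>\<omega>. smooth_tv_dist \<sigma> (empirical_measure n (\<lambda>i. X i \<omega>)) P)"
      unfolding tv' by (intro integrable_mult_right L1)
    have "(\<lambda>x. sqrt (kcov x x)) \<in> borel_measurable borel"
      using measurable_compose[OF measurable_Pair[OF measurable_ident measurable_ident] kcov_measurable] by simp
    then have "integrable lborel (\<lambda>x. sqrt (kcov x x))"
      using fin psd_kernel_diag[OF psd_kcov] by (intro integrableI_nonneg) auto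
    then have "(\<integral>\<^sup>+x. ennreal (sqrt (kcov x x)) \<partial>lborel) = ennreal (\<integral>x. sqrt (kcov x x) \<partial>lborel)"
      using psd_kernel_diag[OF psd_kcov] by (intro nn_integral_eq_integral) auto
    then have "(\<integral>\<omega>. (\<integral>y. \<bar>emp n y \<omega>\<bar> \<partial>lborel) \<partial>M) \<le> (\<integral>x. sqrt (kcov x x) \<partial>lborel)"
      using L1(2) psd_kernel_diag[OF psd_kcov] by (simp add: ennreal_le_iff integral_nonneg_AE)
    then show "sqrt (real n) * (\<integral>\<omega>. smooth_tv_dist \<sigma> (empirical_measure n (\<lambda>i. X i \<omega>)) P \<partial>M)
        \<le> 1 / 2 * (\<integral>x. sqrt (kcov x x) \<partial>lborel)"
      unfolding tv' integral_mult_right_zero using n by simp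
  qed
  show ?thesis
    unfolding var cov[symmetric]
    using B weak mean gaussian_process_is_version[OF B(1)] by blast
qed

end
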